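(* Let $\beta>\overline\beta>0$ and let $u\in\operatorname{dom}(\mathcal{L}^\beta)$ be the exact solution of $\mathcal{L}^\beta u=f$. Assume that there exist constants $C_f,R_f>0$ and $\omega\ge0$ such that $$\|f\|_{\mathbb{H}^\rho(\Omega)}\le C_f\,R_f^\rho\,(\Gamma(\rho+1))^\omega<\infty\qquad\forall\rho\ge0 .$$ Let $u_k:=Q^{\mathcal{L}}(z^{-\beta},\mathcal{N}_q)f$ denote the approximation computed using step size $k\in(0,1/2)$ and $\mathcal{N}_q\in\mathbb{N}$ quadrature points. Then $$\|u-u_k\|_{\mathbb{H}^\beta(\Omega)}=\|E^{\mathcal{L}}(z^{-\beta},\mathcal{N}_q)f\|_{\mathbb{H}^\beta(\Omega)}\le C\Big[C_f\exp\Big(-\frac{\gamma}{k|\ln k|}\Big)+C_f\exp(-\gamma e^{k\mathcal{N}_q})\Big].$$ The constants $C,\gamma>0$ are independent of $k$ and $\mathcal{N}_q$; they may depend on $\omega$, the smallest eigenvalue $\lambda_0$ of $\mathcal{L}$, $\kappa,\theta,\sigma,R_f,\overline\beta$. If $\omega=0$, the logarithmic term may be removed, i.e. $\exp(-\gamma/(k|\ln k|))$ may be replaced by $\exp(-\gamma/k)$.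
   Context: Let $\Omega\subset\mathbb{R}^d$ be a bounded Lipschitz domain, $\mathfrak{A}\in L^\infty(\Omega;\mathbb{R}^{d\times d})$ uniformly symmetric positive definite, $\mathfrak{c}\in L^\infty(\Omega)$ with $\mathfrak{c}\ge0$ a.e., and $\mathcal{L}u:=-\operatorname{div}(\mathfrak{A}\nabla u)+\mathfrak{c}u$ with homogeneous Dirichlet boundary conditions, a self-adjoint operator on $L^2(\Omega)$ with eigenvalues and $L^2$-orthonormal eigenfunctions $(\lambda_j,v_j)_{j=0}^\infty$, $\lambda_0$ being the smallest eigenvalue. For $\beta\ge0$, $\mathbb{H}^\beta(\Omega):=\{u\in L^2(\Omega):\|u\|_{\mathbb{H}^\beta(\Omega)}<\infty\}$ with $\|u\|_{\mathbb{H}^\beta(\Omega)}^2:=\sum_j\lambda_j^\beta|(u,v_j)_{L^2(\Omega)}|^2$. Functions of $\mathcal{L}$ (in particular $\mathcal{L}^\beta$) are defined by $g(\mathcal{L})u=\sum_j g(\lambda_j)(u,v_j)_{L^2(\Omega)}v_j$ (equivalently by the Riesz–Dunford integral). Fix $\sigma\in\{1/2,1\}$, $\theta\ge1$ and $0<\kappa<\lambda_0$. Define $\psi_{\sigma,\theta}(y):=\kappa\big[\cosh(\tfrac{\sigma\pi}{2}\sinh y)+i\theta\sinh(\tfrac{\pi}{2}\sinh y)\big]$. For step size $k>0$ and $\mathcal{N}_q\in\mathbb{N}$, $$Q^{\mathcal{L}}(g,\mathcal{N}_q)u:=\frac{k}{2\pi i}\sum_{j=-\mathcal{N}_q}^{\mathcal{N}_q}g(\psi_{\sigma,\theta}(jk))\,\psi_{\sigma,\theta}'(jk)\,(\mathcal{L}-\psi_{\sigma,\theta}(jk))^{-1}u,\qquad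 E^{\mathcal{L}}(g,\mathcal{N}_q)u:=g(\mathcal{L})u-Q^{\mathcal{L}}(g,\mathcal{N}_q)u.$$ Powers are principal; $\Gamma$ is the Gamma function.
   Formalization: The constant C may also depend on an upper bound for β (γ does not); C uniform in all β>β̄ is false: for f=v_0, ω=0, C_f=1, R_f=λ_0=1, κ=1/2, N_q=0 and fixed k, the error grows like 2^β while the right side stays fixed. *)

theory Defs
  imports "HOL-Analysis.Analysis"
begin

text \<open>
  Conventions. Functions on \<open>\<Omega>\<close> are total functions on \<open>\<real>\<^sup>d\<close> of which only the values on \<open>\<Omega>\<close>
  matter; equality in \<open>L\<^sup>2(\<Omega>)\<close> is equality almost everywhere in \<open>lebesgue_on \<Omega>\<close>. All function
  spaces are complex, because the resolvents are taken at non-real points.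
\<close>

section \<open>Domains and coefficients\<close>

text \<open>Near each boundary point the domain is, for some unit vector \<open>e\<close>, the strict epigraph in
  direction \<open>e\<close> of a Lipschitz function on the hyperplane orthogonal to \<open>e\<close>.\<close>

definition bounded_lipschitz_domain :: "(real ^ 'n) set \<Rightarrow> bool" where
  "bounded_lipschitz_domain \<Omega> \<longleftrightarrow>
     open \<Omega> \<and> connected \<Omega> \<and> \<Omega> \<noteq> {} \<and> bounded \<Omega> \<and>
     (\<forall>x\<in>frontier \<Omega>. \<exists>r>0. \<exists>e h M. norm e = 1 \<and> M-lipschitz_on {y. y \<bullet> e = 0} h \<and>
        \<Omega> \<inter> ball x r = {y \<in> ball x r. h (y - (y \<bullet> e) *\<^sub>R e) < y \<bullet> e})"

definition Linfty :: "(real ^ 'n) set \<Rightarrow> (real ^ 'n \<Rightarrow> 'b::euclidean_space) set" where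
  "Linfty \<Omega> = {g \<in> borel_measurable (lebesgue_on \<Omega>). \<exists>M. AE x in lebesgue_on \<Omega>. norm (g x) \<le> M}"

definition uniformly_spd :: "(real ^ 'n) set \<Rightarrow> (real ^ 'n \<Rightarrow> real ^ 'n ^ 'n) \<Rightarrow> bool" where
  "uniformly_spd \<Omega> A \<longleftrightarrow> (\<exists>\<alpha>>0. AE x in lebesgue_on \<Omega>.
     transpose (A x) = A x \<and> (\<forall>\<xi>. \<alpha> * (norm \<xi>)\<^sup>2 \<le> \<xi> \<bullet> (A x *v \<xi>)))"

definition admissible_problem ::
  "(real ^ 'n) set \<Rightarrow> (real ^ 'n \<Rightarrow> real ^ 'n ^ 'n) \<Rightarrow> (real ^ 'n \<Rightarrow> real) \<Rightarrow> bool" where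
  "admissible_problem \<Omega> A c \<longleftrightarrow>
     bounded_lipschitz_domain \<Omega> \<and>
     A \<in> Linfty \<Omega> \<and> uniformly_spd \<Omega> A \<and>
     c \<in> Linfty \<Omega> \<and> (AE x in lebesgue_on \<Omega>. 0 \<le> c x)"

section \<open>The spaces \<open>L\<^sup>2(\<Omega>)\<close> and \<open>H\<^sup>1\<^sub>0(\<Omega>)\<close>\<close>

definition L2 :: "(real ^ 'n) set \<Rightarrow> (real ^ 'n \<Rightarrow> 'b::euclidean_space) set" where
  "L2 \<Omega> = {u \<in> borel_measurable (lebesgue_on \<Omega>). integrable (lebesgue_on \<Omega>) (\<lambda>x. (norm (u x))\<^sup>2)}"

definition L2_norm :: "(real ^ 'n) set \<Rightarrow> (real ^ 'n \<Rightarrow> 'b::euclidean_space) \<Rightarrow> real" where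
  "L2_norm \<Omega> u = sqrt (\<integral>x. (norm (u x))\<^sup>2 \<partial>lebesgue_on \<Omega>)"

definition L2_inner :: "(real ^ 'n) set \<Rightarrow> (real ^ 'n \<Rightarrow> complex) \<Rightarrow> (real ^ 'n \<Rightarrow> complex) \<Rightarrow> complex" where
  "L2_inner \<Omega> u v = (\<integral>x. u x * cnj (v x) \<partial>lebesgue_on \<Omega>)"

definition partial_deriv :: "'n \<Rightarrow> (real ^ 'n \<Rightarrow> complex) \<Rightarrow> real ^ 'n \<Rightarrow> complex" where
  "partial_deriv i f x = frechet_derivative f (at x) (axis i 1)"

definition gradient :: "(real ^ 'n \<Rightarrow> complex) \<Rightarrow> real ^ 'n \<Rightarrow> complex ^ 'n" where
  "gradient f x = (\<chi> i. partial_deriv i f x)"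

definition smooth :: "(real ^ 'n \<Rightarrow> complex) \<Rightarrow> bool" where
  "smooth f \<longleftrightarrow> (\<forall>is. foldr partial_deriv is f differentiable_on UNIV)"

definition test_function :: "(real ^ 'n) set \<Rightarrow> (real ^ 'n \<Rightarrow> complex) \<Rightarrow> bool" where
  "test_function \<Omega> \<phi> \<longleftrightarrow> smooth \<phi> \<and> compact (closure {x. \<phi> x \<noteq> 0}) \<and> closure {x. \<phi> x \<noteq> 0} \<subseteq> \<Omega>"

definition weak_gradient ::
  "(real ^ 'n) set \<Rightarrow> (real ^ 'n \<Rightarrow> complex) \<Rightarrow> (real ^ 'n \<Rightarrow> complex ^ 'n) \<Rightarrow> bool" where
  "weak_gradient \<Omega> u G \<longleftrightarrow> (\<forall>\<phi> i. test_function \<Omega> \<phi> \<longrightarrow>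
     (\<integral>x. u x * partial_deriv i \<phi> x \<partial>lebesgue_on \<Omega>) = - (\<integral>x. G x $ i * \<phi> x \<partial>lebesgue_on \<Omega>))"

text \<open>\<open>H10_with_gradient \<Omega> u G\<close>: \<open>u\<close> lies in \<open>H\<^sup>1\<^sub>0(\<Omega>)\<close>, the closure of the test functions
  in the \<open>H\<^sup>1\<close> norm, and \<open>G\<close> is (a representative of) its weak gradient.\<close>

definition H10_with_gradient ::
  "(real ^ 'n) set \<Rightarrow> (real ^ 'n \<Rightarrow> complex) \<Rightarrow> (real ^ 'n \<Rightarrow> complex ^ 'n) \<Rightarrow> bool" where
  "H10_with_gradient \<Omega> u G \<longleftrightarrow>
     u \<in> L2 \<Omega> \<and> G \<in> L2 \<Omega> \<and> weak_gradient \<Omega> u G \<and>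
     (\<exists>\<phi>. (\<forall>n::nat. test_function \<Omega> (\<phi> n)) \<and>
          (\<lambda>n. L2_norm \<Omega> (\<lambda>x. u x - \<phi> n x)) \<longlonglongrightarrow> 0 \<and>
          (\<lambda>n. L2_norm \<Omega> (\<lambda>x. G x - gradient (\<phi> n) x)) \<longlonglongrightarrow> 0)"

section \<open>The operator, its eigensystem and its resolvent\<close>

definition energy_form ::
  "(real ^ 'n) set \<Rightarrow> (real ^ 'n \<Rightarrow> real ^ 'n ^ 'n) \<Rightarrow> (real ^ 'n \<Rightarrow> real) \<Rightarrow>
   (real ^ 'n \<Rightarrow> complex) \<Rightarrow> (real ^ 'n \<Rightarrow> complex ^ 'n) \<Rightarrow>
   (real ^ 'n \<Rightarrow> complex) \<Rightarrow> (real ^ 'n \<Rightarrow> complex ^ 'n) \<Rightarrow> complex" where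
  "energy_form \<Omega> A c w G \<phi> H =
     (\<integral>x. (\<Sum>i\<in>UNIV. \<Sum>j\<in>UNIV. complex_of_real (A x $ i $ j) * (G x $ j) * cnj (H x $ i))
          + complex_of_real (c x) * w x * cnj (\<phi> x) \<partial>lebesgue_on \<Omega>)"

text \<open>The graph of \<open>\<L> = -div(A \<nabla>) + c\<close> with homogeneous Dirichlet conditions, as an unbounded
  operator on \<open>L\<^sup>2(\<Omega>)\<close>: \<open>elliptic_op \<Omega> A c w h\<close> means \<open>w \<in> dom(\<L>)\<close> and \<open>\<L> w = h\<close>.\<close>

definition elliptic_op ::
  "(real ^ 'n) set \<Rightarrow> (real ^ 'n \<Rightarrow> real ^ 'n ^ 'n) \<Rightarrow> (real ^ 'n \<Rightarrow> real) \<Rightarrow>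
   (real ^ 'n \<Rightarrow> complex) \<Rightarrow> (real ^ 'n \<Rightarrow> complex) \<Rightarrow> bool" where
  "elliptic_op \<Omega> A c w h \<longleftrightarrow>
     h \<in> L2 \<Omega> \<and>
     (\<exists>G. H10_with_gradient \<Omega> w G \<and>
          (\<forall>\<phi> H. H10_with_gradient \<Omega> \<phi> H \<longrightarrow> energy_form \<Omega> A c w G \<phi> H = L2_inner \<Omega> h \<phi>))"

text \<open>An orthonormal basis of \<open>L\<^sup>2(\<Omega>)\<close> of eigenfunctions, the first one belonging to the
  smallest eigenvalue.\<close>

definition eigensystem ::
  "(real ^ 'n) set \<Rightarrow> (real ^ 'n \<Rightarrow> real ^ 'n ^ 'n) \<Rightarrow> (real ^ 'n \<Rightarrow> real) \<Rightarrow>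
   (nat \<Rightarrow> real) \<Rightarrow> (nat \<Rightarrow> real ^ 'n \<Rightarrow> complex) \<Rightarrow> bool" where
  "eigensystem \<Omega> A c lam v \<longleftrightarrow>
     (\<forall>j. elliptic_op \<Omega> A c (v j) (\<lambda>x. complex_of_real (lam j) * v j x)) \<and>
     (\<forall>i j. L2_inner \<Omega> (v i) (v j) = (if i = j then 1 else 0)) \<and>
     (\<forall>u\<in>L2 \<Omega>. (\<lambda>n. L2_norm \<Omega> (\<lambda>x. u x - (\<Sum>j<n. L2_inner \<Omega> u (v j) * v j x))) \<longlonglongrightarrow> 0) \<and>
     (\<forall>j. lam 0 \<le> lam j)"

text \<open>\<open>(\<L> - z)\<^sup>-\<^sup>1 u\<close>: the solution \<open>w \<in> dom(\<L>)\<close>, unique up to null sets for \<open>z\<close> off the spectrum,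
  of \<open>\<L> w = u + z w\<close>.\<close>

definition resolvent ::
  "(real ^ 'n) set \<Rightarrow> (real ^ 'n \<Rightarrow> real ^ 'n ^ 'n) \<Rightarrow> (real ^ 'n \<Rightarrow> real) \<Rightarrow>
   complex \<Rightarrow> (real ^ 'n \<Rightarrow> complex) \<Rightarrow> real ^ 'n \<Rightarrow> complex" where
  "resolvent \<Omega> A c z u = (SOME w. elliptic_op \<Omega> A c w (\<lambda>x. u x + z * w x))"

section \<open>Functional calculus and the spaces \<open>\<H>\<^sup>\<beta>(\<Omega>)\<close>\<close>

definition fun_op_dom ::
  "(real ^ 'n) set \<Rightarrow> (nat \<Rightarrow> real) \<Rightarrow> (nat \<Rightarrow> real ^ 'n \<Rightarrow> complex) \<Rightarrow>
   (complex \<Rightarrow> complex) \<Rightarrow> (real ^ 'n \<Rightarrow> complex) set" where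
  "fun_op_dom \<Omega> lam v g =
     {u \<in> L2 \<Omega>. summable (\<lambda>j. (cmod (g (complex_of_real (lam j)) * L2_inner \<Omega> u (v j)))\<^sup>2)}"

definition fun_op ::
  "(real ^ 'n) set \<Rightarrow> (nat \<Rightarrow> real) \<Rightarrow> (nat \<Rightarrow> real ^ 'n \<Rightarrow> complex) \<Rightarrow>
   (complex \<Rightarrow> complex) \<Rightarrow> (real ^ 'n \<Rightarrow> complex) \<Rightarrow> real ^ 'n \<Rightarrow> complex" where
  "fun_op \<Omega> lam v g u = (SOME w. w \<in> L2 \<Omega> \<and>
     (\<lambda>n. L2_norm \<Omega> (\<lambda>x. w x -
        (\<Sum>j<n. g (complex_of_real (lam j)) * L2_inner \<Omega> u (v j) * v j x))) \<longlonglongrightarrow> 0)"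

definition Hdot ::
  "(real ^ 'n) set \<Rightarrow> (nat \<Rightarrow> real) \<Rightarrow> (nat \<Rightarrow> real ^ 'n \<Rightarrow> complex) \<Rightarrow> real \<Rightarrow>
   (real ^ 'n \<Rightarrow> complex) set" where
  "Hdot \<Omega> lam v \<beta> =
     {u \<in> L2 \<Omega>. summable (\<lambda>j. lam j powr \<beta> * (cmod (L2_inner \<Omega> u (v j)))\<^sup>2)}"

text \<open>Meaningful only on \<^term>\<open>Hdot \<Omega> lam v \<beta>\<close>, where the series converges.\<close>

definition Hdot_norm ::
  "(real ^ 'n) set \<Rightarrow> (nat \<Rightarrow> real) \<Rightarrow> (nat \<Rightarrow> real ^ 'n \<Rightarrow> complex) \<Rightarrow> real \<Rightarrow>
   (real ^ 'n \<Rightarrow> complex) \<Rightarrow> real" where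
  "Hdot_norm \<Omega> lam v \<beta> u = sqrt (\<Sum>j. lam j powr \<beta> * (cmod (L2_inner \<Omega> u (v j)))\<^sup>2)"

section \<open>Double exponential quadrature\<close>

definition psi :: "real \<Rightarrow> real \<Rightarrow> real \<Rightarrow> real \<Rightarrow> complex" where
  "psi \<sigma> \<theta> \<kappa> y = complex_of_real \<kappa> *
     (complex_of_real (cosh (\<sigma> * pi / 2 * sinh y)) +
      \<i> * complex_of_real (\<theta> * sinh (pi / 2 * sinh y)))"

definition quad_op ::
  "(real ^ 'n) set \<Rightarrow> (real ^ 'n \<Rightarrow> real ^ 'n ^ 'n) \<Rightarrow> (real ^ 'n \<Rightarrow> real) \<Rightarrow>
   real \<Rightarrow> real \<Rightarrow> real \<Rightarrow> real \<Rightarrow> (complex \<Rightarrow> complex) \<Rightarrow> nat \<Rightarrow>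
   (real ^ 'n \<Rightarrow> complex) \<Rightarrow> real ^ 'n \<Rightarrow> complex" where
  "quad_op \<Omega> A c \<sigma> \<theta> \<kappa> k g N u x =
     complex_of_real k / (2 * complex_of_real pi * \<i>) *
     (\<Sum>j = - int N..int N.
        g (psi \<sigma> \<theta> \<kappa> (real_of_int j * k)) *
        vector_derivative (psi \<sigma> \<theta> \<kappa>) (at (real_of_int j * k)) *
        resolvent \<Omega> A c (psi \<sigma> \<theta> \<kappa> (real_of_int j * k)) u x)"

definition quad_error ::
  "(real ^ 'n) set \<Rightarrow> (real ^ 'n \<Rightarrow> real ^ 'n ^ 'n) \<Rightarrow> (real ^ 'n \<Rightarrow> real) \<Rightarrow>
   (nat \<Rightarrow> real) \<Rightarrow> (nat \<Rightarrow> real ^ 'n \<Rightarrow> complex) \<Rightarrow>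
   real \<Rightarrow> real \<Rightarrow> real \<Rightarrow> real \<Rightarrow> (complex \<Rightarrow> complex) \<Rightarrow> nat \<Rightarrow>
   (real ^ 'n \<Rightarrow> complex) \<Rightarrow> real ^ 'n \<Rightarrow> complex" where
  "quad_error \<Omega> A c lam v \<sigma> \<theta> \<kappa> k g N u x =
     fun_op \<Omega> lam v g u x - quad_op \<Omega> A c \<sigma> \<theta> \<kappa> k g N u x"

end

(*
On an eigenfunction with eigenvalue l the quadrature acts as the scalar function
  e(l) = l^(-b) - k/(2 pi i) * sum_{|j| <= N} psi(jk)^(-b) psi'(jk) / (l - psi(jk)),
so the error is a weighted l^2 sum of |e(lambda_j)|^2 |(f,v_j)|^2.

The integrand extends holomorphically to the strip |Im y| < width l ~ 1/(1 + ln l): there psi wraps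
around the origin, but it has no zeros and does not meet l.  Comparing the trapezoidal sum with the
integral through the kernel 1/(exp(2 pi i y/k) - 1) costs exp(-pi width(l)/k), truncating the sum costs
a double exponential, and both hold up to a factor l.

The growth condition on f makes |(f,v_j)| decay like exp(-c lambda_j^(1/(2 omega))).  Splitting the
spectrum at lambda ~ (1/k)^(2 omega), the strip width is at least of order 1/|ln k| below the threshold,
and the coefficients above it contribute exp(-c/k).  For omega = 0 the threshold does not depend on k,
so no logarithm appears.
*)
theory Submission
  imports Defs "HOL-Complex_Analysis.Complex_Analysis"
begin

section \<open>The space \<open>L\<^sup>2\<close>\<close>

text \<open>The difficulty is uniformity in the eigenvalue l. With s = (pi/2) sinh y, a point of
  height d above the real y-axis has |Im s| of order d cosh (Re y), which is unbounded, so no strip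
  in y is mapped into a thin strip in s. Two facts rescue the estimate. Where |Re s| is large, |Psi|
  is at least a multiple of exp |Re s| whatever Im s is; once this exceeds 2 l, the distance to l
  needs no control of Im s. Before that, |Re s| is below ln (C1 l), so cosh (Re y) is at most of
  order 1 + ln (C1 l), and a height d of the inverse order keeps |Im s| below a constant. This fixes
  \<open>width\<close>. Since Psi winds around 0 there, its power is defined through a primitive of
  Psi'/Psi. The losses of a factor l and of the weight l^beta are harmless, because moments of every
  order of the data are under control. Resolvents and functions of the operator are arbitrarily
  chosen representatives; the proof reads off only their coefficients against the
  eigenfunctions.\<close>

lemma L2_measurable: "u \<in> L2 \<Omega> \<Longrightarrow> u \<in> borel_measurable (lebesgue_on \<Omega>)"
  by (simp add: L2_def)

lemma L2_integrable: "u \<in> L2 \<Omega> \<Longrightarrow> integrable (lebesgue_on \<Omega>) (\<lambda>x. (norm (u x))\<^sup>2)"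
  by (simp add: L2_def)

lemma L2_norm_nonneg [simp]: "0 \<le> L2_norm \<Omega> u"
  by (simp add: L2_norm_def integral_nonneg_AE)

lemma L2_norm_power2: "(L2_norm \<Omega> u)\<^sup>2 = (\<integral>x. (norm (u x))\<^sup>2 \<partial>lebesgue_on \<Omega>)"
  by (simp add: L2_norm_def integral_nonneg_AE)

lemma L2_add:
  assumes "u \<in> L2 \<Omega>" "v \<in> L2 \<Omega>"
  shows "(\<lambda>x. u x + v x) \<in> L2 \<Omega>"
proof -
  note [measurable] = assms[THEN L2_measurable]
  have "integrable (lebesgue_on \<Omega>) (\<lambda>x. (norm (u x + v x))\<^sup>2)"
  proof (rule Bochner_Integration.integrable_bound)
    show "integrable (lebesgue_on \<Omega>) (\<lambda>x. 2 * (norm (u x))\<^sup>2 + 2 * (norm (v x))\<^sup>2)"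
      using assms by (simp add: L2_def)
    have "(norm (a + b))\<^sup>2 \<le> 2 * (norm a)\<^sup>2 + 2 * (norm b)\<^sup>2" for a b :: 'b
    proof -
      have "(norm (a + b))\<^sup>2 \<le> (norm a + norm b)\<^sup>2"
        by (intro power_mono norm_triangle_ineq) auto
      also have "\<dots> \<le> 2 * (norm a)\<^sup>2 + 2 * (norm b)\<^sup>2"
        using sum_squares_bound[of "norm a" "norm b"] by (simp add: power2_sum)
      finally show ?thesis .
    qed
    then show "AE x in lebesgue_on \<Omega>. norm ((norm (u x + v x))\<^sup>2) \<le> norm (2 * (norm (u x))\<^sup>2 + 2 * (norm (v x))\<^sup>2)"
      by (intro AE_I2) (simp add: add_nonneg_nonneg)
  qed measurable
  then show ?thesis
    by (simp add: L2_def)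
qed

lemma L2_scale:
  fixes u :: "real ^ 'n \<Rightarrow> complex"
  assumes "u \<in> L2 \<Omega>"
  shows "(\<lambda>x. a * u x) \<in> L2 \<Omega>"
  using assms by (auto simp: L2_def norm_mult power_mult_distrib)

lemma L2_uminus: "u \<in> L2 \<Omega> \<Longrightarrow> (\<lambda>x. - u x) \<in> L2 \<Omega>"
  by (auto simp: L2_def)

lemma L2_diff: "u \<in> L2 \<Omega> \<Longrightarrow> v \<in> L2 \<Omega> \<Longrightarrow> (\<lambda>x. u x - v x) \<in> L2 \<Omega>"
  using L2_add[OF _ L2_uminus, of u \<Omega> v] by simp

lemma L2_zero: "(\<lambda>x. 0) \<in> L2 \<Omega>"
  by (simp add: L2_def)

lemma L2_sum: "(\<And>i. i \<in> I \<Longrightarrow> u i \<in> L2 \<Omega>) \<Longrightarrow> (\<lambda>x. \<Sum>i\<in>I. u i x) \<in> L2 \<Omega>"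
  by (induction I rule: infinite_finite_induct) (auto intro: L2_add L2_zero)

lemma L2_norm_mult_integrable:
  assumes "u \<in> L2 \<Omega>" "v \<in> L2 \<Omega>"
  shows "integrable (lebesgue_on \<Omega>) (\<lambda>x. norm (u x) * norm (v x))"
proof (rule Bochner_Integration.integrable_bound)
  note [measurable] = assms[THEN L2_measurable]
  show "integrable (lebesgue_on \<Omega>) (\<lambda>x. (norm (u x))\<^sup>2 + (norm (v x))\<^sup>2)"
    using assms by (simp add: L2_def)
  have "norm (u x) * norm (v x) \<le> (norm (u x))\<^sup>2 + (norm (v x))\<^sup>2" for x
  proof -
    have "0 \<le> norm (u x) * norm (v x)" by simp
    then show ?thesis
      using sum_squares_bound[of "norm (u x)" "norm (v x)"] by linarith
  qed
  then show "AE x in lebesgue_on \<Omega>. norm (norm (u x) * norm (v x)) \<le> norm ((norm (u x))\<^sup>2 + (norm (v x))\<^sup>2)"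
    by (intro AE_I2) simp
  show "(\<lambda>x. norm (u x) * norm (v x)) \<in> borel_measurable (lebesgue_on \<Omega>)" by measurable
qed

text \<open>The integral of (s |u| - |v|)^2 is a nonnegative quadratic in s, so its discriminant is
  not positive. Stated for the product of the norms, the inequality allows u and v to have different
  value types and serves scalar functions and gradients alike.\<close>

lemma L2_Cauchy_Schwarz:
  assumes "u \<in> L2 \<Omega>" "v \<in> L2 \<Omega>"
  shows "(\<integral>x. norm (u x) * norm (v x) \<partial>lebesgue_on \<Omega>) \<le> L2_norm \<Omega> u * L2_norm \<Omega> v"
proof -
  let ?M = "lebesgue_on \<Omega>"
  note [measurable] = assms[THEN L2_measurable]
  note int = L2_norm_mult_integrable[OF assms] assms[THEN L2_integrable]
  define P where "P = (\<integral>x. norm (u x) * norm (v x) \<partial>?M)"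
  define A where "A = (\<integral>x. (norm (u x))\<^sup>2 \<partial>?M)"
  define B where "B = (\<integral>x. (norm (v x))\<^sup>2 \<partial>?M)"
  have quad: "0 \<le> s\<^sup>2 * A - 2 * s * P + B" for s
  proof -
    have "0 \<le> (\<integral>x. (s * norm (u x) - norm (v x))\<^sup>2 \<partial>?M)"
      by (simp add: integral_nonneg_AE)
    also have "\<dots> = (\<integral>x. s\<^sup>2 * (norm (u x))\<^sup>2 - 2 * s * (norm (u x) * norm (v x)) + (norm (v x))\<^sup>2 \<partial>?M)"
      by (intro Bochner_Integration.integral_cong) (auto simp: power2_eq_square algebra_simps)
    also have "\<dots> = s\<^sup>2 * A - 2 * s * P + B"
      using int by (simp add: A_def P_def B_def)
    finally show ?thesis .
  qed
  have nonneg: "0 \<le> P" "0 \<le> A" "0 \<le> B"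
    by (auto simp: P_def A_def B_def integral_nonneg_AE)
  have "P\<^sup>2 \<le> A * B"
  proof (cases "A = 0")
    case True
    have "P \<le> 0"
    proof (rule ccontr)
      assume "\<not> P \<le> 0"
      \<comment> \<open>With \<open>A = 0\<close> the quadratic is affine in s, and this s gives it
        the value -B - 2.\<close>
      then show False
        using quad[of "(B + 1) / P"] True nonneg by simp
    qed
    then show ?thesis
      using nonneg True by simp
  next
    case False
    then have "A > 0" using nonneg by simp
    then show ?thesis
      using quad[of "P / A"] by (simp add: power2_eq_square field_simps)
  qed
  then have "P \<le> sqrt (A * B)"
    by (rule real_le_rsqrt)
  then show ?thesis
    by (simp add: P_def A_def B_def L2_norm_def real_sqrt_mult)
qed

lemma L2_norm_triangle:
  assumes "u \<in> L2 \<Omega>" "v \<in> L2 \<Omega>"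
  shows "L2_norm \<Omega> (\<lambda>x. u x + v x) \<le> L2_norm \<Omega> u + L2_norm \<Omega> v"
proof (rule power2_le_imp_le)
  let ?M = "lebesgue_on \<Omega>"
  note int = L2_norm_mult_integrable[OF assms] assms[THEN L2_integrable]
  have "(L2_norm \<Omega> (\<lambda>x. u x + v x))\<^sup>2 \<le> (\<integral>x. (norm (u x))\<^sup>2 + 2 * (norm (u x) * norm (v x)) + (norm (v x))\<^sup>2 \<partial>?M)"
    unfolding L2_norm_power2
  proof (rule integral_mono)
    show "integrable ?M (\<lambda>x. (norm (u x + v x))\<^sup>2)"
      using L2_add[OF assms] by (rule L2_integrable)
    show "(norm (u x + v x))\<^sup>2 \<le> (norm (u x))\<^sup>2 + 2 * (norm (u x) * norm (v x)) + (norm (v x))\<^sup>2" for x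
      using power_mono[OF norm_triangle_ineq[of "u x" "v x"], of 2] by (simp add: power2_sum)
  qed (use int in simp)
  also have "\<dots> = (L2_norm \<Omega> u)\<^sup>2 + 2 * (\<integral>x. norm (u x) * norm (v x) \<partial>?M) + (L2_norm \<Omega> v)\<^sup>2"
    using int by (simp add: L2_norm_power2)
  also have "\<dots> \<le> (L2_norm \<Omega> u + L2_norm \<Omega> v)\<^sup>2"
    using L2_Cauchy_Schwarz[OF assms] by (simp add: power2_sum)
  finally show "(L2_norm \<Omega> (\<lambda>x. u x + v x))\<^sup>2 \<le> (L2_norm \<Omega> u + L2_norm \<Omega> v)\<^sup>2" .
qed simp

lemma L2_norm_scale: "L2_norm \<Omega> (\<lambda>x. a * u x) = cmod a * L2_norm \<Omega> u"
  by (simp add: L2_norm_def norm_mult power_mult_distrib real_sqrt_mult)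

lemma L2_norm_minus_commute: "L2_norm \<Omega> (\<lambda>x. u x - v x) = L2_norm \<Omega> (\<lambda>x. v x - u x)"
  by (simp add: L2_norm_def norm_minus_commute)

lemma L2_norm_triangle_diff:
  assumes "u \<in> L2 \<Omega>" "v \<in> L2 \<Omega>" "w \<in> L2 \<Omega>"
  shows "L2_norm \<Omega> (\<lambda>x. u x - w x) \<le> L2_norm \<Omega> (\<lambda>x. u x - v x) + L2_norm \<Omega> (\<lambda>x. v x - w x)"
  using L2_norm_triangle[of "\<lambda>x. u x - v x" \<Omega> "\<lambda>x. v x - w x"] assms by (simp add: L2_diff)

text \<open>On a set of finite measure a Cauchy sequence in L2 is Cauchy in L1, hence has a
  subsequence that converges almost everywhere. Fatou's lemma, applied along the subsequence with n
  fixed, bounds the distance of the pointwise limit from every late member of the full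
  sequence.\<close>

lemma L2_complete:
  fixes u :: "nat \<Rightarrow> real ^ 'n \<Rightarrow> 'b::euclidean_space"
  assumes \<Omega>: "\<Omega> \<in> lmeasurable" and u: "\<And>n. u n \<in> L2 \<Omega>"
    and cauchy: "\<And>e. e > 0 \<Longrightarrow> \<exists>N. \<forall>m\<ge>N. \<forall>n\<ge>N. L2_norm \<Omega> (\<lambda>x. u m x - u n x) < e"
  obtains w where "w \<in> L2 \<Omega>" "(\<lambda>n. L2_norm \<Omega> (\<lambda>x. w x - u n x)) \<longlonglongrightarrow> 0"
proof -
  let ?M = "lebesgue_on \<Omega>"
  interpret finite_measure ?M using \<Omega> by (rule finite_measure_lebesgue_on)
  note [measurable] = u[THEN L2_measurable]
  have one: "(\<lambda>x. 1::real) \<in> L2 \<Omega>" by (simp add: L2_def)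
  have L1: "integrable ?M (f :: real ^ 'n \<Rightarrow> 'b)" if "f \<in> L2 \<Omega>" for f
    using L2_norm_mult_integrable[OF that one] L2_measurable[OF that] by (simp add: integrable_norm_iff)
  \<comment> \<open>The added 1 keeps the later divisor \<open>K\<close> positive even if the set is
    null.\<close>
  define K where "K = L2_norm \<Omega> (\<lambda>x. 1::real) + 1"
  have "K > 0" by (simp add: K_def add_nonneg_pos)
  have le: "(\<integral>x. norm (f x) \<partial>?M) \<le> L2_norm \<Omega> f * K" if "f \<in> L2 \<Omega>" for f :: "real ^ 'n \<Rightarrow> 'b"
  proof -
    have "(\<integral>x. norm (f x) \<partial>?M) \<le> L2_norm \<Omega> f * L2_norm \<Omega> (\<lambda>x. 1::real)"
      using L2_Cauchy_Schwarz[OF that one] by simp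
    also have "\<dots> \<le> L2_norm \<Omega> f * K"
      by (intro mult_left_mono) (auto simp: K_def)
    finally show ?thesis .
  qed
  obtain r where r: "strict_mono r" and AEC: "AE x in ?M. Cauchy (\<lambda>i. u (r i) x)"
  proof (rule cauchy_L1_AE_cauchy_subseq[of ?M u])
    show "integrable ?M (u n)" for n by (intro L1 u)
    show "\<exists>N. \<forall>i\<ge>N. \<forall>j\<ge>N. (\<integral>x. norm (u i x - u j x) \<partial>?M) < e" if "e > 0" for e
    proof -
      obtain N where N: "\<forall>m\<ge>N. \<forall>n\<ge>N. L2_norm \<Omega> (\<lambda>x. u m x - u n x) < e / K"
        using cauchy[of "e / K"] \<open>e > 0\<close> \<open>K > 0\<close> by auto
      have "(\<integral>x. norm (u i x - u j x) \<partial>?M) < e" if "i \<ge> N" "j \<ge> N" for i j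
        using le[OF L2_diff[OF u u], of i j] N that \<open>K > 0\<close> by (fastforce simp: field_simps)
      then show ?thesis by blast
    qed
  qed blast
  define w where "w x = lim (\<lambda>i. u (r i) x)" for x
  have wm [measurable]: "w \<in> borel_measurable ?M"
    unfolding w_def by measurable
  have lim: "AE x in ?M. (\<lambda>i. u (r i) x) \<longlonglongrightarrow> w x"
    using AEC by eventually_elim (auto simp: w_def Cauchy_convergent_iff convergent_LIMSEQ_iff)
  have fatou: "(\<integral>\<^sup>+x. ennreal ((norm (w x - u n x))\<^sup>2) \<partial>?M) \<le> ennreal (e\<^sup>2)"
    if N: "\<forall>m\<ge>N. \<forall>n\<ge>N. L2_norm \<Omega> (\<lambda>x. u m x - u n x) < e" and "n \<ge> N" "e > 0" for N n e
  proof -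
    have "(\<integral>\<^sup>+x. ennreal ((norm (w x - u n x))\<^sup>2) \<partial>?M)
        = (\<integral>\<^sup>+x. liminf (\<lambda>i. ennreal ((norm (u (r i) x - u n x))\<^sup>2)) \<partial>?M)"
    proof (rule nn_integral_cong_AE, use lim in eventually_elim)
      fix x assume "(\<lambda>i. u (r i) x) \<longlonglongrightarrow> w x"
      then have "(\<lambda>i. ennreal ((norm (u (r i) x - u n x))\<^sup>2)) \<longlonglongrightarrow> ennreal ((norm (w x - u n x))\<^sup>2)"
        by (intro tendsto_intros)
      from lim_imp_Liminf[OF _ this]
      show "ennreal ((norm (w x - u n x))\<^sup>2) = liminf (\<lambda>i. ennreal ((norm (u (r i) x - u n x))\<^sup>2))"
        by simp
    qed
    also have "\<dots> \<le> liminf (\<lambda>i. \<integral>\<^sup>+x. ennreal ((norm (u (r i) x - u n x))\<^sup>2) \<partial>?M)"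
      by (intro nn_integral_liminf) measurable
    also have "\<dots> \<le> ennreal (e\<^sup>2)"
    proof (rule Liminf_le[OF _ eventually_sequentiallyI[of N]])
      fix i assume "N \<le> i"
      then have "r i \<ge> N" using strict_mono_imp_increasing[OF r, of i] by simp
      have "(\<integral>\<^sup>+x. ennreal ((norm (u (r i) x - u n x))\<^sup>2) \<partial>?M) = ennreal ((L2_norm \<Omega> (\<lambda>x. u (r i) x - u n x))\<^sup>2)"
        unfolding L2_norm_power2 by (intro nn_integral_eq_integral L2_integrable L2_diff u) auto
      also have "\<dots> \<le> ennreal (e\<^sup>2)"
        using N \<open>r i \<ge> N\<close> \<open>n \<ge> N\<close> by (intro ennreal_leI power_mono) (auto intro: less_imp_le)
      finally show "(\<integral>\<^sup>+x. ennreal ((norm (u (r i) x - u n x))\<^sup>2) \<partial>?M) \<le> ennreal (e\<^sup>2)" .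
    qed simp
    finally show ?thesis .
  qed
  have bound: "(\<lambda>x. w x - u n x) \<in> L2 \<Omega> \<and> L2_norm \<Omega> (\<lambda>x. w x - u n x) \<le> e"
    if N: "\<forall>m\<ge>N. \<forall>n\<ge>N. L2_norm \<Omega> (\<lambda>x. u m x - u n x) < e" and "n \<ge> N" "e > 0" for N n e
  proof -
    note F = fatou[OF that]
    have int: "integrable ?M (\<lambda>x. (norm (w x - u n x))\<^sup>2)"
      using F by (intro integrableI_bounded) (auto intro: le_less_trans)
    then have "ennreal (\<integral>x. (norm (w x - u n x))\<^sup>2 \<partial>?M) \<le> ennreal (e\<^sup>2)"
      using F by (subst (asm) nn_integral_eq_integral) auto
    then have "L2_norm \<Omega> (\<lambda>x. w x - u n x) \<le> e"
      using \<open>e > 0\<close> by (simp add: L2_norm_def real_le_lsqrt)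
    with int show ?thesis by (simp add: L2_def)
  qed
  obtain N1 where N1: "\<forall>m\<ge>N1. \<forall>n\<ge>N1. L2_norm \<Omega> (\<lambda>x. u m x - u n x) < 1"
    using cauchy[of 1] by auto
  have "w \<in> L2 \<Omega>"
    using L2_add[OF conjunct1[OF bound[OF N1, of N1]] u[of N1]] by simp
  moreover have "(\<lambda>n. L2_norm \<Omega> (\<lambda>x. w x - u n x)) \<longlonglongrightarrow> 0"
  proof (rule LIMSEQ_I)
    fix e :: real assume "e > 0"
    then obtain N where N: "\<forall>m\<ge>N. \<forall>n\<ge>N. L2_norm \<Omega> (\<lambda>x. u m x - u n x) < e / 2"
      using cauchy[of "e / 2"] by auto
    show "\<exists>N. \<forall>n\<ge>N. norm (L2_norm \<Omega> (\<lambda>x. w x - u n x) - 0) < e"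
      using bound[OF N] \<open>e > 0\<close> by (intro exI[of _ N]) (auto intro: le_less_trans[of _ "e / 2"])
  qed
  ultimately show thesis by (rule that)
qed

section \<open>The complex L2 inner product\<close>

lemma borel_measurable_cnj [measurable (raw)]:
  "f \<in> borel_measurable M \<Longrightarrow> (\<lambda>x. cnj (f x)) \<in> borel_measurable M"
  by (rule borel_measurable_continuous_on[of cnj]) (auto intro: continuous_intros)

lemma L2_inner_integrable:
  assumes "u \<in> L2 \<Omega>" "v \<in> L2 \<Omega>"
  shows "integrable (lebesgue_on \<Omega>) (\<lambda>x. u x * cnj (v x))"
proof (rule Bochner_Integration.integrable_bound[OF L2_norm_mult_integrable[OF assms]])
  note [measurable] = assms[THEN L2_measurable]
  show "(\<lambda>x. u x * cnj (v x)) \<in> borel_measurable (lebesgue_on \<Omega>)" by measurable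
qed (simp add: norm_mult)

lemma L2_inner_add_left:
  assumes "u \<in> L2 \<Omega>" "v \<in> L2 \<Omega>" "w \<in> L2 \<Omega>"
  shows "L2_inner \<Omega> (\<lambda>x. u x + v x) w = L2_inner \<Omega> u w + L2_inner \<Omega> v w"
  using assms by (simp add: L2_inner_def distrib_right L2_inner_integrable)

lemma L2_inner_diff_left:
  assumes "u \<in> L2 \<Omega>" "v \<in> L2 \<Omega>" "w \<in> L2 \<Omega>"
  shows "L2_inner \<Omega> (\<lambda>x. u x - v x) w = L2_inner \<Omega> u w - L2_inner \<Omega> v w"
  using assms by (simp add: L2_inner_def left_diff_distrib L2_inner_integrable)

lemma L2_inner_scale_left: "L2_inner \<Omega> (\<lambda>x. a * u x) w = a * L2_inner \<Omega> u w"
  by (simp add: L2_inner_def mult.assoc)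

lemma L2_inner_sum_left:
  assumes "\<And>i. i \<in> I \<Longrightarrow> u i \<in> L2 \<Omega>" "w \<in> L2 \<Omega>"
  shows "L2_inner \<Omega> (\<lambda>x. \<Sum>i\<in>I. u i x) w = (\<Sum>i\<in>I. L2_inner \<Omega> (u i) w)"
  unfolding L2_inner_def sum_distrib_right
  by (intro Bochner_Integration.integral_sum L2_inner_integrable assms)

lemma L2_inner_cnj: "L2_inner \<Omega> v u = cnj (L2_inner \<Omega> u v)"
  unfolding L2_inner_def by (subst Bochner_Integration.integral_cnj[symmetric]) (simp add: mult.commute)

lemma L2_inner_bound:
  assumes "u \<in> L2 \<Omega>" "v \<in> L2 \<Omega>"
  shows "cmod (L2_inner \<Omega> u v) \<le> L2_norm \<Omega> u * L2_norm \<Omega> v"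
proof -
  have "cmod (L2_inner \<Omega> u v) \<le> (\<integral>x. norm (u x * cnj (v x)) \<partial>lebesgue_on \<Omega>)"
    unfolding L2_inner_def by (rule integral_norm_bound)
  also have "\<dots> = (\<integral>x. norm (u x) * norm (v x) \<partial>lebesgue_on \<Omega>)"
    by (simp add: norm_mult)
  also have "\<dots> \<le> L2_norm \<Omega> u * L2_norm \<Omega> v"
    by (rule L2_Cauchy_Schwarz[OF assms])
  finally show ?thesis .
qed

lemma L2_inner_cong_AE:
  assumes "AE x in lebesgue_on \<Omega>. u x = u' x" "u \<in> L2 \<Omega>" "u' \<in> L2 \<Omega>" "v \<in> L2 \<Omega>"
  shows "L2_inner \<Omega> u v = L2_inner \<Omega> u' v"
proof -
  note [measurable] = assms(2,3,4)[THEN L2_measurable]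
  show ?thesis
    unfolding L2_inner_def using assms(1) by (intro integral_cong_AE) auto
qed

lemma L2_inner_self: "L2_inner \<Omega> u u = complex_of_real ((L2_norm \<Omega> u)\<^sup>2)"
  unfolding L2_norm_power2 L2_inner_def
  by (simp add: complex_norm_square[symmetric] flip: integral_complex_of_real)

lemma L2_inner_tendsto:
  assumes "\<And>n. s n \<in> L2 \<Omega>" "u \<in> L2 \<Omega>" "v \<in> L2 \<Omega>"
    and "(\<lambda>n. L2_norm \<Omega> (\<lambda>x. u x - s n x)) \<longlonglongrightarrow> 0"
  shows "(\<lambda>n. L2_inner \<Omega> (s n) v) \<longlonglongrightarrow> L2_inner \<Omega> u v"
proof (rule Lim_transform2[OF tendsto_const])
  show "(\<lambda>n. L2_inner \<Omega> u v - L2_inner \<Omega> (s n) v) \<longlonglongrightarrow> 0"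
  proof (rule Lim_null_comparison)
    show "\<forall>\<^sub>F n in sequentially. norm (L2_inner \<Omega> u v - L2_inner \<Omega> (s n) v) \<le> L2_norm \<Omega> (\<lambda>x. u x - s n x) * L2_norm \<Omega> v"
      using L2_inner_bound[OF L2_diff[OF assms(2,1)] assms(3)] assms(1-3)
      by (auto simp: L2_inner_diff_left)
    show "(\<lambda>n. L2_norm \<Omega> (\<lambda>x. u x - s n x) * L2_norm \<Omega> v) \<longlonglongrightarrow> 0"
      using tendsto_mult_left_zero[OF assms(4)] .
  qed
qed

section \<open>Test functions and the space \<open>H\<^sup>1\<^sub>0\<close>\<close>

lemma L2_dominated:
  assumes "v \<in> L2 \<Omega>" "u \<in> borel_measurable (lebesgue_on \<Omega>)" "\<And>x. norm (u x) \<le> norm (v x)"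
  shows "u \<in> L2 \<Omega>" and "L2_norm \<Omega> u \<le> L2_norm \<Omega> v"
proof -
  note [measurable] = assms(2)
  have le: "(norm (u x))\<^sup>2 \<le> (norm (v x))\<^sup>2" for x
    using assms(3) by (intro power_mono) auto
  have int: "integrable (lebesgue_on \<Omega>) (\<lambda>x. (norm (u x))\<^sup>2)"
    by (rule Bochner_Integration.integrable_bound[OF L2_integrable[OF assms(1)]]) (use le in auto)
  then show "u \<in> L2 \<Omega>" using assms(2) by (simp add: L2_def)
  show "L2_norm \<Omega> u \<le> L2_norm \<Omega> v"
    unfolding L2_norm_def using int L2_integrable[OF assms(1)] le
    by (intro real_sqrt_le_mono integral_mono) auto
qed

lemma L2_cnj: "u \<in> L2 \<Omega> \<Longrightarrow> (\<lambda>x. cnj (u x)) \<in> L2 \<Omega>"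
  by (auto simp: L2_def)

lemma borel_measurable_vec_nth [measurable (raw)]:
  fixes f :: "'a \<Rightarrow> 'b::{second_countable_topology, real_normed_vector} ^ 'n"
  shows "f \<in> borel_measurable M \<Longrightarrow> (\<lambda>x. f x $ i) \<in> borel_measurable M"
  by (rule borel_measurable_continuous_on[of "\<lambda>y. y $ i"]) (auto intro: continuous_intros)

lemma L2_component:
  fixes G :: "real ^ 'n \<Rightarrow> complex ^ 'n"
  assumes "G \<in> L2 \<Omega>"
  shows "(\<lambda>x. G x $ i) \<in> L2 \<Omega>" and "L2_norm \<Omega> (\<lambda>x. G x $ i) \<le> L2_norm \<Omega> G"
  using L2_dominated[OF assms, of "\<lambda>x. G x $ i"] L2_measurable[OF assms]
  by (auto simp: Finite_Cartesian_Product.norm_nth_le)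

lemma L2_continuous_compact_support:
  fixes g :: "real ^ 'n \<Rightarrow> 'b::euclidean_space"
  assumes \<Omega>: "\<Omega> \<in> lmeasurable" and g: "continuous_on UNIV g" and K: "compact K" "\<And>x. x \<notin> K \<Longrightarrow> g x = 0"
  shows "g \<in> L2 \<Omega>"
proof -
  interpret finite_measure "lebesgue_on \<Omega>" using \<Omega> by (rule finite_measure_lebesgue_on)
  have "g \<in> borel_measurable borel"
    using g by (rule borel_measurable_continuous_onI)
  then have "g \<in> borel_measurable lebesgue"
    by (simp add: measurable_completion)
  then have gm [measurable]: "g \<in> borel_measurable (lebesgue_on \<Omega>)"
    by (rule measurable_restrict_space1)
  have "compact (g ` K)"
    using g K(1) by (meson compact_continuous_image continuous_on_subset subset_UNIV)
  from compact_imp_bounded[OF this] obtain B where B: "\<And>y. y \<in> g ` K \<Longrightarrow> norm y \<le> B"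
    by (auto simp: bounded_iff)
  have "norm (g x) \<le> \<bar>B\<bar>" for x
    using B[of "g x"] K(2)[of x] by (cases "x \<in> K") auto
  then have "norm ((norm (g x))\<^sup>2) \<le> \<bar>B\<bar>\<^sup>2" for x
    using power_mono[of "norm (g x)" "\<bar>B\<bar>" 2] by simp
  then have "integrable (lebesgue_on \<Omega>) (\<lambda>x. (norm (g x))\<^sup>2)"
    by (intro integrable_const_bound[of _ "\<bar>B\<bar>\<^sup>2"]) auto
  then show ?thesis by (simp add: L2_def)
qed

section \<open>Linearity and integrability of test functions and their gradients\<close>

lemma partial_deriv_eq:
  assumes "(f has_derivative f') (at x)"
  shows "partial_deriv i f x = f' (axis i 1)"
  using frechet_derivative_at[OF assms] by (simp add: partial_deriv_def)

text \<open>\<open>smooth\<close> speaks about all lists of directions, so closure under sums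
  requires additivity of every iterated derivative at once. Smoothness supplies the
  differentiability of each shorter iterate that the induction step needs.\<close>

lemma foldr_partial_deriv_add:
  assumes "smooth \<phi>" "smooth \<psi>"
  shows "foldr partial_deriv is (\<lambda>x. \<phi> x + \<psi> x) = (\<lambda>x. foldr partial_deriv is \<phi> x + foldr partial_deriv is \<psi> x)"
proof (induction "is")
  case (Cons i "is")
  show ?case
  proof
    fix x
    have "foldr partial_deriv is \<phi> differentiable (at x)" "foldr partial_deriv is \<psi> differentiable (at x)"
      using assms by (auto simp: smooth_def differentiable_on_def)
    then obtain D E where D: "(foldr partial_deriv is \<phi> has_derivative D) (at x)"
      and E: "(foldr partial_deriv is \<psi> has_derivative E) (at x)"
      by (auto simp: differentiable_def)
    show "foldr partial_deriv (i # is) (\<lambda>x. \<phi> x + \<psi> x) x =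
      foldr partial_deriv (i # is) \<phi> x + foldr partial_deriv (i # is) \<psi> x"
      using partial_deriv_eq[OF has_derivative_add[OF D E]] partial_deriv_eq[OF D] partial_deriv_eq[OF E]
      by (simp add: Cons.IH)
  qed
qed simp

lemma foldr_partial_deriv_scale:
  assumes "smooth \<phi>"
  shows "foldr partial_deriv is (\<lambda>x. a * \<phi> x) = (\<lambda>x. a * foldr partial_deriv is \<phi> x)"
proof (induction "is")
  case (Cons i "is")
  show ?case
  proof
    fix x
    have "foldr partial_deriv is \<phi> differentiable (at x)"
      using assms by (auto simp: smooth_def differentiable_on_def)
    then obtain D where D: "(foldr partial_deriv is \<phi> has_derivative D) (at x)"
      by (auto simp: differentiable_def)
    show "foldr partial_deriv (i # is) (\<lambda>x. a * \<phi> x) x = a * foldr partial_deriv (i # is) \<phi> x"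
      using partial_deriv_eq[OF has_derivative_mult_right[OF D]] partial_deriv_eq[OF D]
      by (simp add: Cons.IH)
  qed
qed simp

lemma smooth_add: "smooth \<phi> \<Longrightarrow> smooth \<psi> \<Longrightarrow> smooth (\<lambda>x. \<phi> x + \<psi> x)"
  using foldr_partial_deriv_add[of \<phi> \<psi>] by (simp add: smooth_def)

lemma smooth_scale: "smooth \<phi> \<Longrightarrow> smooth (\<lambda>x. a * \<phi> x)"
  using foldr_partial_deriv_scale[of \<phi>]
  by (simp add: smooth_def differentiable_on_def)

lemma gradient_add: "smooth \<phi> \<Longrightarrow> smooth \<psi> \<Longrightarrow> gradient (\<lambda>x. \<phi> x + \<psi> x) x = gradient \<phi> x + gradient \<psi> x"
  using foldr_partial_deriv_add[of \<phi> \<psi> "[i]" for i] by (simp add: gradient_def vec_eq_iff fun_eq_iff)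

lemma gradient_scale: "smooth \<phi> \<Longrightarrow> gradient (\<lambda>x. a * \<phi> x) x = a *s gradient \<phi> x"
  using foldr_partial_deriv_scale[of \<phi> "[i]" for i] by (simp add: gradient_def vec_eq_iff fun_eq_iff)

lemma test_function_smooth: "test_function \<Omega> \<phi> \<Longrightarrow> smooth \<phi>"
  by (simp add: test_function_def)

text \<open>A compact set is closed, so it contains the closure of any of its subsets. The support
  of a sum can thus be bounded by a union of two supports without being computed.\<close>

lemma test_function_supportI:
  assumes "smooth \<phi>" "compact K" "K \<subseteq> \<Omega>" "{x. \<phi> x \<noteq> 0} \<subseteq> K"
  shows "test_function \<Omega> \<phi>"
proof -
  have "closure {x. \<phi> x \<noteq> 0} \<subseteq> K"
    using assms by (intro closure_minimal compact_imp_closed)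
  then show ?thesis
    using assms compact_Int_closed[OF assms(2) closed_closure, of "{x. \<phi> x \<noteq> 0}"]
    by (auto simp: test_function_def inf.absorb2)
qed

lemma test_function_add:
  assumes "test_function \<Omega> \<phi>" "test_function \<Omega> \<psi>"
  shows "test_function \<Omega> (\<lambda>x. \<phi> x + \<psi> x)"
proof (rule test_function_supportI)
  show "{x. \<phi> x + \<psi> x \<noteq> 0} \<subseteq> closure {x. \<phi> x \<noteq> 0} \<union> closure {x. \<psi> x \<noteq> 0}"
  proof -
    have "{x. \<phi> x + \<psi> x \<noteq> 0} \<subseteq> {x. \<phi> x \<noteq> 0} \<union> {x. \<psi> x \<noteq> 0}" by auto
    then show ?thesis
      using closure_subset[of "{x. \<phi> x \<noteq> 0}"] closure_subset[of "{x. \<psi> x \<noteq> 0}"] by blast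
  qed
qed (use assms in \<open>auto simp: test_function_def intro: smooth_add\<close>)

lemma test_function_scale:
  assumes "test_function \<Omega> \<phi>"
  shows "test_function \<Omega> (\<lambda>x. a * \<phi> x)"
proof (rule test_function_supportI)
  show "{x. a * \<phi> x \<noteq> 0} \<subseteq> closure {x. \<phi> x \<noteq> 0}"
    using closure_subset[of "{x. \<phi> x \<noteq> 0}"] by auto
qed (use assms in \<open>auto simp: test_function_def intro: smooth_scale\<close>)

lemma partial_deriv_support:
  assumes "test_function \<Omega> \<phi>" "x \<notin> closure {x. \<phi> x \<noteq> 0}"
  shows "partial_deriv i \<phi> x = 0"
proof -
  have "(\<phi> has_derivative (\<lambda>_. 0)) (at x)"
  proof (rule has_derivative_transform_within_open)
    show "((\<lambda>_. 0) has_derivative (\<lambda>_. 0)) (at x)" by simp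
    show "open (- closure {x. \<phi> x \<noteq> 0})" by (simp add: open_Compl)
    show "0 = \<phi> y" if "y \<in> - closure {x. \<phi> x \<noteq> 0}" for y
      using that closure_subset[of "{x. \<phi> x \<noteq> 0}"] by auto
  qed (use assms in auto)
  then show ?thesis by (rule partial_deriv_eq)
qed

lemma continuous_on_partial_deriv: "smooth \<phi> \<Longrightarrow> continuous_on UNIV (partial_deriv i \<phi>)"
  unfolding smooth_def by (drule spec[of _ "[i]"]) (simp add: differentiable_imp_continuous_on)

lemma continuous_on_smooth: "smooth \<phi> \<Longrightarrow> continuous_on UNIV \<phi>"
  unfolding smooth_def by (drule spec[of _ "[]"]) (simp add: differentiable_imp_continuous_on)

lemma test_function_L2:
  assumes "\<Omega> \<in> lmeasurable" "test_function \<Omega> \<phi>"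
  shows "\<phi> \<in> L2 \<Omega>" "partial_deriv i \<phi> \<in> L2 \<Omega>" "gradient \<phi> \<in> L2 \<Omega>"
proof -
  have K: "compact (closure {x. \<phi> x \<noteq> 0})" and sm: "smooth \<phi>"
    using assms(2) by (auto simp: test_function_def)
  show "\<phi> \<in> L2 \<Omega>"
    using closure_subset[of "{x. \<phi> x \<noteq> 0}"]
    by (intro L2_continuous_compact_support[OF assms(1) continuous_on_smooth[OF sm] K]) auto
  show "partial_deriv i \<phi> \<in> L2 \<Omega>"
    using partial_deriv_support[OF assms(2)]
    by (intro L2_continuous_compact_support[OF assms(1) continuous_on_partial_deriv[OF sm] K]) auto
  have "continuous_on UNIV (gradient \<phi>)"
    unfolding gradient_def by (intro continuous_on_vec_lambda continuous_on_partial_deriv[OF sm])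
  then show "gradient \<phi> \<in> L2 \<Omega>"
    using partial_deriv_support[OF assms(2)]
    by (intro L2_continuous_compact_support[OF assms(1) _ K]) (auto simp: gradient_def vec_eq_iff)
qed

text \<open>Expansion coefficients are complex, so gradients are scaled componentwise by
  \<open>*s\<close> rather than by real scalars.\<close>

lemma norm_vector_scale: "norm (a *s (x :: complex ^ 'n)) = cmod a * norm x"
  by (simp add: norm_vec_def L2_set_def norm_mult power_mult_distrib real_sqrt_mult flip: sum_distrib_left)

lemma vector_scale_diff: "a *s (x - y) = a *s x - a *s (y :: complex ^ 'n)"
  by (simp add: vec_eq_iff right_diff_distrib)

lemma L2_vector_scale:
  fixes G :: "real ^ 'n \<Rightarrow> complex ^ 'n"
  assumes "G \<in> L2 \<Omega>"
  shows "(\<lambda>x. a *s G x) \<in> L2 \<Omega>"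
proof -
  have "continuous_on UNIV (\<lambda>y :: complex ^ 'n. a *s y)"
    unfolding vector_scalar_mult_def by (intro continuous_intros)
  then have "(\<lambda>x. a *s G x) \<in> borel_measurable (lebesgue_on \<Omega>)"
    using L2_measurable[OF assms] by (rule borel_measurable_continuous_on)
  then show ?thesis
    using L2_integrable[OF assms] by (simp add: L2_def norm_vector_scale power_mult_distrib)
qed

lemma L2_norm_vector_scale: "L2_norm \<Omega> (\<lambda>x. a *s (G x :: complex ^ 'n)) = cmod a * L2_norm \<Omega> G"
  by (simp add: L2_norm_def norm_vector_scale power_mult_distrib real_sqrt_mult)

text \<open>The defining identity is bilinear. Conjugating the test function turns both sides into
  values of \<open>L2_inner\<close>, whose linearity and continuity then apply.\<close>

lemma weak_gradient_iff_inner: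
  "weak_gradient \<Omega> u G \<longleftrightarrow> (\<forall>\<phi> i. test_function \<Omega> \<phi> \<longrightarrow>
     L2_inner \<Omega> u (\<lambda>x. cnj (partial_deriv i \<phi> x)) = - L2_inner \<Omega> (\<lambda>x. G x $ i) (\<lambda>x. cnj (\<phi> x)))"
  by (simp add: weak_gradient_def L2_inner_def)

section \<open>Linearity and closedness of the weak gradient on the closure of the test
  functions\<close>

lemma H10_imp_L2:
  assumes "H10_with_gradient \<Omega> u G"
  shows "u \<in> L2 \<Omega>" "G \<in> L2 \<Omega>"
  using assms by (auto simp: H10_with_gradient_def)

lemma H10_add:
  assumes \<Omega>: "\<Omega> \<in> lmeasurable" and u: "H10_with_gradient \<Omega> u G" and v: "H10_with_gradient \<Omega> v H"
  shows "H10_with_gradient \<Omega> (\<lambda>x. u x + v x) (\<lambda>x. G x + H x)"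
proof -
  note L = H10_imp_L2[OF u] H10_imp_L2[OF v]
  obtain \<phi> where \<phi>: "\<And>n::nat. test_function \<Omega> (\<phi> n)" "(\<lambda>n. L2_norm \<Omega> (\<lambda>x. u x - \<phi> n x)) \<longlonglongrightarrow> 0"
    "(\<lambda>n. L2_norm \<Omega> (\<lambda>x. G x - gradient (\<phi> n) x)) \<longlonglongrightarrow> 0"
    using u unfolding H10_with_gradient_def by blast
  obtain \<psi> where \<psi>: "\<And>n::nat. test_function \<Omega> (\<psi> n)" "(\<lambda>n. L2_norm \<Omega> (\<lambda>x. v x - \<psi> n x)) \<longlonglongrightarrow> 0"
    "(\<lambda>n. L2_norm \<Omega> (\<lambda>x. H x - gradient (\<psi> n) x)) \<longlonglongrightarrow> 0"
    using v unfolding H10_with_gradient_def by blast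
  have wk: "weak_gradient \<Omega> (\<lambda>x. u x + v x) (\<lambda>x. G x + H x)"
    using u v L test_function_L2[OF \<Omega>] unfolding H10_with_gradient_def weak_gradient_iff_inner
    by (simp add: L2_inner_add_left L2_component L2_cnj)
  have sum0: "(\<lambda>n. a n) \<longlonglongrightarrow> 0" if "b \<longlonglongrightarrow> 0" "c \<longlonglongrightarrow> 0" "\<And>n. 0 \<le> a n" "\<And>n. a n \<le> b n + c n" for a b c :: "nat \<Rightarrow> real"
    using tendsto_sandwich[of "\<lambda>_. 0" a sequentially "\<lambda>n. b n + c n" 0] tendsto_add[OF that(1,2)] that by auto
  have "(\<lambda>n. L2_norm \<Omega> (\<lambda>x. (u x + v x) - (\<phi> n x + \<psi> n x))) \<longlonglongrightarrow> 0"
  proof (rule sum0[OF \<phi>(2) \<psi>(2)])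
    fix n
    have "(\<lambda>x. (u x + v x) - (\<phi> n x + \<psi> n x)) = (\<lambda>x. (u x - \<phi> n x) + (v x - \<psi> n x))" by auto
    then show "L2_norm \<Omega> (\<lambda>x. (u x + v x) - (\<phi> n x + \<psi> n x)) \<le> L2_norm \<Omega> (\<lambda>x. u x - \<phi> n x) + L2_norm \<Omega> (\<lambda>x. v x - \<psi> n x)"
      using L test_function_L2[OF \<Omega>] \<phi> \<psi> by (simp add: L2_norm_triangle L2_diff)
  qed simp
  moreover have "(\<lambda>n. L2_norm \<Omega> (\<lambda>x. (G x + H x) - gradient (\<lambda>x. \<phi> n x + \<psi> n x) x)) \<longlonglongrightarrow> 0"
  proof (rule sum0[OF \<phi>(3) \<psi>(3)])
    fix n
    have "(\<lambda>x. (G x + H x) - gradient (\<lambda>x. \<phi> n x + \<psi> n x) x) = (\<lambda>x. (G x - gradient (\<phi> n) x) + (H x - gradient (\<psi> n) x))"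
      by (rule ext) (simp add: gradient_add[OF test_function_smooth[OF \<phi>(1)] test_function_smooth[OF \<psi>(1)]])
    then show "L2_norm \<Omega> (\<lambda>x. (G x + H x) - gradient (\<lambda>x. \<phi> n x + \<psi> n x) x) \<le> L2_norm \<Omega> (\<lambda>x. G x - gradient (\<phi> n) x) + L2_norm \<Omega> (\<lambda>x. H x - gradient (\<psi> n) x)"
      using L test_function_L2[OF \<Omega>] \<phi> \<psi> by (simp add: L2_norm_triangle L2_diff)
  qed simp
  ultimately show ?thesis
    using L wk \<phi>(1) \<psi>(1) unfolding H10_with_gradient_def
    by (intro conjI exI[of _ "\<lambda>n x. \<phi> n x + \<psi> n x"]) (auto intro: L2_add test_function_add)
qed

lemma H10_scale:
  assumes u: "H10_with_gradient \<Omega> u G"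
  shows "H10_with_gradient \<Omega> (\<lambda>x. a * u x) (\<lambda>x. a *s G x)"
proof -
  note L = H10_imp_L2[OF u]
  obtain \<phi> where \<phi>: "\<And>n::nat. test_function \<Omega> (\<phi> n)" "(\<lambda>n. L2_norm \<Omega> (\<lambda>x. u x - \<phi> n x)) \<longlonglongrightarrow> 0"
    "(\<lambda>n. L2_norm \<Omega> (\<lambda>x. G x - gradient (\<phi> n) x)) \<longlonglongrightarrow> 0"
    using u unfolding H10_with_gradient_def by blast
  have wk: "weak_gradient \<Omega> (\<lambda>x. a * u x) (\<lambda>x. a *s G x)"
    using u unfolding H10_with_gradient_def weak_gradient_iff_inner by (simp add: L2_inner_scale_left)
  have "(\<lambda>n. L2_norm \<Omega> (\<lambda>x. a * u x - a * \<phi> n x)) \<longlonglongrightarrow> 0"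
    using tendsto_mult_right_zero[OF \<phi>(2), of "cmod a"] by (simp flip: right_diff_distrib L2_norm_scale)
  moreover have "(\<lambda>n. L2_norm \<Omega> (\<lambda>x. a *s G x - gradient (\<lambda>x. a * \<phi> n x) x)) \<longlonglongrightarrow> 0"
    using tendsto_mult_right_zero[OF \<phi>(3), of "cmod a"]
    by (simp add: gradient_scale[OF test_function_smooth[OF \<phi>(1)]] L2_norm_vector_scale[symmetric]
        vector_scale_diff)
  ultimately show ?thesis
    using L wk \<phi>(1) unfolding H10_with_gradient_def
    by (intro conjI exI[of _ "\<lambda>n x. a * \<phi> n x"]) (auto intro: L2_scale L2_vector_scale test_function_scale)
qed

lemma H10_zero:
  fixes \<Omega> :: "(real ^ 'n) set"
  shows "H10_with_gradient \<Omega> (\<lambda>x. 0) (\<lambda>x. 0)"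
proof -
  have pd: "partial_deriv i (\<lambda>x. 0 :: complex) = (\<lambda>x :: real ^ 'n. 0)" for i
    by (rule ext) (rule partial_deriv_eq[OF has_derivative_const])
  have "foldr partial_deriv is (\<lambda>x. 0 :: complex) = (\<lambda>x :: real ^ 'n. 0)" for "is"
    by (induction "is") (auto simp: pd)
  then have "test_function \<Omega> (\<lambda>x. 0)"
    by (simp add: test_function_def smooth_def)
  moreover have "gradient (\<lambda>x. 0) = (\<lambda>x :: real ^ 'n. 0)"
    by (simp add: gradient_def fun_eq_iff vec_eq_iff pd)
  ultimately show ?thesis
    unfolding H10_with_gradient_def
    by (intro conjI exI[of _ "\<lambda>n x. 0"]) (auto simp: weak_gradient_def L2_zero L2_norm_def)
qed

lemma H10_sum:
  assumes "\<Omega> \<in> lmeasurable" "\<And>i. i \<in> I \<Longrightarrow> H10_with_gradient \<Omega> (u i) (G i)"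
  shows "H10_with_gradient \<Omega> (\<lambda>x. \<Sum>i\<in>I. u i x) (\<lambda>x. \<Sum>i\<in>I. G i x)"
  using assms(2) by (induction I rule: infinite_finite_induct) (auto intro: H10_zero H10_add[OF assms(1)])

text \<open>A diagonal choice: each pair \<open>(u n, G n)\<close> has a test function within
  1/(n+1) in both norms, and these test functions approximate \<open>w\<close> and \<open>F\<close>.
  The weak gradient identity survives because both of its sides are inner products that
  converge.\<close>

lemma H10_closed:
  assumes \<Omega>: "\<Omega> \<in> lmeasurable" and un: "\<And>n::nat. H10_with_gradient \<Omega> (u n) (G n)"
    and w: "w \<in> L2 \<Omega>" "F \<in> L2 \<Omega>"
    and lim: "(\<lambda>n. L2_norm \<Omega> (\<lambda>x. w x - u n x)) \<longlonglongrightarrow> 0" "(\<lambda>n. L2_norm \<Omega> (\<lambda>x. F x - G n x)) \<longlonglongrightarrow> 0"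
  shows "H10_with_gradient \<Omega> w F"
proof -
  note L = H10_imp_L2[OF un]
  have "\<exists>\<phi>. test_function \<Omega> \<phi> \<and> L2_norm \<Omega> (\<lambda>x. u n x - \<phi> x) < 1 / real (Suc n) \<and>
      L2_norm \<Omega> (\<lambda>x. G n x - gradient \<phi> x) < 1 / real (Suc n)" for n
  proof -
    obtain \<phi> where \<phi>: "\<And>n::nat. test_function \<Omega> (\<phi> n)" and lims: "(\<lambda>m. L2_norm \<Omega> (\<lambda>x. u n x - \<phi> m x)) \<longlonglongrightarrow> 0"
      "(\<lambda>m. L2_norm \<Omega> (\<lambda>x. G n x - gradient (\<phi> m) x)) \<longlonglongrightarrow> 0"
      using un[of n] unfolding H10_with_gradient_def by blast
    have pos: "0 < 1 / real (Suc n)" by simp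
    have "\<forall>\<^sub>F m in sequentially. L2_norm \<Omega> (\<lambda>x. u n x - \<phi> m x) < 1 / real (Suc n) \<and>
      L2_norm \<Omega> (\<lambda>x. G n x - gradient (\<phi> m) x) < 1 / real (Suc n)"
      using order_tendstoD(2)[OF lims(1) pos] order_tendstoD(2)[OF lims(2) pos] by (rule eventually_conj)
    then show ?thesis
      using \<phi> eventually_happens'[OF sequentially_bot] by blast
  qed
  then obtain \<phi> where \<phi>: "\<And>n. test_function \<Omega> (\<phi> n)"
      "\<And>n. L2_norm \<Omega> (\<lambda>x. u n x - \<phi> n x) < 1 / real (Suc n)"
      "\<And>n. L2_norm \<Omega> (\<lambda>x. G n x - gradient (\<phi> n) x) < 1 / real (Suc n)"
    by metis
  have inv: "(\<lambda>n. 1 / real (Suc n)) \<longlonglongrightarrow> 0"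
    using LIMSEQ_inverse_real_of_nat by (simp add: inverse_eq_divide)
  have squeeze: "a \<longlonglongrightarrow> 0" if "b \<longlonglongrightarrow> 0" "\<And>n. 0 \<le> a n" "\<And>n. a n \<le> b n + 1 / real (Suc n)" for a b :: "nat \<Rightarrow> real"
    using tendsto_sandwich[of "\<lambda>_. 0" a sequentially "\<lambda>n. b n + 1 / real (Suc n)" 0] tendsto_add[OF that(1) inv] that by auto
  have "(\<lambda>n. L2_norm \<Omega> (\<lambda>x. w x - \<phi> n x)) \<longlonglongrightarrow> 0"
  proof (rule squeeze[OF lim(1)])
    show "L2_norm \<Omega> (\<lambda>x. w x - \<phi> n x) \<le> L2_norm \<Omega> (\<lambda>x. w x - u n x) + 1 / real (Suc n)" for n
      using L2_norm_triangle_diff[OF w(1) L(1)[of n] test_function_L2(1)[OF \<Omega> \<phi>(1)[of n]]] \<phi>(2)[of n] by linarith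
  qed simp
  moreover have "(\<lambda>n. L2_norm \<Omega> (\<lambda>x. F x - gradient (\<phi> n) x)) \<longlonglongrightarrow> 0"
  proof (rule squeeze[OF lim(2)])
    show "L2_norm \<Omega> (\<lambda>x. F x - gradient (\<phi> n) x) \<le> L2_norm \<Omega> (\<lambda>x. F x - G n x) + 1 / real (Suc n)" for n
      using L2_norm_triangle_diff[OF w(2) L(2)[of n] test_function_L2(3)[OF \<Omega> \<phi>(1)[of n]]] \<phi>(3)[of n] by linarith
  qed simp
  moreover have "weak_gradient \<Omega> w F"
    unfolding weak_gradient_iff_inner
  proof (intro allI impI)
    fix \<psi> i assume \<psi>: "test_function \<Omega> \<psi>"
    note T = test_function_L2[OF \<Omega> \<psi>]
    have comp: "(\<lambda>n. L2_norm \<Omega> (\<lambda>x. F x $ i - G n x $ i)) \<longlonglongrightarrow> 0"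
      by (rule tendsto_sandwich[OF _ _ tendsto_const lim(2)])
        (use L2_component(2)[OF L2_diff[OF w(2) L(2)]] in auto)
    have "(\<lambda>n. L2_inner \<Omega> (u n) (\<lambda>x. cnj (partial_deriv i \<psi> x))) \<longlonglongrightarrow> L2_inner \<Omega> w (\<lambda>x. cnj (partial_deriv i \<psi> x))"
      by (intro L2_inner_tendsto L w L2_cnj T lim)
    moreover have "(\<lambda>n. - L2_inner \<Omega> (\<lambda>x. G n x $ i) (\<lambda>x. cnj (\<psi> x))) \<longlonglongrightarrow> - L2_inner \<Omega> (\<lambda>x. F x $ i) (\<lambda>x. cnj (\<psi> x))"
      by (intro tendsto_minus L2_inner_tendsto L2_component L w L2_cnj T comp)
    ultimately show "L2_inner \<Omega> w (\<lambda>x. cnj (partial_deriv i \<psi> x)) = - L2_inner \<Omega> (\<lambda>x. F x $ i) (\<lambda>x. cnj (\<psi> x))"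
      using un \<psi> unfolding H10_with_gradient_def weak_gradient_iff_inner
      by (intro LIMSEQ_unique) auto
  qed
  ultimately show ?thesis
    using w \<phi>(1) unfolding H10_with_gradient_def by blast
qed

section \<open>The energy form\<close>

lemma admissible_lmeasurable: "admissible_problem \<Omega> A c \<Longrightarrow> \<Omega> \<in> lmeasurable"
  by (auto simp: admissible_problem_def bounded_lipschitz_domain_def intro: lmeasurable_open)

text \<open>The integrand of \<open>energy_form\<close>, named so that it can be estimated pointwise
  before integrating.\<close>

definition energy_density ::
  "(real ^ 'n \<Rightarrow> real ^ 'n ^ 'n) \<Rightarrow> (real ^ 'n \<Rightarrow> real) \<Rightarrow>
   (real ^ 'n \<Rightarrow> complex) \<Rightarrow> (real ^ 'n \<Rightarrow> complex ^ 'n) \<Rightarrow>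
   (real ^ 'n \<Rightarrow> complex) \<Rightarrow> (real ^ 'n \<Rightarrow> complex ^ 'n) \<Rightarrow> real ^ 'n \<Rightarrow> complex" where
  "energy_density A c w G \<phi> H x =
     (\<Sum>i\<in>UNIV. \<Sum>j\<in>UNIV. complex_of_real (A x $ i $ j) * (G x $ j) * cnj (H x $ i))
       + complex_of_real (c x) * w x * cnj (\<phi> x)"

lemma energy_form_eq: "energy_form \<Omega> A c w G \<phi> H = (\<integral>x. energy_density A c w G \<phi> H x \<partial>lebesgue_on \<Omega>)"
  by (simp add: energy_form_def energy_density_def)

text \<open>The coefficients are essentially bounded. K is chosen before the four functions, which
  yields continuity of the form and not merely integrability of its density.\<close>

lemma energy_density_bound:
  fixes \<Omega> :: "(real ^ 'n) set"
  assumes "admissible_problem \<Omega> A c"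
  obtains K where "K > 0" "\<And>w G \<phi> H. AE x in lebesgue_on \<Omega>.
      cmod (energy_density A c w G \<phi> H x) \<le> K * (norm (G x) * norm (H x) + norm (w x) * norm (\<phi> x))"
proof -
  obtain K1 K2 where K1: "AE x in lebesgue_on \<Omega>. norm (A x) \<le> K1" and K2: "AE x in lebesgue_on \<Omega>. norm (c x) \<le> K2"
    using assms by (auto simp: admissible_problem_def Linfty_def)
  \<comment> \<open>The double sum has \<open>n * n\<close> terms, each bounded by |K1| times the
    two norms.\<close>
  define n where "n = real CARD('n)"
  have n: "n \<ge> 1" by (simp add: n_def Suc_leI)
  define K where "K = n * (n * \<bar>K1\<bar>) + \<bar>K2\<bar> + 1"
  have "n * (n * \<bar>K1\<bar>) \<ge> 0" using n by simp
  then have K: "K > 0" "n * (n * \<bar>K1\<bar>) \<le> K" "\<bar>K2\<bar> \<le> K" by (auto simp: K_def)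
  show thesis
  proof (rule that[OF K(1)])
    fix w G \<phi> H
    show "AE x in lebesgue_on \<Omega>.
      cmod (energy_density A c w G \<phi> H x) \<le> K * (norm (G x) * norm (H x) + norm (w x) * norm (\<phi> x))"
      using K1 K2
    proof eventually_elim
      fix x assume 1: "norm (A x) \<le> K1" and 2: "norm (c x) \<le> K2"
      have A: "\<bar>A x $ i $ j\<bar> \<le> \<bar>K1\<bar>" for i j
        using Finite_Cartesian_Product.norm_nth_le[of "A x" i] Finite_Cartesian_Product.norm_nth_le[of "A x $ i" j] 1 by simp
      have "cmod (\<Sum>i\<in>UNIV. \<Sum>j\<in>UNIV. complex_of_real (A x $ i $ j) * (G x $ j) * cnj (H x $ i))
          \<le> (\<Sum>i\<in>(UNIV :: 'n set). \<Sum>j\<in>(UNIV :: 'n set). \<bar>K1\<bar> * (norm (G x) * norm (H x)))"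
      proof (intro sum_norm_le)
        fix i j
        have "cmod (complex_of_real (A x $ i $ j) * G x $ j * cnj (H x $ i)) = \<bar>A x $ i $ j\<bar> * (cmod (G x $ j) * cmod (H x $ i))"
          by (simp add: norm_mult)
        also have "\<dots> \<le> \<bar>K1\<bar> * (norm (G x) * norm (H x))"
          by (intro mult_mono A Finite_Cartesian_Product.norm_nth_le) auto
        finally show "cmod (complex_of_real (A x $ i $ j) * G x $ j * cnj (H x $ i)) \<le> \<bar>K1\<bar> * (norm (G x) * norm (H x))" .
      qed
      also have "\<dots> = (n * (n * \<bar>K1\<bar>)) * (norm (G x) * norm (H x))"
        by (simp add: n_def)
      also have "\<dots> \<le> K * (norm (G x) * norm (H x))"
        using K by (intro mult_right_mono) auto
      finally have *: "cmod (\<Sum>i\<in>UNIV. \<Sum>j\<in>UNIV. complex_of_real (A x $ i $ j) * (G x $ j) * cnj (H x $ i))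
          \<le> K * (norm (G x) * norm (H x))" .
      have "cmod (complex_of_real (c x) * w x * cnj (\<phi> x)) = \<bar>c x\<bar> * (norm (w x) * norm (\<phi> x))"
        by (simp add: norm_mult)
      also have "\<dots> \<le> K * (norm (w x) * norm (\<phi> x))"
        using 2 K by (intro mult_right_mono) auto
      finally show "cmod (energy_density A c w G \<phi> H x) \<le> K * (norm (G x) * norm (H x) + norm (w x) * norm (\<phi> x))"
        using * unfolding energy_density_def distrib_left
        by (intro order_trans[OF norm_triangle_ineq] add_mono)
    qed
  qed
qed

lemma energy_density_measurable:
  assumes "admissible_problem \<Omega> A c" "w \<in> L2 \<Omega>" "G \<in> L2 \<Omega>" "\<phi> \<in> L2 \<Omega>" "H \<in> L2 \<Omega>"
  shows "energy_density A c w G \<phi> H \<in> borel_measurable (lebesgue_on \<Omega>)"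
proof -
  have [measurable]: "A \<in> borel_measurable (lebesgue_on \<Omega>)" "c \<in> borel_measurable (lebesgue_on \<Omega>)"
    using assms(1) by (auto simp: admissible_problem_def Linfty_def)
  note [measurable] = assms(2-)[THEN L2_measurable]
  show ?thesis
    unfolding energy_density_def by measurable
qed

lemma energy_density_integrable:
  assumes "admissible_problem \<Omega> A c" "w \<in> L2 \<Omega>" "G \<in> L2 \<Omega>" "\<phi> \<in> L2 \<Omega>" "H \<in> L2 \<Omega>"
  shows "integrable (lebesgue_on \<Omega>) (energy_density A c w G \<phi> H)"
proof -
  obtain K where K: "K > 0" "\<And>w G \<phi> H. AE x in lebesgue_on \<Omega>.
      cmod (energy_density A c w G \<phi> H x) \<le> K * (norm (G x) * norm (H x) + norm (w x) * norm (\<phi> x))"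
    using energy_density_bound[OF assms(1)] by blast
  show ?thesis
  proof (rule Bochner_Integration.integrable_bound[OF _ energy_density_measurable[OF assms]])
    show "integrable (lebesgue_on \<Omega>) (\<lambda>x. K * (norm (G x) * norm (H x) + norm (w x) * norm (\<phi> x)))"
      by (intro integrable_mult_right Bochner_Integration.integrable_add L2_norm_mult_integrable assms)
    show "AE x in lebesgue_on \<Omega>. norm (energy_density A c w G \<phi> H x)
        \<le> norm (K * (norm (G x) * norm (H x) + norm (w x) * norm (\<phi> x)))"
      using K(2)[of w G \<phi> H] by eventually_elim auto
  qed
qed

lemma energy_form_bound:
  fixes \<Omega> :: "(real ^ 'n) set"
  assumes "admissible_problem \<Omega> A c"
  obtains K where "K > 0" "\<And>w G \<phi> H. w \<in> L2 \<Omega> \<Longrightarrow> G \<in> L2 \<Omega> \<Longrightarrow> \<phi> \<in> L2 \<Omega> \<Longrightarrow> H \<in> L2 \<Omega> \<Longrightarrow>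
      cmod (energy_form \<Omega> A c w G \<phi> H) \<le> K * (L2_norm \<Omega> G * L2_norm \<Omega> H + L2_norm \<Omega> w * L2_norm \<Omega> \<phi>)"
proof -
  obtain K where K: "K > 0" "\<And>w G \<phi> H. AE x in lebesgue_on \<Omega>.
      cmod (energy_density A c w G \<phi> H x) \<le> K * (norm (G x) * norm (H x) + norm (w x) * norm (\<phi> x))"
    using energy_density_bound[OF assms(1)] by blast
  show thesis
  proof (rule that[OF K(1)])
    fix w \<phi> :: "real ^ 'n \<Rightarrow> complex" and G H :: "real ^ 'n \<Rightarrow> complex ^ 'n"
    assume L: "w \<in> L2 \<Omega>" "G \<in> L2 \<Omega>" "\<phi> \<in> L2 \<Omega>" "H \<in> L2 \<Omega>"
    have "cmod (energy_form \<Omega> A c w G \<phi> H) \<le> (\<integral>x. cmod (energy_density A c w G \<phi> H x) \<partial>lebesgue_on \<Omega>)"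
      unfolding energy_form_eq by (rule integral_norm_bound)
    also have "\<dots> \<le> (\<integral>x. K * (norm (G x) * norm (H x) + norm (w x) * norm (\<phi> x)) \<partial>lebesgue_on \<Omega>)"
      using L K(2)[of w G \<phi> H] energy_density_integrable[OF assms L]
      by (intro integral_mono_AE integrable_norm integrable_mult_right Bochner_Integration.integrable_add
          L2_norm_mult_integrable) auto
    also have "\<dots> = K * ((\<integral>x. norm (G x) * norm (H x) \<partial>lebesgue_on \<Omega>) + (\<integral>x. norm (w x) * norm (\<phi> x) \<partial>lebesgue_on \<Omega>))"
      using L2_norm_mult_integrable[OF L(2,4)] L2_norm_mult_integrable[OF L(1,3)] by simp
    also have "\<dots> \<le> K * (L2_norm \<Omega> G * L2_norm \<Omega> H + L2_norm \<Omega> w * L2_norm \<Omega> \<phi>)"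
      using K(1) L by (intro mult_left_mono add_mono L2_Cauchy_Schwarz) auto
    finally show "cmod (energy_form \<Omega> A c w G \<phi> H) \<le> K * (L2_norm \<Omega> G * L2_norm \<Omega> H + L2_norm \<Omega> w * L2_norm \<Omega> \<phi>)" .
  qed
qed

lemma energy_form_diff_left:
  assumes "admissible_problem \<Omega> A c" "w \<in> L2 \<Omega>" "G \<in> L2 \<Omega>" "w' \<in> L2 \<Omega>" "G' \<in> L2 \<Omega>" "\<phi> \<in> L2 \<Omega>" "H \<in> L2 \<Omega>"
  shows "energy_form \<Omega> A c (\<lambda>x. w x - w' x) (\<lambda>x. G x - G' x) \<phi> H = energy_form \<Omega> A c w G \<phi> H - energy_form \<Omega> A c w' G' \<phi> H"
proof -
  have "energy_density A c (\<lambda>x. w x - w' x) (\<lambda>x. G x - G' x) \<phi> H x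
      = energy_density A c w G \<phi> H x - energy_density A c w' G' \<phi> H x" for x
    unfolding energy_density_def by (simp add: algebra_simps sum_subtractf)
  then show ?thesis
    using assms by (simp add: energy_form_eq energy_density_integrable)
qed

lemma energy_form_sum_left:
  assumes "admissible_problem \<Omega> A c" "\<And>k. k \<in> I \<Longrightarrow> w k \<in> L2 \<Omega>" "\<And>k. k \<in> I \<Longrightarrow> G k \<in> L2 \<Omega>" "\<phi> \<in> L2 \<Omega>" "H \<in> L2 \<Omega>"
  shows "energy_form \<Omega> A c (\<lambda>x. \<Sum>k\<in>I. a k * w k x) (\<lambda>x. \<Sum>k\<in>I. a k *s G k x) \<phi> H
    = (\<Sum>k\<in>I. a k * energy_form \<Omega> A c (w k) (G k) \<phi> H)"
proof -
  have eq: "energy_density A c (\<lambda>x. \<Sum>k\<in>I. a k * w k x) (\<lambda>x. \<Sum>k\<in>I. a k *s G k x) \<phi> H x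
      = (\<Sum>k\<in>I. a k * energy_density A c (w k) (G k) \<phi> H x)" for x
  proof -
    have "(\<Sum>i\<in>UNIV. \<Sum>j\<in>UNIV. complex_of_real (A x $ i $ j) * ((\<Sum>k\<in>I. a k *s G k x) $ j) * cnj (H x $ i))
      = (\<Sum>i\<in>UNIV. \<Sum>j\<in>UNIV. \<Sum>k\<in>I. a k * (complex_of_real (A x $ i $ j) * (G k x $ j) * cnj (H x $ i)))"
      by (intro sum.cong refl) (simp add: sum_distrib_left sum_distrib_right mult_ac)
    also have "\<dots> = (\<Sum>i\<in>UNIV. \<Sum>k\<in>I. \<Sum>j\<in>UNIV. a k * (complex_of_real (A x $ i $ j) * (G k x $ j) * cnj (H x $ i)))"
      by (intro sum.cong refl) (rule sum.swap)
    also have "\<dots> = (\<Sum>k\<in>I. \<Sum>i\<in>UNIV. \<Sum>j\<in>UNIV. a k * (complex_of_real (A x $ i $ j) * (G k x $ j) * cnj (H x $ i)))"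
      by (rule sum.swap)
    finally show ?thesis
      unfolding energy_density_def
      by (simp add: distrib_left sum.distrib sum_distrib_left sum_distrib_right mult_ac)
  qed
  have "energy_form \<Omega> A c (\<lambda>x. \<Sum>k\<in>I. a k * w k x) (\<lambda>x. \<Sum>k\<in>I. a k *s G k x) \<phi> H
    = (\<Sum>k\<in>I. (\<integral>x. a k * energy_density A c (w k) (G k) \<phi> H x \<partial>lebesgue_on \<Omega>))"
    unfolding energy_form_eq eq
    using assms by (intro Bochner_Integration.integral_sum) (auto intro: energy_density_integrable)
  also have "\<dots> = (\<Sum>k\<in>I. a k * energy_form \<Omega> A c (w k) (G k) \<phi> H)"
    unfolding energy_form_eq by (intro sum.cong refl) simp
  finally show ?thesis .
qed

text \<open>Hermitian symmetry, from the symmetry of the matrix after exchanging the two summations.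
  It is what moves the operator from an arbitrary function onto an eigenfunction.\<close>

lemma energy_form_cnj:
  assumes adm: "admissible_problem \<Omega> A c" and L: "w \<in> L2 \<Omega>" "G \<in> L2 \<Omega>" "\<phi> \<in> L2 \<Omega>" "H \<in> L2 \<Omega>"
  shows "energy_form \<Omega> A c \<phi> H w G = cnj (energy_form \<Omega> A c w G \<phi> H)"
proof -
  have "AE x in lebesgue_on \<Omega>. transpose (A x) = A x"
    using adm by (auto simp: admissible_problem_def uniformly_spd_def)
  then have "AE x in lebesgue_on \<Omega>. energy_density A c \<phi> H w G x = cnj (energy_density A c w G \<phi> H x)"
  proof eventually_elim
    fix x assume T: "transpose (A x) = A x"
    have sym: "A x $ i $ j = A x $ j $ i" for i j
      using T by (metis transpose_def vec_lambda_beta)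
    have "(\<Sum>i\<in>UNIV. \<Sum>j\<in>UNIV. complex_of_real (A x $ i $ j) * (H x $ j) * cnj (G x $ i))
      = (\<Sum>i\<in>UNIV. \<Sum>j\<in>UNIV. complex_of_real (A x $ i $ j) * (H x $ i) * cnj (G x $ j))"
      by (subst sum.swap) (intro sum.cong refl, simp add: sym)
    then show "energy_density A c \<phi> H w G x = cnj (energy_density A c w G \<phi> H x)"
      unfolding energy_density_def by (simp add: mult_ac)
  qed
  then have "energy_form \<Omega> A c \<phi> H w G = (\<integral>x. cnj (energy_density A c w G \<phi> H x) \<partial>lebesgue_on \<Omega>)"
    unfolding energy_form_eq using energy_density_measurable[OF adm] L
    by (intro integral_cong_AE) auto
  then show ?thesis
    by (simp add: energy_form_eq)
qed

text \<open>Ellipticity is a statement about real vectors, so it is applied to the real and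
  imaginary parts of the gradient; the cross terms are purely imaginary. Control of the gradient
  suffices, since convergence of the functions themselves is read off from their
  coefficients.\<close>

lemma energy_form_coercive:
  fixes \<Omega> :: "(real ^ 'n) set"
  assumes adm: "admissible_problem \<Omega> A c"
  obtains \<alpha> where "\<alpha> > 0" "\<And>w G. w \<in> L2 \<Omega> \<Longrightarrow> G \<in> L2 \<Omega> \<Longrightarrow> \<alpha> * (L2_norm \<Omega> G)\<^sup>2 \<le> Re (energy_form \<Omega> A c w G w G)"
proof -
  obtain \<alpha> where \<alpha>: "\<alpha> > 0" "AE x in lebesgue_on \<Omega>. \<forall>\<xi>. \<alpha> * (norm \<xi>)\<^sup>2 \<le> \<xi> \<bullet> (A x *v \<xi>)"
    using adm by (auto simp: admissible_problem_def uniformly_spd_def)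
  have c: "AE x in lebesgue_on \<Omega>. 0 \<le> c x"
    using adm by (auto simp: admissible_problem_def)
  show thesis
  proof (rule that[OF \<alpha>(1)])
    fix w :: "real ^ 'n \<Rightarrow> complex" and G :: "real ^ 'n \<Rightarrow> complex ^ 'n"
    assume L: "w \<in> L2 \<Omega>" "G \<in> L2 \<Omega>"
    note int = energy_density_integrable[OF adm L L]
    have "AE x in lebesgue_on \<Omega>. \<alpha> * (norm (G x))\<^sup>2 \<le> Re (energy_density A c w G w G x)"
      using \<alpha>(2) c
    proof eventually_elim
      fix x assume spd: "\<forall>\<xi>. \<alpha> * (norm \<xi>)\<^sup>2 \<le> \<xi> \<bullet> (A x *v \<xi>)" and cx: "0 \<le> c x"
      define P :: "real ^ 'n" where "P = (\<chi> i. Re (G x $ i))"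
      define Q :: "real ^ 'n" where "Q = (\<chi> i. Im (G x $ i))"
      have n2: "(norm (G x))\<^sup>2 = (norm P)\<^sup>2 + (norm Q)\<^sup>2"
        by (simp add: norm_vec_def L2_set_def sum_nonneg P_def Q_def cmod_power2 sum.distrib)
      have "Re (\<Sum>i\<in>UNIV. \<Sum>j\<in>UNIV. complex_of_real (A x $ i $ j) * (G x $ j) * cnj (G x $ i))
          = P \<bullet> (A x *v P) + Q \<bullet> (A x *v Q)"
        by (simp add: inner_vec_def matrix_vector_mult_def P_def Q_def sum_distrib_left algebra_simps flip: sum.distrib)
      moreover have "Re (complex_of_real (c x) * w x * cnj (w x)) \<ge> 0"
      proof -
        have "complex_of_real (c x) * w x * cnj (w x) = complex_of_real (c x * (cmod (w x))\<^sup>2)"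
          by (simp add: complex_norm_square[symmetric] mult.assoc)
        then show ?thesis using cx by (simp only: Re_complex_of_real) simp
      qed
      ultimately show "\<alpha> * (norm (G x))\<^sup>2 \<le> Re (energy_density A c w G w G x)"
        using spd[rule_format, of P] spd[rule_format, of Q] by (simp add: energy_density_def n2 distrib_left)
    qed
    then have "(\<integral>x. \<alpha> * (norm (G x))\<^sup>2 \<partial>lebesgue_on \<Omega>) \<le> (\<integral>x. Re (energy_density A c w G w G x) \<partial>lebesgue_on \<Omega>)"
      using int L2_integrable[OF L(2)] by (intro integral_mono_AE) auto
    then show "\<alpha> * (L2_norm \<Omega> G)\<^sup>2 \<le> Re (energy_form \<Omega> A c w G w G)"
      using int by (simp add: energy_form_eq L2_norm_power2)
  qed
qed

section \<open>Eigenfunction expansions and resolvents\<close>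

text \<open>Positivity of the spectrum is an assumption of the locale; in the theorem it comes from
  0 < \<kappa> and \<kappa> < \<open>lam 0\<close>.\<close>

locale dirichlet_eigensystem =
  fixes \<Omega> :: "(real ^ 'n) set" and A c lam v
  assumes admissible: "admissible_problem \<Omega> A c"
    and eigen: "eigensystem \<Omega> A c lam v"
    and lam0_pos: "0 < lam 0"
begin

lemma lam0_le: "lam 0 \<le> lam j"
  using eigen by (simp add: eigensystem_def)

lemma lam_pos: "0 < lam j"
  using lam0_pos lam0_le[of j] by simp

lemma eigenfunction: "elliptic_op \<Omega> A c (v j) (\<lambda>x. complex_of_real (lam j) * v j x)"
  using eigen by (simp add: eigensystem_def)

text \<open>\<open>elliptic_op\<close> only asserts that some weak gradient exists. Fixing one for
  each eigenfunction makes the gradients of partial sums explicit.\<close>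

definition dv :: "nat \<Rightarrow> real ^ 'n \<Rightarrow> complex ^ 'n" where
  "dv j = (SOME G. H10_with_gradient \<Omega> (v j) G \<and>
     (\<forall>\<phi> H. H10_with_gradient \<Omega> \<phi> H \<longrightarrow>
        energy_form \<Omega> A c (v j) G \<phi> H = L2_inner \<Omega> (\<lambda>x. complex_of_real (lam j) * v j x) \<phi>))"

lemma dv: "H10_with_gradient \<Omega> (v j) (dv j)"
    "H10_with_gradient \<Omega> \<phi> H \<Longrightarrow> energy_form \<Omega> A c (v j) (dv j) \<phi> H = complex_of_real (lam j) * L2_inner \<Omega> (v j) \<phi>"
proof -
  have "\<exists>G. H10_with_gradient \<Omega> (v j) G \<and>
     (\<forall>\<phi> H. H10_with_gradient \<Omega> \<phi> H \<longrightarrow>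
        energy_form \<Omega> A c (v j) G \<phi> H = L2_inner \<Omega> (\<lambda>x. complex_of_real (lam j) * v j x) \<phi>)"
    using eigenfunction[of j] by (simp add: elliptic_op_def)
  from someI_ex[OF this] show "H10_with_gradient \<Omega> (v j) (dv j)"
    "H10_with_gradient \<Omega> \<phi> H \<Longrightarrow> energy_form \<Omega> A c (v j) (dv j) \<phi> H = complex_of_real (lam j) * L2_inner \<Omega> (v j) \<phi>"
    unfolding dv_def[symmetric] by (auto simp: L2_inner_scale_left)
qed

lemma v_L2: "v j \<in> L2 \<Omega>" and dv_L2: "dv j \<in> L2 \<Omega>"
  using H10_imp_L2[OF dv(1)] .

lemma orthonormal: "L2_inner \<Omega> (v i) (v j) = (if i = j then 1 else 0)"
  using eigen by (simp add: eigensystem_def)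

lemma expansion:
  "u \<in> L2 \<Omega> \<Longrightarrow> (\<lambda>n. L2_norm \<Omega> (\<lambda>x. u x - (\<Sum>j<n. L2_inner \<Omega> u (v j) * v j x))) \<longlonglongrightarrow> 0"
  using eigen by (simp add: eigensystem_def)

section \<open>Orthonormal expansions in L2\<close>

lemma partial_sum_L2: "(\<lambda>x. \<Sum>j\<in>J. a j * v j x) \<in> L2 \<Omega>"
  by (intro L2_sum L2_scale v_L2)

lemma partial_sum_inner:
  "finite J \<Longrightarrow> L2_inner \<Omega> (\<lambda>x. \<Sum>j\<in>J. a j * v j x) (v i) = (if i \<in> J then a i else 0)"
  by (simp add: L2_inner_sum_left L2_scale v_L2 L2_inner_scale_left orthonormal if_distrib cong: if_cong)

lemma partial_sum_norm:
  assumes "finite J"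
  shows "(L2_norm \<Omega> (\<lambda>x. \<Sum>j\<in>J. a j * v j x))\<^sup>2 = (\<Sum>j\<in>J. (cmod (a j))\<^sup>2)"
proof -
  let ?S = "\<lambda>x. \<Sum>j\<in>J. a j * v j x"
  have "complex_of_real ((L2_norm \<Omega> ?S)\<^sup>2) = (\<Sum>j\<in>J. a j * L2_inner \<Omega> (v j) ?S)"
    unfolding L2_inner_self[symmetric]
    by (subst L2_inner_sum_left) (auto intro: L2_scale v_L2 partial_sum_L2 simp: L2_inner_scale_left)
  also have "\<dots> = (\<Sum>j\<in>J. a j * cnj (a j))"
    using assms by (intro sum.cong refl) (subst L2_inner_cnj, simp add: partial_sum_inner)
  also have "\<dots> = complex_of_real (\<Sum>j\<in>J. (cmod (a j))\<^sup>2)"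
    by (simp add: complex_norm_square[symmetric])
  finally show ?thesis
    using of_real_eq_iff by blast
qed

lemma partial_sum_diff:
  fixes f :: "nat \<Rightarrow> 'b :: ab_group_add"
  assumes "m \<le> n"
  shows "(\<Sum>j<n. f j) - (\<Sum>j<m. f j) = (\<Sum>j\<in>{m..<n}. f j)"
proof -
  have "(\<Sum>j<n. f j) = (\<Sum>j<m. f j) + (\<Sum>j\<in>{m..<n}. f j)"
    using assms by (subst sum.union_disjoint[symmetric]) (auto intro: sum.cong)
  then show ?thesis by simp
qed

text \<open>The distance \<open>d\<close> is left abstract because the lemma serves two cases:
  squared L2 distances of partial sums, equal to blocks of the series, and squared distances of
  their gradients, which coercivity only bounds by a multiple of such blocks.\<close>

lemma cauchy_partial_sums:
  assumes nn: "\<And>j. 0 \<le> b j" and sb: "summable b"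
    and le: "\<And>m n. m \<le> n \<Longrightarrow> d m n \<le> K * (\<Sum>j\<in>{m..<n}. b j)" and sym: "\<And>m n. d m n = d n m" and K: "K > 0" and "e > (0::real)"
  shows "\<exists>N::nat. \<forall>m\<ge>N. \<forall>n\<ge>N. d m n < e"
proof -
  obtain N where N: "\<And>m n. m \<ge> N \<Longrightarrow> norm (sum b {m..<n}) < e / K"
    using sb[unfolded summable_Cauchy] \<open>e > 0\<close> K by (meson divide_pos_pos)
  have *: "d m n < e" if "N \<le> m" "m \<le> n" for m n
    using le[OF that(2)] N[OF that(1), of n] K sum_nonneg[of "{m..<n}" b] nn by (simp add: field_simps)
  show ?thesis
  proof (intro exI allI impI)
    fix m n assume "N \<le> m" "N \<le> n"
    then show "d m n < e"
      using *[of m n] *[of n m] sym[of m n] by (cases "m \<le> n") auto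
  qed
qed

lemma riesz_fischer:
  assumes "summable (\<lambda>j. (cmod (a j))\<^sup>2)"
  obtains w where "w \<in> L2 \<Omega>" "(\<lambda>n. L2_norm \<Omega> (\<lambda>x. w x - (\<Sum>j<n. a j * v j x))) \<longlonglongrightarrow> 0"
proof (rule L2_complete[where u = "\<lambda>n x. \<Sum>j<n. a j * v j x"])
  show "\<Omega> \<in> lmeasurable" using admissible by (rule admissible_lmeasurable)
  fix e :: real assume "e > 0"
  let ?d = "\<lambda>m n. L2_norm \<Omega> (\<lambda>x. (\<Sum>j<m. a j * v j x) - (\<Sum>j<n. a j * v j x))"
  have "\<exists>N. \<forall>m\<ge>N. \<forall>n\<ge>N. (?d m n)\<^sup>2 < e\<^sup>2"
  proof (rule cauchy_partial_sums[OF _ assms, where K = 1])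
    show "(?d m n)\<^sup>2 \<le> 1 * (\<Sum>j\<in>{m..<n}. (cmod (a j))\<^sup>2)" if "m \<le> n" for m n
      using that by (subst L2_norm_minus_commute) (simp add: partial_sum_diff partial_sum_norm)
    show "(?d m n)\<^sup>2 = (?d n m)\<^sup>2" for m n
      by (subst L2_norm_minus_commute) simp
  qed (use \<open>e > 0\<close> in auto)
  then show "\<exists>N. \<forall>m\<ge>N. \<forall>n\<ge>N. ?d m n < e"
    using \<open>e > 0\<close> by (meson less_imp_le power2_less_imp_less)
qed (use that in \<open>auto intro: partial_sum_L2\<close>)

lemma limit_coefficient:
  assumes "w \<in> L2 \<Omega>" "(\<lambda>n. L2_norm \<Omega> (\<lambda>x. w x - (\<Sum>j<n. a j * v j x))) \<longlonglongrightarrow> 0"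
  shows "L2_inner \<Omega> w (v i) = a i"
proof (rule LIMSEQ_unique)
  show "(\<lambda>n. L2_inner \<Omega> (\<lambda>x. \<Sum>j<n. a j * v j x) (v i)) \<longlonglongrightarrow> L2_inner \<Omega> w (v i)"
    by (intro L2_inner_tendsto partial_sum_L2 assms v_L2)
  show "(\<lambda>n. L2_inner \<Omega> (\<lambda>x. \<Sum>j<n. a j * v j x) (v i)) \<longlonglongrightarrow> a i"
    by (rule tendsto_eventually, rule eventually_sequentiallyI[of "Suc i"]) (simp add: partial_sum_inner)
qed

text \<open>The partial sums of the expansion converge to u, so their norms are bounded; by
  orthonormality the squared norms are the partial sums of this series.\<close>

lemma coefficients_summable:
  assumes "u \<in> L2 \<Omega>"
  shows "summable (\<lambda>j. (cmod (L2_inner \<Omega> u (v j)))\<^sup>2)"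
proof -
  let ?S = "\<lambda>n x. \<Sum>j<n. L2_inner \<Omega> u (v j) * v j x"
  obtain B where B: "\<And>n. norm (L2_norm \<Omega> (\<lambda>x. u x - ?S n x)) \<le> B"
    using convergent_imp_Bseq[OF convergentI[OF expansion[OF assms]]] by (auto simp: Bseq_def)
  show ?thesis
  proof (rule summableI_nonneg_bounded)
    fix n
    have "L2_norm \<Omega> (?S n) \<le> L2_norm \<Omega> (\<lambda>x. ?S n x - u x) + L2_norm \<Omega> u"
      using L2_norm_triangle[OF L2_diff[OF partial_sum_L2 assms] assms] by simp
    also have "\<dots> \<le> B + L2_norm \<Omega> u"
      using B[of n] by (subst L2_norm_minus_commute) simp
    finally have "(L2_norm \<Omega> (?S n))\<^sup>2 \<le> (B + L2_norm \<Omega> u)\<^sup>2"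
      by (intro power_mono) auto
    then show "(\<Sum>j<n. (cmod (L2_inner \<Omega> u (v j)))\<^sup>2) \<le> (B + L2_norm \<Omega> u)\<^sup>2"
      by (simp add: partial_sum_norm)
  qed auto
qed

text \<open>The choice operator returns some representative of the limit. Its coefficients do not
  depend on the choice, and they are all that is used of it.\<close>

lemma fun_op:
  assumes "u \<in> fun_op_dom \<Omega> lam v g"
  shows "fun_op \<Omega> lam v g u \<in> L2 \<Omega>"
    and "L2_inner \<Omega> (fun_op \<Omega> lam v g u) (v j) = g (complex_of_real (lam j)) * L2_inner \<Omega> u (v j)"
proof -
  have "\<exists>w. w \<in> L2 \<Omega> \<and> (\<lambda>n. L2_norm \<Omega> (\<lambda>x. w x -
        (\<Sum>j<n. g (complex_of_real (lam j)) * L2_inner \<Omega> u (v j) * v j x))) \<longlonglongrightarrow> 0"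
    using riesz_fischer[of "\<lambda>j. g (complex_of_real (lam j)) * L2_inner \<Omega> u (v j)"] assms
    unfolding fun_op_dom_def by blast
  from someI_ex[OF this] have *: "fun_op \<Omega> lam v g u \<in> L2 \<Omega>"
    "(\<lambda>n. L2_norm \<Omega> (\<lambda>x. fun_op \<Omega> lam v g u x -
        (\<Sum>j<n. g (complex_of_real (lam j)) * L2_inner \<Omega> u (v j) * v j x))) \<longlonglongrightarrow> 0"
    unfolding fun_op_def[symmetric] by auto
  from *(1) show "fun_op \<Omega> lam v g u \<in> L2 \<Omega>" .
  show "L2_inner \<Omega> (fun_op \<Omega> lam v g u) (v j) = g (complex_of_real (lam j)) * L2_inner \<Omega> u (v j)"
    using limit_coefficient[OF *] .
qed

section \<open>The elliptic operator and its resolvent in terms of coefficients\<close>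

text \<open>Test the weak equation with an eigenfunction and move the operator onto it by Hermitian
  symmetry.\<close>

lemma elliptic_op_coefficient:
  assumes "elliptic_op \<Omega> A c w h"
  shows "w \<in> L2 \<Omega>" and "complex_of_real (lam j) * L2_inner \<Omega> w (v j) = L2_inner \<Omega> h (v j)"
proof -
  obtain G where G: "H10_with_gradient \<Omega> w G"
    "\<And>\<phi> H. H10_with_gradient \<Omega> \<phi> H \<Longrightarrow> energy_form \<Omega> A c w G \<phi> H = L2_inner \<Omega> h \<phi>"
    using assms by (auto simp: elliptic_op_def)
  note L = H10_imp_L2[OF G(1)]
  show "w \<in> L2 \<Omega>" by (rule L)
  have "L2_inner \<Omega> h (v j) = energy_form \<Omega> A c w G (v j) (dv j)"
    using G(2)[OF dv(1)] by simp
  also have "\<dots> = cnj (energy_form \<Omega> A c (v j) (dv j) w G)"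
    by (intro energy_form_cnj admissible v_L2 dv_L2 L)
  also have "\<dots> = complex_of_real (lam j) * L2_inner \<Omega> w (v j)"
    using dv(2)[OF G(1)] by (simp flip: L2_inner_cnj)
  finally show "complex_of_real (lam j) * L2_inner \<Omega> w (v j) = L2_inner \<Omega> h (v j)" ..
qed

text \<open>The form shifted by z need not be coercive, so the solution is built as the series with
  coefficients \<open>a j\<close>. The series converges in L2; summability of \<open>lam j\<close>
  times |\<open>a j\<close>|^2 together with coercivity makes the gradients of the partial sums
  converge as well. Closedness places the limit in the form domain, and continuity of the form
  carries the weak equation over from the partial sums.\<close>

lemma resolvent_exists:
  assumes f: "f \<in> L2 \<Omega>" and \<delta>: "\<delta> > 0" "\<And>j. \<delta> \<le> cmod (complex_of_real (lam j) - z)"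
  shows "\<exists>w. elliptic_op \<Omega> A c w (\<lambda>x. f x + z * w x)"
proof -
  have \<Omega>: "\<Omega> \<in> lmeasurable" using admissible by (rule admissible_lmeasurable)
  define fj where "fj j = L2_inner \<Omega> f (v j)" for j
  define a where "a j = fj j / (complex_of_real (lam j) - z)" for j
  have nz: "complex_of_real (lam j) - z \<noteq> 0" for j
    using \<delta>(1) \<delta>(2)[of j] by auto
  have aeq: "complex_of_real (lam j) * a j = fj j + z * a j" for j
    using nz[of j] by (simp add: a_def field_simps)
  have sf: "summable (\<lambda>j. (cmod (fj j))\<^sup>2)"
    unfolding fj_def by (rule coefficients_summable[OF f])
  have a2: "(cmod (a j))\<^sup>2 \<le> (1 / \<delta>\<^sup>2) * (cmod (fj j))\<^sup>2" for j
  proof -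
    have "(cmod (a j))\<^sup>2 = (cmod (fj j))\<^sup>2 / (cmod (complex_of_real (lam j) - z))\<^sup>2"
      by (simp add: a_def norm_divide power_divide)
    also have "\<dots> \<le> (cmod (fj j))\<^sup>2 / \<delta>\<^sup>2"
      using \<delta>(1) \<delta>(2)[of j] nz[of j] by (intro divide_left_mono power_mono mult_pos_pos zero_less_power) auto
    finally show ?thesis by simp
  qed
  have sa: "summable (\<lambda>j. (cmod (a j))\<^sup>2)"
    by (rule summable_comparison_test'[OF summable_mult[OF sf, of "1 / \<delta>\<^sup>2"], of 0]) (use a2 in auto)
  \<comment> \<open>Bound \<open>lam j\<close> by |\<open>lam j\<close> - z| + |z|. The first
    summand cancels one of the two denominators in |\<open>a j\<close>|^2, so a single factor
    1/\<delta> remains.\<close>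
  have la: "lam j * (cmod (a j))\<^sup>2 \<le> (1 / \<delta> + cmod z / \<delta>\<^sup>2) * (cmod (fj j))\<^sup>2" for j
  proof -
    have "lam j \<le> cmod (complex_of_real (lam j) - z) + cmod z"
      using norm_triangle_ineq[of "complex_of_real (lam j) - z" z] by simp
    then have "lam j * (cmod (a j))\<^sup>2 \<le> (cmod (complex_of_real (lam j) - z) + cmod z) * (cmod (a j))\<^sup>2"
      by (intro mult_right_mono) auto
    also have "\<dots> = cmod (complex_of_real (lam j) - z) * (cmod (a j))\<^sup>2 + cmod z * (cmod (a j))\<^sup>2"
      by (simp add: distrib_right)
    also have "cmod (complex_of_real (lam j) - z) * (cmod (a j))\<^sup>2 = (cmod (fj j))\<^sup>2 / cmod (complex_of_real (lam j) - z)"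
      using nz[of j] by (simp add: a_def norm_divide power2_eq_square)
    also have "\<dots> \<le> (cmod (fj j))\<^sup>2 / \<delta>"
      using \<delta>(1) \<delta>(2)[of j] nz[of j] by (intro divide_left_mono mult_pos_pos) auto
    also have "cmod z * (cmod (a j))\<^sup>2 \<le> cmod z * ((1 / \<delta>\<^sup>2) * (cmod (fj j))\<^sup>2)"
      using a2 by (intro mult_left_mono) auto
    finally show ?thesis by (simp add: algebra_simps)
  qed
  have sl: "summable (\<lambda>j. lam j * (cmod (a j))\<^sup>2)"
    by (rule summable_comparison_test'[OF summable_mult[OF sf, of "1 / \<delta> + cmod z / \<delta>\<^sup>2"], of 0])
      (use la lam_pos in \<open>auto simp: less_imp_le abs_mult\<close>)
  let ?S = "\<lambda>n x. \<Sum>j<n. a j * v j x" and ?D = "\<lambda>n x. \<Sum>j<n. a j *s dv j x"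
  have HS: "H10_with_gradient \<Omega> (\<lambda>x. \<Sum>j\<in>J. a j * v j x) (\<lambda>x. \<Sum>j\<in>J. a j *s dv j x)" for J
    by (intro H10_sum \<Omega> H10_scale dv)
  have energy: "energy_form \<Omega> A c (\<lambda>x. \<Sum>j\<in>J. a j * v j x) (\<lambda>x. \<Sum>j\<in>J. a j *s dv j x) \<phi> H
      = L2_inner \<Omega> (\<lambda>x. \<Sum>j\<in>J. complex_of_real (lam j) * a j * v j x) \<phi>"
    if H: "H10_with_gradient \<Omega> \<phi> H" for J \<phi> H
    using H10_imp_L2[OF H]
    by (simp add: energy_form_sum_left[OF admissible] v_L2 dv_L2 dv(2)[OF H] L2_inner_sum_left L2_scale
        L2_inner_scale_left mult_ac)
  obtain w where w: "w \<in> L2 \<Omega>" "(\<lambda>n. L2_norm \<Omega> (\<lambda>x. w x - ?S n x)) \<longlonglongrightarrow> 0"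
    using riesz_fischer[OF sa] by blast
  obtain \<alpha> where \<alpha>: "\<alpha> > 0" "\<And>w G. w \<in> L2 \<Omega> \<Longrightarrow> G \<in> L2 \<Omega> \<Longrightarrow> \<alpha> * (L2_norm \<Omega> G)\<^sup>2 \<le> Re (energy_form \<Omega> A c w G w G)"
    using energy_form_coercive[OF admissible] by blast
  have dnorm: "(L2_norm \<Omega> (\<lambda>x. \<Sum>j\<in>J. a j *s dv j x))\<^sup>2 \<le> 1 / \<alpha> * (\<Sum>j\<in>J. lam j * (cmod (a j))\<^sup>2)" if "finite J" for J
  proof -
    let ?SJ = "\<lambda>x. \<Sum>j\<in>J. a j * v j x"
    have "L2_inner \<Omega> (\<lambda>x. \<Sum>j\<in>J. complex_of_real (lam j) * a j * v j x) ?SJ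
        = (\<Sum>j\<in>J. complex_of_real (lam j) * a j * L2_inner \<Omega> (v j) ?SJ)"
      by (subst L2_inner_sum_left) (auto intro: L2_scale v_L2 partial_sum_L2 simp: L2_inner_scale_left)
    also have "\<dots> = (\<Sum>j\<in>J. complex_of_real (lam j) * a j * cnj (a j))"
      using that by (intro sum.cong refl) (subst L2_inner_cnj, simp add: partial_sum_inner)
    also have "\<dots> = complex_of_real (\<Sum>j\<in>J. lam j * (cmod (a j))\<^sup>2)"
      by (simp add: complex_norm_square[symmetric] mult.assoc)
    finally have "\<alpha> * (L2_norm \<Omega> (\<lambda>x. \<Sum>j\<in>J. a j *s dv j x))\<^sup>2 \<le> (\<Sum>j\<in>J. lam j * (cmod (a j))\<^sup>2)"
      using \<alpha>(2)[OF H10_imp_L2[OF HS], of J J] energy[OF HS, of J J] by (simp only: Re_complex_of_real)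
    then show ?thesis
      using \<alpha>(1) by (simp add: field_simps)
  qed
  obtain G where G: "G \<in> L2 \<Omega>" "(\<lambda>n. L2_norm \<Omega> (\<lambda>x. G x - ?D n x)) \<longlonglongrightarrow> 0"
  proof (rule L2_complete[OF \<Omega>, where u = ?D])
    fix e :: real assume "e > 0"
    let ?d = "\<lambda>m n. L2_norm \<Omega> (\<lambda>x. ?D m x - ?D n x)"
    have "\<exists>N. \<forall>m\<ge>N. \<forall>n\<ge>N. (?d m n)\<^sup>2 < e\<^sup>2"
    proof (rule cauchy_partial_sums[OF _ sl, where K = "1 / \<alpha>"])
      show "(?d m n)\<^sup>2 \<le> 1 / \<alpha> * (\<Sum>j\<in>{m..<n}. lam j * (cmod (a j))\<^sup>2)" if "m \<le> n" for m n
        using that dnorm[of "{m..<n}"] by (subst L2_norm_minus_commute) (simp add: partial_sum_diff)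
      show "(?d m n)\<^sup>2 = (?d n m)\<^sup>2" for m n
        by (subst L2_norm_minus_commute) simp
    qed (use \<open>e > 0\<close> \<alpha>(1) lam_pos in \<open>auto simp: less_imp_le\<close>)
    then show "\<exists>N. \<forall>m\<ge>N. \<forall>n\<ge>N. ?d m n < e"
      using \<open>e > 0\<close> by (meson less_imp_le power2_less_imp_less)
  qed (use H10_imp_L2(2)[OF HS] in auto)
  have wG: "H10_with_gradient \<Omega> w G"
    by (rule H10_closed[OF \<Omega> HS w(1) G(1) w(2) G(2)])
  define h where "h x = f x + z * w x" for x
  have hL2: "h \<in> L2 \<Omega>"
    unfolding h_def by (intro L2_add L2_scale f w)
  have hlim: "(\<lambda>n. L2_norm \<Omega> (\<lambda>x. h x - (\<Sum>j<n. complex_of_real (lam j) * a j * v j x))) \<longlonglongrightarrow> 0"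
  proof (rule tendsto_sandwich[OF _ _ tendsto_const])
    have "(\<lambda>n. L2_norm \<Omega> (\<lambda>x. f x - (\<Sum>j<n. fj j * v j x)) + cmod z * L2_norm \<Omega> (\<lambda>x. w x - ?S n x)) \<longlonglongrightarrow> 0 + cmod z * 0"
      unfolding fj_def by (intro tendsto_intros expansion[OF f] w)
    then show "(\<lambda>n. L2_norm \<Omega> (\<lambda>x. f x - (\<Sum>j<n. fj j * v j x)) + cmod z * L2_norm \<Omega> (\<lambda>x. w x - ?S n x)) \<longlonglongrightarrow> 0"
      by simp
    have "L2_norm \<Omega> (\<lambda>x. h x - (\<Sum>j<n. complex_of_real (lam j) * a j * v j x))
        \<le> L2_norm \<Omega> (\<lambda>x. f x - (\<Sum>j<n. fj j * v j x)) + cmod z * L2_norm \<Omega> (\<lambda>x. w x - ?S n x)" for n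
    proof -
      have "(\<lambda>x. h x - (\<Sum>j<n. complex_of_real (lam j) * a j * v j x))
          = (\<lambda>x. (f x - (\<Sum>j<n. fj j * v j x)) + z * (w x - ?S n x))"
        unfolding h_def aeq distrib_right sum.distrib
        by (simp add: fun_eq_iff right_diff_distrib sum_distrib_left mult.assoc)
      then show ?thesis
        using L2_norm_triangle[OF L2_diff[OF f partial_sum_L2] L2_scale[OF L2_diff[OF w(1) partial_sum_L2]]]
        by (simp add: L2_norm_scale)
    qed
    then show "\<forall>\<^sub>F n in sequentially. L2_norm \<Omega> (\<lambda>x. h x - (\<Sum>j<n. complex_of_real (lam j) * a j * v j x))
        \<le> L2_norm \<Omega> (\<lambda>x. f x - (\<Sum>j<n. fj j * v j x)) + cmod z * L2_norm \<Omega> (\<lambda>x. w x - ?S n x)"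
      by simp
  qed simp
  have "energy_form \<Omega> A c w G \<phi> H = L2_inner \<Omega> h \<phi>" if H: "H10_with_gradient \<Omega> \<phi> H" for \<phi> H
  proof (rule LIMSEQ_unique)
    note LH = H10_imp_L2[OF H]
    obtain K where K: "K > 0" "\<And>w G \<phi> H. w \<in> L2 \<Omega> \<Longrightarrow> G \<in> L2 \<Omega> \<Longrightarrow> \<phi> \<in> L2 \<Omega> \<Longrightarrow> H \<in> L2 \<Omega> \<Longrightarrow>
        cmod (energy_form \<Omega> A c w G \<phi> H) \<le> K * (L2_norm \<Omega> G * L2_norm \<Omega> H + L2_norm \<Omega> w * L2_norm \<Omega> \<phi>)"
      using energy_form_bound[OF admissible] by blast
    show "(\<lambda>n. energy_form \<Omega> A c (?S n) (?D n) \<phi> H) \<longlonglongrightarrow> L2_inner \<Omega> h \<phi>"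
      unfolding energy[OF H] by (intro L2_inner_tendsto hL2 hlim LH) (rule partial_sum_L2)
    have "(\<lambda>n. energy_form \<Omega> A c w G \<phi> H - energy_form \<Omega> A c (?S n) (?D n) \<phi> H) \<longlonglongrightarrow> 0"
    proof (rule Lim_null_comparison)
      have "norm (energy_form \<Omega> A c w G \<phi> H - energy_form \<Omega> A c (?S n) (?D n) \<phi> H)
          \<le> K * (L2_norm \<Omega> (\<lambda>x. G x - ?D n x) * L2_norm \<Omega> H + L2_norm \<Omega> (\<lambda>x. w x - ?S n x) * L2_norm \<Omega> \<phi>)" for n
        using K(2)[OF L2_diff[OF w(1) H10_imp_L2(1)[OF HS]] L2_diff[OF G(1) H10_imp_L2(2)[OF HS]] LH, of "{..<n}" "{..<n}"]
        by (simp add: energy_form_diff_left[OF admissible w(1) G(1) H10_imp_L2[OF HS] LH])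
      then show "\<forall>\<^sub>F n in sequentially. norm (energy_form \<Omega> A c w G \<phi> H - energy_form \<Omega> A c (?S n) (?D n) \<phi> H)
          \<le> K * (L2_norm \<Omega> (\<lambda>x. G x - ?D n x) * L2_norm \<Omega> H + L2_norm \<Omega> (\<lambda>x. w x - ?S n x) * L2_norm \<Omega> \<phi>)"
        by simp
      have "(\<lambda>n. K * (L2_norm \<Omega> (\<lambda>x. G x - ?D n x) * L2_norm \<Omega> H + L2_norm \<Omega> (\<lambda>x. w x - ?S n x) * L2_norm \<Omega> \<phi>))
          \<longlonglongrightarrow> K * (0 * L2_norm \<Omega> H + 0 * L2_norm \<Omega> \<phi>)"
        by (intro tendsto_intros w G)
      then show "(\<lambda>n. K * (L2_norm \<Omega> (\<lambda>x. G x - ?D n x) * L2_norm \<Omega> H + L2_norm \<Omega> (\<lambda>x. w x - ?S n x) * L2_norm \<Omega> \<phi>)) \<longlonglongrightarrow> 0"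
        by simp
    qed
    then show "(\<lambda>n. energy_form \<Omega> A c (?S n) (?D n) \<phi> H) \<longlonglongrightarrow> energy_form \<Omega> A c w G \<phi> H"
      by (rule Lim_transform2[OF tendsto_const])
  qed
  then have "elliptic_op \<Omega> A c w h"
    unfolding elliptic_op_def using hL2 wG by blast
  then show ?thesis
    unfolding h_def[abs_def] by blast
qed

text \<open>Any solution has the same coefficients, since each is determined by dividing by
  \<open>lam j\<close> - z; the arbitrary choice in \<open>resolvent\<close> therefore does no
  harm.\<close>

lemma resolvent:
  assumes f: "f \<in> L2 \<Omega>" and \<delta>: "\<delta> > 0" "\<And>j. \<delta> \<le> cmod (complex_of_real (lam j) - z)"
  shows "resolvent \<Omega> A c z f \<in> L2 \<Omega>"
    and "L2_inner \<Omega> (resolvent \<Omega> A c z f) (v j) = L2_inner \<Omega> f (v j) / (complex_of_real (lam j) - z)"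
proof -
  let ?w = "resolvent \<Omega> A c z f"
  have *: "elliptic_op \<Omega> A c ?w (\<lambda>x. f x + z * ?w x)"
    unfolding resolvent_def by (rule someI_ex[OF resolvent_exists[OF assms]])
  show L: "?w \<in> L2 \<Omega>" by (rule elliptic_op_coefficient[OF *])
  have "complex_of_real (lam j) * L2_inner \<Omega> ?w (v j) = L2_inner \<Omega> f (v j) + z * L2_inner \<Omega> ?w (v j)"
    using elliptic_op_coefficient(2)[OF *, of j]
    by (simp add: L2_inner_add_left[OF f L2_scale[OF L] v_L2] L2_inner_scale_left)
  moreover have "complex_of_real (lam j) - z \<noteq> 0"
    using \<delta>(1) \<delta>(2)[of j] by auto
  ultimately show "L2_inner \<Omega> ?w (v j) = L2_inner \<Omega> f (v j) / (complex_of_real (lam j) - z)"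
    by (simp add: field_simps)
qed

end

section \<open>The trapezoidal rule on a strip\<close>

text \<open>The Gudermannian function: a bounded primitive of 1/cosh.\<close>

lemma arctan_sinh_derivative: "((\<lambda>x. arctan (sinh x)) has_real_derivative 1 / cosh x) (at (x :: real) within S)"
proof -
  have "1 + (sinh x)\<^sup>2 = (cosh x)\<^sup>2"
    using cosh_square_eq[of x] by simp
  then show ?thesis
    by (auto intro!: derivative_eq_intros simp: power2_eq_square field_simps)
qed

text \<open>The bound is uniform in X because the integral of 1/cosh over the whole real line is
  pi.\<close>

lemma horizontal_integral_bound:
  assumes f: "continuous_on (closed_segment (Complex (-X) t) (Complex X t)) f"
    and "0 \<le> X"
    and B: "\<And>x. cmod (f (Complex x t)) \<le> B / cosh x"
  shows "cmod (contour_integral (linepath (Complex (-X) t) (Complex X t)) f) \<le> pi * B"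
proof -
  let ?a = "Complex (-X) t" and ?b = "Complex X t"
  have B0: "B \<ge> 0" using B[of 0] by (smt (verit) norm_ge_zero cosh_0 div_by_1)
  have lp: "linepath ?a ?b s = Complex (X * (2 * s - 1)) t" for s
    by (simp add: linepath_def complex_eq_iff algebra_simps)
  have ba: "?b - ?a = complex_of_real (2 * X)"
    by (simp add: complex_eq_iff)
  have "(f has_contour_integral contour_integral (linepath ?a ?b) f) (linepath ?a ?b)"
    using f by (intro has_contour_integral_integral contour_integrable_continuous_linepath)
  then have hi: "((\<lambda>s. f (linepath ?a ?b s) * (?b - ?a)) has_integral contour_integral (linepath ?a ?b) f) {0..1}"
    by (simp add: has_contour_integral_linepath)
  have "((\<lambda>s. B * arctan (sinh (X * (2 * s - 1)))) has_vector_derivative B * (2 * X / cosh (X * (2 * s - 1)))) (at s within {0..1})" for s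
  proof -
    have "((\<lambda>s. arctan (sinh (X * (2 * s - 1)))) has_real_derivative 1 / cosh (X * (2 * s - 1)) * (2 * X)) (at s within {0..1})"
      by (rule DERIV_chain2[OF arctan_sinh_derivative]) (auto intro!: derivative_eq_intros)
    from DERIV_cmult[OF this, of B] show ?thesis
      by (simp add: has_real_derivative_iff_has_vector_derivative)
  qed
  from fundamental_theorem_of_calculus[OF _ this]
  have hB: "((\<lambda>s. B * (2 * X / cosh (X * (2 * s - 1)))) has_integral B * arctan (sinh X) - B * arctan (sinh (-X))) {0..1}"
    by simp
  have "cmod (integral {0..1} (\<lambda>s. f (linepath ?a ?b s) * (?b - ?a)))
      \<le> integral {0..1} (\<lambda>s. B * (2 * X / cosh (X * (2 * s - 1))))"
  proof (rule integral_norm_bound_integral)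
    fix s :: real
    have "cmod (f (linepath ?a ?b s) * (?b - ?a)) = cmod (f (Complex (X * (2 * s - 1)) t)) * (2 * X)"
      using \<open>0 \<le> X\<close> unfolding lp ba norm_mult norm_of_real by simp
    also have "\<dots> \<le> B / cosh (X * (2 * s - 1)) * (2 * X)"
      using B \<open>0 \<le> X\<close> by (intro mult_right_mono) auto
    finally show "cmod (f (linepath ?a ?b s) * (?b - ?a)) \<le> B * (2 * X / cosh (X * (2 * s - 1)))"
      by simp
  qed (use hi hB in blast)+
  then have "cmod (contour_integral (linepath ?a ?b) f) \<le> B * arctan (sinh X) - B * arctan (sinh (-X))"
    using integral_unique[OF hi] integral_unique[OF hB] by simp
  also have "\<dots> = B * (2 * arctan (sinh X))"
    by (simp add: arctan_minus)
  also have "\<dots> \<le> B * pi"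
    using B0 arctan_ubound[of "sinh X"] by (intro mult_left_mono) auto
  finally show ?thesis by (simp add: mult.commute)
qed

text \<open>exp (c w) - 1 has a simple zero at z with derivative c there. For c = 2 pi i / k the
  residue times 2 pi i is k h(z), a term of the trapezoidal sum.\<close>

lemma residue_exp_kernel:
  fixes c :: complex
  assumes S: "open S" "z \<in> S" and h: "h holomorphic_on S" and c: "c \<noteq> 0" and z: "exp (c * z) = 1"
    and nz: "\<And>w. w \<in> S - {z} \<Longrightarrow> exp (c * w) \<noteq> 1"
  shows "residue (\<lambda>w. h w / (exp (c * w) - 1)) z = h z / c"
proof (rule residue_simple'[OF S])
  show "(\<lambda>w. h w / (exp (c * w) - 1)) holomorphic_on S - {z}"
    using nz by (intro holomorphic_intros holomorphic_on_subset[OF h]) auto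
  have "((\<lambda>w. exp (c * w)) has_field_derivative c) (at z)"
    using z by (auto intro!: derivative_eq_intros)
  then have "((\<lambda>w. (exp (c * w) - 1) / (w - z)) \<longlongrightarrow> c) (at z)"
    using z by (simp add: has_field_derivative_iff)
  moreover have "(h \<longlongrightarrow> h z) (at z)"
    using holomorphic_on_imp_continuous_on[OF h] S by (simp add: continuous_on_eq_continuous_at continuous_at)
  ultimately have "((\<lambda>w. h w / ((exp (c * w) - 1) / (w - z))) \<longlongrightarrow> h z / c) (at z)"
    using c by (intro tendsto_intros)
  then show "((\<lambda>w. h w / (exp (c * w) - 1) * (w - z)) \<longlongrightarrow> h z / c) (at z)"
    by simp
qed

lemma exp_2pi_i_eq_1:
  assumes "k > 0" "exp (complex_of_real (2 * pi / k) * \<i> * y) = 1"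
  obtains j :: int where "y = complex_of_real (of_int j * k)"
proof -
  obtain j :: int where "Re (complex_of_real (2 * pi / k) * \<i> * y) = 0" "Im (complex_of_real (2 * pi / k) * \<i> * y) = of_int (2 * j) * pi"
    using assms(2) by (auto simp: exp_eq_1)
  then have "y = complex_of_real (of_int j * k)"
    using assms(1) by (auto simp: complex_eq_iff field_simps)
  then show thesis by (rule that)
qed

text \<open>The rectangle stays finite and the integral of h is expressed through the primitive
  \<open>H\<close>, so no improper integral appears; the limit in \<open>M\<close> is left to the
  caller. The first error term comes from the two horizontal sides. The second collects the vertical
  sides, of length 2d each, and the two segments of length d along which \<open>H\<close> is carried
  from the upper side down to the real axis.\<close>

lemma trapezoid_strip:
  fixes h H :: "complex \<Rightarrow> complex" and M :: nat
  assumes d: "0 < d" "d < d1" and k: "0 < k"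
    and h: "h holomorphic_on {y. \<bar>Im y\<bar> < d1}"
    and H: "\<And>y. \<bar>Im y\<bar> < d1 \<Longrightarrow> (H has_field_derivative h y) (at y)"
    and B: "\<And>y. \<bar>Im y\<bar> \<le> d \<Longrightarrow> cmod (h y) \<le> B / cosh (Re y)"
    and X: "X = (real M + 1 / 2) * k"
  shows "cmod (complex_of_real k * (\<Sum>j = - int M..int M. h (complex_of_real (of_int j * k)))
      - (H (complex_of_real X) - H (complex_of_real (- X))))
    \<le> 2 * pi * B / (exp (2 * pi * d / k) - 1) + 6 * d * B / cosh X"
proof -
  define c where "c = complex_of_real (2 * pi / k) * \<i>"
  define E where "E = exp (2 * pi * d / k)"
  have c0: "c \<noteq> 0" using k by (simp add: c_def)
  have E: "E > 1" using d k by (simp add: E_def)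
  have X0: "X > 0" using k by (simp add: X)
  have B0: "B \<ge> 0" using B[of 0] d by (smt (verit) norm_ge_zero cosh_0 div_by_1 zero_complex.sel)
  define g where "g y = h y / (exp (c * y) - 1)" for y
  \<comment> \<open>Wider than the rectangle by half a step, so that it contains the rectangle and
    still no nodes beyond index \<open>M\<close>.\<close>
  define S where "S = {y. \<bar>Im y\<bar> < d1 \<and> \<bar>Re y\<bar> < (real M + 1) * k}"
  define pts where "pts = (\<lambda>j::int. complex_of_real (of_int j * k)) ` {- int M..int M}"
  have Sbox: "S = box (Complex (- ((real M + 1) * k)) (- d1)) (Complex ((real M + 1) * k) d1)"
    by (auto simp: S_def in_box_complex_iff)
  have S: "open S" "connected S"
    unfolding Sbox by (auto intro: convex_connected)
  have q1: "exp (c * y) = 1 \<Longrightarrow> y \<in> S \<Longrightarrow> y \<in> pts" for y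
  proof -
    assume "exp (c * y) = 1" "y \<in> S"
    then obtain j :: int where j: "y = complex_of_real (of_int j * k)"
      using exp_2pi_i_eq_1[OF k] by (auto simp: c_def)
    have "\<bar>real_of_int j\<bar> * k < (real M + 1) * k"
      using \<open>y \<in> S\<close> k by (simp add: S_def j abs_mult)
    then have "\<bar>j\<bar> \<le> int M" using k by simp
    then have "j \<in> {- int M..int M}" by auto
    then show "y \<in> pts" unfolding pts_def j by (rule imageI)
  qed
  have pts1: "exp (c * y) = 1" "y \<in> S" if "y \<in> pts" for y
  proof -
    obtain j :: int where "j \<in> {- int M..int M}" and j2: "y = complex_of_real (of_int j * k)"
      using \<open>y \<in> pts\<close> unfolding pts_def by blast
    then have j: "\<bar>j\<bar> \<le> int M" by auto
    note j = j j2
    have "c * y = \<i> * (of_int j * (of_real pi * 2))" using k by (simp add: c_def j)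
    then show "exp (c * y) = 1" by (simp only: exp_2pi_1_int)
    have "\<bar>real_of_int j\<bar> * k < (real M + 1) * k"
      using j(1) k by (intro mult_strict_right_mono) linarith+
    then show "y \<in> S" using d k by (simp add: S_def j abs_mult)
  qed
  have hS: "h holomorphic_on S" by (rule holomorphic_on_subset[OF h]) (auto simp: S_def)
  have gS: "g holomorphic_on S - pts"
    unfolding g_def using q1 by (intro holomorphic_intros holomorphic_on_subset[OF hS]) auto
  define a1 a2 a3 a4 where "a1 = Complex (-X) (-d)" and "a2 = Complex X (-d)" and "a3 = Complex X d" and "a4 = Complex (-X) d"
  have XM: "X < (real M + 1) * k" using k by (simp add: X)
  have ptsX: "\<bar>Re y\<bar> < X \<and> Im y = 0" if "y \<in> pts" for y
  proof -
    obtain j :: int where "j \<in> {- int M..int M}" and j2: "y = complex_of_real (of_int j * k)"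
      using \<open>y \<in> pts\<close> unfolding pts_def by blast
    then have j: "\<bar>j\<bar> \<le> int M" by auto
    note j = j j2
    have "\<bar>real_of_int j\<bar> * k < (real M + 1 / 2) * k"
      using j(1) k by (intro mult_strict_right_mono) linarith+
    then show ?thesis using k by (simp add: j abs_mult X)
  qed
  have img: "path_image (rectpath a1 a3) \<subseteq> S - pts"
    using X0 d XM ptsX by (auto simp: path_image_rectpath a1_def a3_def S_def) fastforce+
  have res: "residue g p = h p / c" if "p \<in> pts" for p
  proof -
    have "finite pts" by (simp add: pts_def)
    then have o: "open (S - (pts - {p}))" using S(1) by (simp add: open_Diff finite_imp_closed)
    show ?thesis
      unfolding g_def using that q1 pts1[OF that] c0
      by (intro residue_exp_kernel[OF o]) (auto intro: holomorphic_on_subset[OF hS])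
  qed
  have "contour_integral (rectpath a1 a3) g = 2 * pi * \<i> * (\<Sum>p\<in>pts. winding_number (rectpath a1 a3) p * residue g p)"
  proof (rule Residue_theorem[OF S])
    show "\<forall>z. z \<notin> S \<longrightarrow> winding_number (rectpath a1 a3) z = 0"
      using X0 d XM by (intro allI impI winding_number_rectpath_outside)
        (auto simp: a1_def a3_def S_def in_cbox_complex_iff)
  qed (use gS img in \<open>auto simp: pts_def\<close>)
  also have "(\<Sum>p\<in>pts. winding_number (rectpath a1 a3) p * residue g p) = (\<Sum>p\<in>pts. h p / c)"
    using ptsX d by (intro sum.cong refl) (subst winding_number_rectpath, fastforce simp: a1_def a3_def in_box_complex_iff, simp add: res)
  also have "\<dots> = (\<Sum>j = - int M..int M. h (complex_of_real (of_int j * k))) / c"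
    unfolding pts_def sum_divide_distrib using k by (subst sum.reindex) (auto simp: inj_on_def)
  also have "2 * pi * \<i> * (\<dots>) = complex_of_real k * (\<Sum>j = - int M..int M. h (complex_of_real (of_int j * k)))"
    using k by (simp add: c_def)
  finally have main: "contour_integral (rectpath a1 a3) g = complex_of_real k * (\<Sum>j = - int M..int M. h (complex_of_real (of_int j * k)))" .
  have gc: "continuous_on (path_image (rectpath a1 a3)) g"
    by (rule holomorphic_on_imp_continuous_on[OF holomorphic_on_subset[OF gS img]])
  have segs: "path_image (rectpath a1 a3) = closed_segment a1 a2 \<union> closed_segment a2 a3 \<union> closed_segment a3 a4 \<union> closed_segment a4 a1"
    by (auto simp: rectpath_def Let_def path_image_join a1_def a2_def a3_def a4_def)
  have gseg: "continuous_on (closed_segment a1 a2) g" "continuous_on (closed_segment a4 a3) g"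
    unfolding closed_segment_commute[of a4 a3] by (auto intro!: continuous_on_subset[OF gc] simp: segs)
  have gint: "g contour_integrable_on linepath a1 a2" "g contour_integrable_on linepath a2 a3"
     "g contour_integrable_on linepath a3 a4" "g contour_integrable_on linepath a4 a1"
    by (auto intro!: contour_integrable_continuous_linepath continuous_on_subset[OF gc] simp: segs)
  have four: "contour_integral (rectpath a1 a3) g = contour_integral (linepath a1 a2) g + contour_integral (linepath a2 a3) g
      + contour_integral (linepath a3 a4) g + contour_integral (linepath a4 a1) g"
    using gint by (simp add: rectpath_def a1_def a2_def a3_def a4_def Let_def contour_integrable_joinI)
  have cnorm: "cmod (exp (c * y)) = exp (- (2 * pi * Im y / k))" for y
    by (simp add: c_def norm_exp_eq_Re)
  have hcont: "continuous_on T h" if "T \<subseteq> {y. \<bar>Im y\<bar> < d1}" for T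
    using holomorphic_on_imp_continuous_on[OF h] that by (rule continuous_on_subset)
  have seg_d1: "closed_segment (Complex x y) (Complex x' y') \<subseteq> {y. \<bar>Im y\<bar> < d1}" if "\<bar>y\<bar> \<le> d" "\<bar>y'\<bar> \<le> d" for x y x' y'
  proof (rule closed_segment_subset)
    have "{y. \<bar>Im y\<bar> < d1} = {y. Im y < d1} \<inter> {y. Im y > - d1}" by auto
    then show "convex {y. \<bar>Im y\<bar> < d1}"
      by (simp add: convex_Int convex_halfspace_Im_lt convex_halfspace_Im_gt)
  qed (use that d in auto)
  have Hint: "contour_integral (linepath p q) h = H q - H p" if "closed_segment p q \<subseteq> {y. \<bar>Im y\<bar> < d1}" for p q
    using contour_integral_primitive[of "{y. \<bar>Im y\<bar> < d1}" H h "linepath p q"] H that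
    by (auto intro: has_field_derivative_at_within contour_integral_unique)
  \<comment> \<open>below the real axis the kernel is small\<close>
  have bot: "cmod (contour_integral (linepath a1 a2) g) \<le> pi * (B / (E - 1))"
    unfolding a1_def a2_def
  proof (rule horizontal_integral_bound)
    show "continuous_on (closed_segment (Complex (- X) (- d)) (Complex X (- d))) g"
      using gseg(1) by (simp add: a1_def a2_def)
    fix x
    have "cmod (exp (c * Complex x (-d))) = E" unfolding cnorm E_def by simp
    then have "E - 1 \<le> cmod (exp (c * Complex x (-d)) - 1)"
      using norm_triangle_ineq2[of "exp (c * Complex x (-d))" 1] by simp
    moreover have "cmod (h (Complex x (-d))) \<le> B / cosh x"
      using B[of "Complex x (-d)"] d by simp
    ultimately have "cmod (g (Complex x (-d))) \<le> (B / cosh x) / (E - 1)"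
      unfolding g_def norm_divide using E B0 by (intro frac_le) auto
    then show "cmod (g (Complex x (-d))) \<le> B / (E - 1) / cosh x" by (simp add: field_simps)
  qed (use X0 in simp)
  \<comment> \<open>above the real axis the kernel is close to -1\<close>
  have top: "cmod (contour_integral (linepath a3 a4) g - (H a3 - H a4)) \<le> pi * (B / (E - 1))"
  proof -
    have "continuous_on (closed_segment a4 a3) h"
      using seg_d1[of d d "-X" X] d unfolding a3_def a4_def by (intro hcont) auto
    note cont = gseg(2) this
    have "contour_integral (linepath a3 a4) g - (H a3 - H a4)
        = - (contour_integral (linepath a4 a3) g + contour_integral (linepath a4 a3) h)"
      using cont seg_d1[of d d "-X" X] d
      by (subst contour_integral_reverse_linepath) (auto simp: Hint a3_def a4_def)
    also have "contour_integral (linepath a4 a3) g + contour_integral (linepath a4 a3) h = contour_integral (linepath a4 a3) (\<lambda>y. g y + h y)"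
      using cont by (intro contour_integral_add[symmetric] contour_integrable_continuous_linepath)
    also have "cmod (- \<dots>) \<le> pi * (B / (E - 1))"
      unfolding norm_minus_cancel unfolding a3_def a4_def
    proof (rule horizontal_integral_bound)
      show "continuous_on (closed_segment (Complex (- X) d) (Complex X d)) (\<lambda>y. g y + h y)"
        using cont by (intro continuous_intros) (auto simp: a3_def a4_def)
      fix x
      let ?q = "exp (c * Complex x d)"
      have nq: "cmod ?q = 1 / E" unfolding cnorm E_def by (simp add: exp_minus inverse_eq_divide)
      have "1 - 1 / E \<le> cmod (?q - 1)"
        using norm_triangle_ineq2[of 1 ?q] nq by (simp add: norm_minus_commute)
      moreover have pos: "1 - 1 / E > 0" using E by simp
      ultimately have "?q \<noteq> 1" by auto
      then have "g (Complex x d) + h (Complex x d) = h (Complex x d) * (?q / (?q - 1))"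
        by (simp add: g_def field_simps)
      then have "cmod (g (Complex x d) + h (Complex x d)) = cmod (h (Complex x d)) * ((1 / E) / cmod (?q - 1))"
        by (simp only: norm_mult norm_divide nq)
      also have "\<dots> \<le> (B / cosh x) * ((1 / E) / (1 - 1 / E))"
        using B[of "Complex x d"] d B0 E pos \<open>1 - 1 / E \<le> cmod (?q - 1)\<close>
        by (intro mult_mono frac_le) auto
      also have "\<dots> = B / (E - 1) / cosh x"
        using E by (simp add: field_simps)
      finally show "cmod (g (Complex x d) + h (Complex x d)) \<le> B / (E - 1) / cosh x" .
    qed (use X0 in simp)
    finally show ?thesis .
  qed
  have hside: "cmod (h y) \<le> B / cosh X" if "\<bar>Re y\<bar> = X" "\<bar>Im y\<bar> \<le> d" for y
  proof -
    have "cosh (Re y) = cosh X" using that(1) by (metis cosh_real_abs)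
    then show ?thesis using B[OF that(2)] by (simp only:)
  qed
  have gside: "cmod (g y) \<le> B / cosh X" if "\<bar>Re y\<bar> = X" "\<bar>Im y\<bar> \<le> d" for y
  proof -
    \<comment> \<open>The vertical sides lie midway between nodes, where the exponential is a
      negative real; the denominator of the kernel then has modulus at least 1.\<close>
    have "exp (c * y) = - complex_of_real (exp (- (2 * pi * Im y / k)))"
    proof -
      obtain j :: int where j: "Re y = (of_int j + 1 / 2) * k"
      proof (cases "Re y = X")
        case True
        then show thesis by (intro that[of "int M"]) (simp add: X)
      next
        case False
        then have "Re y = - X" using \<open>\<bar>Re y\<bar> = X\<close> by linarith
        \<comment> \<open>-(M + 1/2) = (-M - 1) + 1/2.\<close>
        then show thesis by (intro that[of "- int M - 1"]) (simp add: X algebra_simps)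
      qed
      have "c * y = (complex_of_real (- (2 * pi * Im y / k)) + \<i> * complex_of_real pi) + \<i> * (of_int j * (of_real pi * 2))"
        using k j by (simp add: c_def complex_eq_iff field_simps)
      then show ?thesis
        by (simp only: exp_plus_2pin exp_add exp_of_real exp_pi_i') simp
    qed
    then have "cmod (exp (c * y) - 1) = 1 + exp (- (2 * pi * Im y / k))"
      by (metis abs_of_nonneg add.commute add_nonneg_nonneg exp_ge_zero minus_add_distrib norm_minus_cancel norm_of_real of_real_1 of_real_add uminus_add_conv_diff zero_le_one diff_conv_add_uminus)
    then have "1 \<le> cmod (exp (c * y) - 1)" by simp
    then have "cmod (g y) \<le> (B / cosh X) / 1"
      unfolding g_def norm_divide using hside[OF that] B0 by (intro frac_le) auto
    then show ?thesis by simp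
  qed
  have BX: "0 \<le> B / cosh X" using B0 by simp
  have vert: "Re y = x \<and> \<bar>Im y\<bar> \<le> d" if "y \<in> closed_segment (Complex x s) (Complex x t)" "\<bar>s\<bar> \<le> d" "\<bar>t\<bar> \<le> d" for x y s t
    using that by (auto simp: closed_segment_same_Re closed_segment_eq_real_ivl split: if_splits)
  have right: "cmod (contour_integral (linepath a2 a3) g) \<le> B / cosh X * (2 * d)"
  proof -
    have "cmod (contour_integral (linepath a2 a3) g) \<le> B / cosh X * cmod (a3 - a2)"
      using gint BX vert[of _ X "-d" d] gside X0 d by (intro contour_integral_bound_linepath) (auto simp: a2_def a3_def)
    also have "cmod (a3 - a2) = 2 * d" using d by (simp add: a2_def a3_def cmod_def real_sqrt_mult)
    finally show ?thesis .
  qed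
  have left: "cmod (contour_integral (linepath a4 a1) g) \<le> B / cosh X * (2 * d)"
  proof -
    have "cmod (contour_integral (linepath a4 a1) g) \<le> B / cosh X * cmod (a1 - a4)"
      using gint BX vert[of _ "-X" d "-d"] gside X0 d by (intro contour_integral_bound_linepath) (auto simp: a1_def a4_def)
    also have "cmod (a1 - a4) = 2 * d" using d by (simp add: a1_def a4_def cmod_def real_sqrt_mult)
    finally show ?thesis .
  qed
  have shift: "cmod (H (Complex x d) - H (complex_of_real x)) \<le> B / cosh X * d" if "\<bar>x\<bar> = X" for x
  proof -
    have "H (Complex x d) - H (complex_of_real x) = contour_integral (linepath (Complex x 0) (Complex x d)) h"
      using seg_d1[of 0 d x x] d by (subst Hint) (auto simp: complex_of_real_def)
    also have "cmod \<dots> \<le> B / cosh X * cmod (Complex x d - Complex x 0)"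
      using BX vert[of _ x 0 d] hside that d seg_d1[of 0 d x x]
      by (intro contour_integral_bound_linepath contour_integrable_continuous_linepath hcont) auto
    also have "cmod (Complex x d - Complex x 0) = d" using d by (simp add: cmod_def)
    finally show ?thesis .
  qed
  have "complex_of_real k * (\<Sum>j = - int M..int M. h (complex_of_real (of_int j * k))) - (H (complex_of_real X) - H (complex_of_real (- X)))
    = contour_integral (linepath a1 a2) g + contour_integral (linepath a2 a3) g
      + (contour_integral (linepath a3 a4) g - (H a3 - H a4)) + contour_integral (linepath a4 a1) g
      + (H (Complex X d) - H (complex_of_real X)) - (H (Complex (-X) d) - H (complex_of_real (- X)))"
    unfolding main[symmetric] four by (simp add: a3_def a4_def)
  also have "cmod \<dots> \<le> pi * (B / (E - 1)) + B / cosh X * (2 * d) + pi * (B / (E - 1)) + B / cosh X * (2 * d)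
      + B / cosh X * d + B / cosh X * d"
    using X0 by (intro norm_triangle_le_diff norm_triangle_le add_mono bot top right left shift) auto
  also have "\<dots> = 2 * pi * B / (exp (2 * pi * d / k) - 1) + 6 * d * B / cosh X"
    by (simp add: E_def algebra_simps)
  finally show ?thesis .
qed

section \<open>The Cauchy integral over an unbounded contour\<close>

lemma cmod_powr_real: "w \<noteq> 0 \<Longrightarrow> cmod (w powr complex_of_real b) = cmod w powr b"
  by (simp add: powr_def norm_exp_eq_Re)

text \<open>The path stays in the right half-plane, avoids the ray from l to infinity and runs
  upwards between conjugate points. On the half-plane the integrand has an explicit primitive up to
  a logarithm: Ln (L - z) is smooth along the path, Ln (z - L) along the arc that closes it at
  radius |P X|. Exchanging these branches at the two endpoints produces 2 pi i, and the arc
  contributes a multiple of |P X|^(-\<beta>), which vanishes in the limit.\<close>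

lemma cauchy_kernel_limit:
  fixes P P' F :: "real \<Rightarrow> complex"
  assumes \<beta>: "0 < \<beta>" and l: "0 < l"
    and P: "\<And>x. (P has_vector_derivative P' x) (at x)"
    and Re_P: "\<And>x. 0 < Re (P x)" and off: "\<And>x. complex_of_real l - P x \<notin> \<real>\<^sub>\<le>\<^sub>0"
    and sym: "\<And>x. P (- x) = cnj (P x)" and Im_P: "\<And>x. 0 < x \<Longrightarrow> 0 < Im (P x)"
    and inf: "filterlim (\<lambda>x. cmod (P x)) at_top at_top"
    and F: "\<And>x. (F has_vector_derivative P x powr (- complex_of_real \<beta>) * P' x / (complex_of_real l - P x)) (at x)"
  shows "((\<lambda>X. F X - F (- X)) \<longlongrightarrow> 2 * complex_of_real pi * \<i> * complex_of_real l powr (- complex_of_real \<beta>)) at_top"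
proof -
  define L where "L = complex_of_real l"
  define f where "f z = z powr (- complex_of_real \<beta>)" for z :: complex
  define D where "D = {z :: complex. 0 < Re z}"
  have D: "open D" "convex D" "L \<in> D"
    using l by (auto simp: D_def L_def open_halfspace_Re_gt convex_halfspace_Re_gt)
  have D0: "z \<notin> \<real>\<^sub>\<le>\<^sub>0" if "z \<in> D" for z
    using that by (auto simp: D_def complex_nonpos_Reals_iff)
  have holf: "f holomorphic_on D"
    unfolding f_def using D0 by (intro holomorphic_intros) auto
  \<comment> \<open>The pole at \<open>L\<close> is split off: the difference quotient of
    \<open>f\<close> is holomorphic across \<open>L\<close> and hence has a primitive on the
    half-plane.\<close>
  define p where "p z = (if z = L then deriv f L else (f z - f L) / (z - L))" for z
  have holp: "p holomorphic_on D"
    unfolding p_def by (rule pole_lemma_open[OF holf D(1)])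
  obtain \<Phi> where \<Phi>': "\<And>z. z \<in> D \<Longrightarrow> (\<Phi> has_field_derivative p z) (at z within D)"
  proof (rule holomorphic_convex_primitive'[OF D(2,1) holp])
    fix g assume "\<And>z. z \<in> D \<Longrightarrow> (g has_field_derivative p z) (at z within D)"
    then show thesis by (rule that)
  qed
  have \<Phi>: "(\<Phi> has_field_derivative p z) (at z)" if "z \<in> D" for z
    using \<Phi>'[OF that] by (simp only: at_within_open[OF that D(1)])
  have split: "f z / (L - z) = - p z + f L / (L - z)" if "z \<noteq> L" for z
    using that by (simp add: p_def field_simps)
  have PD: "P x \<in> D" and PL: "P x \<noteq> L" for x
    using Re_P[of x] off[of x] by (auto simp: D_def L_def)
  \<comment> \<open>\<open>F\<close> minus an explicit primitive along the path; being constant,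
    \<open>G\<close> makes the increments of \<open>F\<close> computable.\<close>
  define G where "G x = F x + \<Phi> (P x) + f L * Ln (L - P x)" for x
  have "(G has_vector_derivative 0) (at x)" for x
  proof -
    have 1: "((\<lambda>x. \<Phi> (P x)) has_vector_derivative P' x * p (P x)) (at x)"
      using field_vector_diff_chain_at[OF P \<Phi>[OF PD]] by (simp add: o_def)
    have "((\<lambda>z. Ln (L - z)) has_field_derivative - (1 / (L - P x))) (at (P x))"
      using off[of x] unfolding L_def by (auto intro!: derivative_eq_intros simp: inverse_eq_divide)
    from field_vector_diff_chain_at[OF P this]
    have 2: "((\<lambda>x. Ln (L - P x)) has_vector_derivative P' x * - (1 / (L - P x))) (at x)"
      by (simp add: o_def)
    have "P x powr (- complex_of_real \<beta>) * P' x / (complex_of_real l - P x) = P' x * (f (P x) / (L - P x))"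
      by (simp add: f_def L_def)
    then have 3: "(F has_vector_derivative P' x * (- p (P x) + f L / (L - P x))) (at x)"
      using F[of x] split[OF PL] by simp
    have "(G has_vector_derivative P' x * (- p (P x) + f L / (L - P x)) + P' x * p (P x) + f L * (P' x * - (1 / (L - P x)))) (at x)"
      unfolding G_def by (intro derivative_intros 1 2 3)
    then show ?thesis by (simp add: algebra_simps)
  qed
  then have Gconst: "G x = G y" for x y
    by (rule has_vector_derivative_zero_constant[of UNIV G, simplified]) auto
  have key: "cmod (F X - F (- X) - 2 * complex_of_real pi * \<i> * f L) \<le> 2 * pi * cmod (P X) powr (- \<beta>)"
    if X: "0 < X" and big: "2 * l \<le> cmod (P X)" for X
  proof -
    define z where "z = P X"
    define R where "R = cmod z"
    define \<alpha> where "\<alpha> = Arg z"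
    have z: "0 < Re z" "0 < Im z" "z \<noteq> 0" "P (- X) = cnj z"
      using Re_P[of X] Im_P[OF X] sym[of X] by (auto simp: z_def)
    have R: "0 < R" "2 * l \<le> R" using z big by (auto simp: R_def z_def)
    have \<alpha>: "\<bar>\<alpha>\<bar> < pi / 2" using Arg_Re_pos[of z] z by (simp add: \<alpha>_def)
    have \<alpha>0: "0 < \<alpha>" using Arg_lt_pi[of z] z by (simp add: \<alpha>_def)
    have zR: "z = complex_of_real R * exp (\<i> * complex_of_real \<alpha>)"
      using Arg_eq[OF z(3)] by (simp add: R_def \<alpha>_def)
    let ?\<gamma> = "part_circlepath 0 R (- \<alpha>) \<alpha>"
    define U where "U = {w \<in> D. w - L \<notin> \<real>\<^sub>\<le>\<^sub>0}"
    have prim: "((\<lambda>w. - \<Phi> w - f L * Ln (w - L)) has_field_derivative f w / (L - w)) (at w within U)" if "w \<in> U" for w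
    proof -
      have w: "w \<in> D" "w - L \<notin> \<real>\<^sub>\<le>\<^sub>0" "w \<noteq> L" using that by (auto simp: U_def)
      have "((\<lambda>w. - \<Phi> w - f L * Ln (w - L)) has_field_derivative - p w - f L * (1 / (w - L))) (at w)"
        using w by (auto intro!: derivative_eq_intros \<Phi> simp: inverse_eq_divide)
      also have "- p w - f L * (1 / (w - L)) = f w / (L - w)"
        using w(3) by (simp add: split[OF w(3)] field_simps)
      finally show ?thesis by (rule has_field_derivative_at_within)
    qed
    have img: "w \<in> U" "cmod w = R" if "w \<in> path_image ?\<gamma>" for w
    proof -
      obtain t where t: "w = complex_of_real R * exp (\<i> * complex_of_real t)" "- \<alpha> \<le> t" "t \<le> \<alpha>"
        using \<open>w \<in> path_image ?\<gamma>\<close> \<alpha>0 by (auto simp: path_image_part_circlepath)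
      show "cmod w = R" using R by (simp add: t(1) norm_mult)
      have Rew: "Re w = R * cos t" "Im w = R * sin t" by (auto simp: t(1) Re_exp Im_exp)
      have "0 < cos t" using t \<alpha> by (intro cos_gt_zero_pi) auto
      then have "w \<in> D" using R Rew by (simp add: D_def)
      moreover have "w - L \<notin> \<real>\<^sub>\<le>\<^sub>0"
      proof
        assume "w - L \<in> \<real>\<^sub>\<le>\<^sub>0"
        then have "sin t = 0" and le: "Re w \<le> l" using Rew R by (auto simp: complex_nonpos_Reals_iff L_def)
        then have "cos t = 1" using \<open>0 < cos t\<close> sin_cos_squared_add[of t] by (simp add: power2_eq_1_iff)
        then show False using le Rew R l by simp
      qed
      ultimately show "w \<in> U" by (simp add: U_def)
    qed
    have ends: "pathstart ?\<gamma> = cnj z" "pathfinish ?\<gamma> = z"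
      by (simp_all add: zR exp_cnj)
    have "((\<lambda>w. f w / (L - w)) has_contour_integral
        (- \<Phi> z - f L * Ln (z - L)) - (- \<Phi> (cnj z) - f L * Ln (cnj z - L))) ?\<gamma>"
      using contour_integral_primitive[OF prim, of ?\<gamma>] img(1) unfolding ends by auto
    then have "cmod ((- \<Phi> z - f L * Ln (z - L)) - (- \<Phi> (cnj z) - f L * Ln (cnj z - L))) \<le> (R powr (- \<beta>) / (R / 2)) * R * (\<alpha> - (- \<alpha>))"
    proof (rule has_contour_integral_bound_part_circlepath)
      fix w assume w: "w \<in> path_image ?\<gamma>"
      have "cmod (f w) = R powr (- \<beta>)"
        using img(2)[OF w] R cmod_powr_real[of w "- \<beta>"] by (auto simp: f_def)
      moreover have "R / 2 \<le> cmod (L - w)"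
        using norm_triangle_ineq2[of w L] img(2)[OF w] R l by (simp add: L_def norm_minus_commute)
      ultimately show "cmod (f w / (L - w)) \<le> R powr (- \<beta>) / (R / 2)"
        unfolding norm_divide using R by (intro frac_le) auto
    qed (use R \<alpha>0 in auto)
    also have "\<dots> = 4 * \<alpha> * R powr (- \<beta>)" using R by (simp add: field_simps)
    also have "\<dots> \<le> 2 * pi * R powr (- \<beta>)" using \<alpha> by (intro mult_right_mono) auto
    finally have arc: "cmod ((- \<Phi> z - f L * Ln (z - L)) - (- \<Phi> (cnj z) - f L * Ln (cnj z - L))) \<le> 2 * pi * R powr (- \<beta>)" .
    \<comment> \<open>The endpoints lie on opposite sides of the real axis, so the two branches
      differ there by i pi with opposite signs; these add up to the residue.\<close>
    have im: "Im (z - L) > 0" "Im (cnj z - L) < 0" using z by (auto simp: L_def)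
    then have "z - L \<noteq> 0" "cnj z - L \<noteq> 0" by auto
    from this[THEN Ln_minus] im
    have ln1: "Ln (L - z) = Ln (z - L) - \<i> * complex_of_real pi"
      and ln2: "Ln (L - cnj z) = Ln (cnj z - L) + \<i> * complex_of_real pi"
      by auto
    have "G X = G (- X)" by (rule Gconst)
    then have "F X - F (- X) = - (\<Phi> z - \<Phi> (cnj z)) - f L * (Ln (L - z) - Ln (L - cnj z))"
      by (simp add: G_def z(4) z_def[symmetric] algebra_simps)
    then have "F X - F (- X) - 2 * complex_of_real pi * \<i> * f L
        = (- \<Phi> z - f L * Ln (z - L)) - (- \<Phi> (cnj z) - f L * Ln (cnj z - L))"
      by (simp add: ln1 ln2 algebra_simps)
    then show ?thesis using arc by (simp add: R_def z_def)
  qed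
  have "((\<lambda>X. F X - F (- X) - 2 * complex_of_real pi * \<i> * f L) \<longlongrightarrow> 0) at_top"
  proof (rule Lim_null_comparison)
    have "\<forall>\<^sub>F X in at_top. 2 * l \<le> cmod (P X)"
      using inf by (simp add: filterlim_at_top)
    then show "\<forall>\<^sub>F X in at_top. norm (F X - F (- X) - 2 * complex_of_real pi * \<i> * f L) \<le> 2 * pi * cmod (P X) powr (- \<beta>)"
      using eventually_gt_at_top[of 0] by eventually_elim (use key in auto)
    have "((\<lambda>X. cmod (P X) powr (- \<beta>)) \<longlongrightarrow> 0) at_top"
      using \<beta> by (intro tendsto_neg_powr inf) auto
    then show "((\<lambda>X. 2 * pi * cmod (P X) powr (- \<beta>)) \<longlongrightarrow> 0) at_top"
      by (rule tendsto_mult_right_zero)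
  qed
  then show ?thesis
    by (subst (asm) Lim_null[symmetric]) (simp add: f_def L_def)
qed

section \<open>Moduli of the complex hyperbolic functions\<close>

lemma Re_sinh: "Re (sinh z) = sinh (Re z) * cos (Im z)"
  and Im_sinh: "Im (sinh z) = cosh (Re z) * sin (Im z)"
  and Re_cosh: "Re (cosh z) = cosh (Re z) * cos (Im z)"
  and Im_cosh: "Im (cosh z) = sinh (Re z) * sin (Im z)"
  by (auto simp: sinh_field_def cosh_field_def Re_exp Im_exp field_simps)

lemma sinh_of_real_complex: "sinh (complex_of_real x) = complex_of_real (sinh x)"
  by (simp add: complex_eq_iff Re_sinh Im_sinh)

lemma cosh_of_real_complex: "cosh (complex_of_real x) = complex_of_real (cosh x)"
  by (simp add: complex_eq_iff Re_cosh Im_cosh)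

lemma cmod_sinh: "(cmod (sinh z))\<^sup>2 = (sinh (Re z))\<^sup>2 + (sin (Im z))\<^sup>2"
proof -
  have "(cmod (sinh z))\<^sup>2 = (sinh (Re z))\<^sup>2 * (cos (Im z))\<^sup>2 + (1 + (sinh (Re z))\<^sup>2) * (sin (Im z))\<^sup>2"
    by (simp add: cmod_power2 Re_sinh Im_sinh power_mult_distrib cosh_square_eq add.commute)
  also have "\<dots> = (sinh (Re z))\<^sup>2 * ((cos (Im z))\<^sup>2 + (sin (Im z))\<^sup>2) + (sin (Im z))\<^sup>2"
    by (simp only: distrib_left distrib_right)
  finally show ?thesis by simp
qed

lemma cmod_cosh: "(cmod (cosh z))\<^sup>2 = (sinh (Re z))\<^sup>2 + (cos (Im z))\<^sup>2"
proof -
  have "(cmod (cosh z))\<^sup>2 = (1 + (sinh (Re z))\<^sup>2) * (cos (Im z))\<^sup>2 + (sinh (Re z))\<^sup>2 * (sin (Im z))\<^sup>2"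
    by (simp add: cmod_power2 Re_cosh Im_cosh power_mult_distrib cosh_square_eq add.commute)
  also have "\<dots> = (sinh (Re z))\<^sup>2 * ((cos (Im z))\<^sup>2 + (sin (Im z))\<^sup>2) + (cos (Im z))\<^sup>2"
    by (simp only: distrib_left distrib_right)
  finally show ?thesis by simp
qed

lemma cmod_cosh_le: "cmod (cosh z) \<le> cosh (Re z)"
proof (rule power2_le_imp_le)
  show "(cmod (cosh z))\<^sup>2 \<le> (cosh (Re z))\<^sup>2"
    using cmod_cosh[of z] cosh_square_eq[of "Re z"] sin_cos_squared_add[of "Im z"] zero_le_power2[of "sin (Im z)"]
    by linarith
qed simp

lemma cmod_sinh_le: "cmod (sinh z) \<le> cosh (Re z)"
proof (rule power2_le_imp_le)
  show "(cmod (sinh z))\<^sup>2 \<le> (cosh (Re z))\<^sup>2"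
    using cmod_sinh[of z] cosh_square_eq[of "Re z"] sin_cos_squared_add[of "Im z"] zero_le_power2[of "cos (Im z)"]
    by linarith
qed simp

lemma cmod_sinh_ge: "\<bar>sinh (Re z)\<bar> \<le> cmod (sinh z)"
proof (rule power2_le_imp_le)
  show "\<bar>sinh (Re z)\<bar>\<^sup>2 \<le> (cmod (sinh z))\<^sup>2"
    unfolding cmod_sinh by simp
qed simp

section \<open>The double exponential contour\<close>

lemma cos_ge_quadratic: "1 - x\<^sup>2 / 2 \<le> cos (x :: real)"
proof -
  have "(sin (x / 2))\<^sup>2 \<le> (x / 2)\<^sup>2"
    using abs_sin_x_le_abs_x[of "x / 2"] abs_le_square_iff by blast
  moreover have "cos x = 1 - 2 * (sin (x / 2))\<^sup>2"
    using cos_double_sin[of "x / 2"] by simp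
  ultimately show ?thesis by (simp add: power2_eq_square)
qed

lemma cosh_real_le_1_plus_sinh: "cosh (x :: real) \<le> 1 + \<bar>sinh x\<bar>"
proof (rule power2_le_imp_le)
  show "(cosh x)\<^sup>2 \<le> (1 + \<bar>sinh x\<bar>)\<^sup>2"
    by (simp add: cosh_square_eq power2_sum)
qed simp

lemma cosh_real_le_exp_abs: "cosh (x :: real) \<le> exp \<bar>x\<bar>"
proof -
  define p q where "p = exp \<bar>x\<bar>" and "q = exp (- \<bar>x\<bar>)"
  have "q \<le> p" by (simp add: p_def q_def)
  moreover have "cosh x = (p + q) / 2"
    unfolding p_def q_def by (metis cosh_real_abs cosh_field_def)
  ultimately show ?thesis unfolding p_def[symmetric] by simp
qed

lemma abs_sinh_mono: "\<bar>x\<bar> \<le> \<bar>y\<bar> \<Longrightarrow> \<bar>sinh x\<bar> \<le> \<bar>sinh (y :: real)\<bar>"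
  by (simp flip: sinh_real_abs)

lemma cosh_mono: "\<bar>x\<bar> \<le> \<bar>y\<bar> \<Longrightarrow> cosh x \<le> cosh (y :: real)"
  using cosh_real_nonneg_le_iff[of "\<bar>x\<bar>" "\<bar>y\<bar>"] by simp

locale de_contour =
  fixes \<sigma> \<theta> \<kappa> l0 :: real
  assumes \<sigma>: "\<sigma> \<in> {1/2, 1}" and \<theta>: "1 \<le> \<theta>" and \<kappa>: "0 < \<kappa>" and \<kappa>_less: "\<kappa> < l0"
begin

text \<open>A quarter of the distance from 1 = \<open>P 0\<close>, where the contour in units of
  \<kappa> crosses the real axis, to the scaled spectral bound; the quarters are spent in
  \<open>P_gap\<close>.\<close>

definition gap :: real where "gap = (l0 / \<kappa> - 1) / 4"

text \<open>Half the height of the admissible strip in the variable s. Dividing by \<theta>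
  compensates for the factor \<theta> in front of sinh, so that \<theta> \<open>eps\<close> is at
  most 1/20 and at most \<open>gap\<close>.\<close>

definition eps :: real where "eps = min (1/20) gap / \<theta>"

text \<open>The contour without the scaling by \<kappa> and before the substitution s = (pi/2) sinh
  y. Lower bounds are proved in s and transported to y afterwards.\<close>

definition P :: "complex \<Rightarrow> complex" where
  "P s = cosh (of_real \<sigma> * s) + \<i> * of_real \<theta> * sinh s"

definition P' :: "complex \<Rightarrow> complex" where
  "P' s = of_real \<sigma> * sinh (of_real \<sigma> * s) + \<i> * of_real \<theta> * cosh s"

text \<open>The point at which \<open>P\<close> is evaluated, not the argument of a complex
  number.\<close>

definition arg :: "complex \<Rightarrow> complex" where
  "arg y = of_real (pi / 2) * sinh y"

definition Psi :: "complex \<Rightarrow> complex" where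
  "Psi y = of_real \<kappa> * P (arg y)"

definition Psi' :: "complex \<Rightarrow> complex" where
  "Psi' y = of_real \<kappa> * (P' (arg y) * (of_real (pi / 2) * cosh y))"

lemma \<sigma>_bounds: "0 < \<sigma>" "\<sigma> \<le> 1" using \<sigma> by auto

lemma gap_pos: "0 < gap" using \<kappa> \<kappa>_less by (simp add: gap_def)

lemma eps: "0 < eps" "\<theta> * eps \<le> 1/20" "\<theta> * eps \<le> gap" "eps \<le> 1/20"
proof -
  show pos: "0 < eps" using gap_pos \<theta> by (simp add: eps_def)
  have eq: "\<theta> * eps = min (1/20) gap" using \<theta> by (simp add: eps_def)
  then show "\<theta> * eps \<le> 1/20" "\<theta> * eps \<le> gap" by auto
  have "1 * eps \<le> \<theta> * eps" using \<theta> pos by (intro mult_right_mono) auto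
  then show "eps \<le> 1/20" using eq by simp
qed

lemma Re_P: "Re (P s) = cosh (\<sigma> * Re s) * cos (\<sigma> * Im s) - \<theta> * (cosh (Re s) * sin (Im s))"
  and Im_P: "Im (P s) = sinh (\<sigma> * Re s) * sin (\<sigma> * Im s) + \<theta> * (sinh (Re s) * cos (Im s))"
  by (simp_all add: P_def Re_cosh Im_cosh Re_sinh Im_sinh)

lemma \<sigma>_mult_le: "\<bar>\<sigma> * x\<bar> \<le> \<bar>x\<bar>"
  using \<sigma>_bounds by (simp add: abs_mult mult_left_le_one_le)

text \<open>Im s must be small only where |Re s| is at most 2; there Re (P s) is at least 1/2.
  Beyond that the growing exponential wins for every Im s, and this is why \<open>Psi\<close> has no
  zeros in a strip of fixed height although Im s is unbounded on it.\<close>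

lemma P_growth:
  assumes "\<bar>Re s\<bar> \<le> 2 \<Longrightarrow> \<bar>Im s\<bar> \<le> eps"
  shows "exp \<bar>Re s\<bar> / 100 \<le> cmod (P s)"
proof (cases "\<bar>Re s\<bar> \<le> 2")
  case True
  then have b: "\<bar>Im s\<bar> \<le> eps" using assms by simp
  have "exp (2 :: real) = exp 1 * exp 1" by (simp flip: exp_add)
  also have "\<dots> \<le> 3 * 3" by (intro mult_mono) (use exp_le in auto)
  finally have e2: "exp (2 :: real) \<le> 9" by simp
  have "cosh (Re s) \<le> exp \<bar>Re s\<bar>" by (rule cosh_real_le_exp_abs)
  also have "\<dots> \<le> exp 2" using True by simp
  finally have ch: "cosh (Re s) \<le> 9" using e2 by simp
  have "(\<sigma> * Im s)\<^sup>2 \<le> (1/20)\<^sup>2"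
    using \<sigma>_mult_le[of "Im s"] b eps by (intro abs_le_square_iff[THEN iffD1]) auto
  then have c: "cos (\<sigma> * Im s) \<ge> 99 / 100"
    using cos_ge_quadratic[of "\<sigma> * Im s"] by (simp add: power2_eq_square)
  have "1 * (99 / 100) \<le> cosh (\<sigma> * Re s) * cos (\<sigma> * Im s)"
    using c cosh_real_ge_1 by (intro mult_mono) auto
  moreover have "\<theta> * (cosh (Re s) * sin (Im s)) \<le> \<theta> * (9 * eps)"
  proof (intro mult_left_mono)
    have "cosh (Re s) * sin (Im s) \<le> cosh (Re s) * eps"
      using b abs_sin_x_le_abs_x[of "Im s"] by (intro mult_left_mono) auto
    also have "\<dots> \<le> 9 * eps" using ch eps by (intro mult_right_mono) auto
    finally show "cosh (Re s) * sin (Im s) \<le> 9 * eps" .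
  qed (use \<theta> in auto)
  moreover have "\<theta> * (9 * eps) \<le> 9/20" using eps by simp
  ultimately have "1/2 \<le> Re (P s)" unfolding Re_P by simp
  moreover have "exp \<bar>Re s\<bar> \<le> exp 2" using True by simp
  ultimately show ?thesis
    using e2 complex_Re_le_cmod[of "P s"] by linarith
next
  case False
  define a where "a = \<bar>Re s\<bar>"
  \<comment> \<open>In terms of t the comparison of sinh a - cosh (a/2) with exp a / 100 is a
    quadratic inequality, which holds from t = 5/2 on.\<close>
  define t where "t = exp (a / 2)"
  have a2: "2 < a" using False by (simp add: a_def)
  have "1 + a / 2 + (a / 2)\<^sup>2 / 2 \<le> t"
    unfolding t_def using a2 by (intro exp_lower_Taylor_quadratic) auto
  moreover have "1 \<le> (a / 2)\<^sup>2" using a2 by (intro one_le_power) auto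
  ultimately have t: "5/2 \<le> t" using a2 by linarith
  have tt: "exp a = t * t" by (simp add: t_def flip: exp_add)
  define q where "q = exp (- a)"
  have et: "q \<le> 1" "exp (- (a / 2)) \<le> 1" using a2 by (auto simp: q_def)
  have sh: "sinh a = t * t / 2 - q / 2" by (simp add: sinh_field_def tt q_def diff_divide_distrib)
  have ch: "cosh (a / 2) \<le> t / 2 + 1 / 2" using et by (simp add: cosh_field_def t_def add_divide_distrib)
  have "5/2 * t \<le> t * t" using t by (intro mult_right_mono) auto
  then have low: "exp \<bar>Re s\<bar> / 100 \<le> sinh a - cosh (a / 2)"
    unfolding a_def[symmetric] tt sh using ch et t by linarith
  have chpos: "0 < cosh (a / 2)" by simp
  have "sinh a - cosh (a / 2) \<le> cmod (P s)"
  proof (cases "\<sigma> = 1")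
    case True
    have r: "1 \<le> cmod (1 + \<i> * of_real \<theta>)"
      using complex_Re_le_cmod[of "1 + \<i> * of_real \<theta>"] by simp
    have r': "cmod (1 - \<i> * of_real \<theta>) = cmod (1 + \<i> * of_real \<theta>)"
      by (simp add: cmod_def)
    \<comment> \<open>The coefficients 1 + i\<theta> and 1 - i\<theta> have equal modulus, at least
      1, so the moduli of the two exponential terms differ by at least |sinh (Re s)|.\<close>
    let ?A = "(1 + \<i> * of_real \<theta>) * exp s / 2" and ?B = "(1 - \<i> * of_real \<theta>) * exp (- s) / 2"
    have "P s = cosh s + \<i> * of_real \<theta> * sinh s"
      unfolding P_def using True by simp
    then have PAB: "P s = ?A - (- ?B)" "P s = ?B - (- ?A)"
      by (simp_all add: cosh_field_def sinh_field_def field_simps)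
    have "cmod ?A - cmod ?B \<le> cmod (P s)" "cmod ?B - cmod ?A \<le> cmod (P s)"
      using norm_triangle_ineq2[of ?A "- ?B"] norm_triangle_ineq2[of ?B "- ?A"]
      by (simp_all only: PAB(1)[symmetric] PAB(2)[symmetric] norm_minus_cancel)
    moreover have "cmod ?A = cmod (1 + \<i> * of_real \<theta>) * (exp (Re s) / 2)"
      "cmod ?B = cmod (1 + \<i> * of_real \<theta>) * (exp (- Re s) / 2)"
      by (simp_all add: norm_mult r')
    ultimately have "cmod (1 + \<i> * of_real \<theta>) * \<bar>sinh (Re s)\<bar> \<le> cmod (P s)"
      by (simp add: sinh_field_def abs_if right_diff_distrib' field_simps)
    moreover have "1 * \<bar>sinh (Re s)\<bar> \<le> cmod (1 + \<i> * of_real \<theta>) * \<bar>sinh (Re s)\<bar>"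
      using r by (intro mult_right_mono) auto
    ultimately have "sinh a \<le> cmod (P s)" by (simp add: a_def)
    then show ?thesis using chpos by linarith
  next
    case False
    then have s2: "\<sigma> = 1/2" using \<sigma> by simp
    have "sinh a \<le> cmod (sinh s)" using cmod_sinh_ge[of s] by (simp add: a_def)
    also have "\<dots> \<le> \<theta> * cmod (sinh s)" using \<theta> mult_right_mono[of 1 \<theta> "cmod (sinh s)"] by simp
    also have "\<dots> = cmod (\<i> * of_real \<theta> * sinh s)" using \<theta> by (simp add: norm_mult)
    finally have 1: "sinh a \<le> cmod (\<i> * of_real \<theta> * sinh s)" .
    have "cmod (cosh (of_real \<sigma> * s)) \<le> cosh (\<sigma> * Re s)"
      using cmod_cosh_le[of "of_real \<sigma> * s"] by simp
    also have "\<dots> = cosh (a / 2)"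
      using cosh_real_abs[of "Re s / 2"] by (simp add: s2 a_def)
    finally have 2: "cmod (cosh (of_real \<sigma> * s)) \<le> cosh (a / 2)" .
    show ?thesis
      using norm_triangle_ineq2[of "\<i> * of_real \<theta> * sinh s" "- cosh (of_real \<sigma> * s)"] 1 2
      by (simp add: P_def add.commute)
  qed
  with low show ?thesis by simp
qed

lemma P'_bound: "cmod (P' s) \<le> (1 + \<theta>) * exp \<bar>Re s\<bar>"
proof -
  have "cmod (P' s) \<le> cmod (of_real \<sigma> * sinh (of_real \<sigma> * s)) + cmod (\<i> * of_real \<theta> * cosh s)"
    unfolding P'_def by (rule norm_triangle_ineq)
  also have "cmod (of_real \<sigma> * sinh (of_real \<sigma> * s)) \<le> 1 * cosh (\<sigma> * Re s)"
    unfolding norm_mult using \<sigma>_bounds cmod_sinh_le[of "of_real \<sigma> * s"] by (intro mult_mono) auto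
  also have "cosh (\<sigma> * Re s) \<le> cosh (Re s)" by (intro cosh_mono \<sigma>_mult_le)
  also have "cmod (\<i> * of_real \<theta> * cosh s) \<le> \<theta> * cosh (Re s)"
    unfolding norm_mult using \<theta> cmod_cosh_le[of s] by simp
  also have "1 * cosh (Re s) + \<theta> * cosh (Re s) = (1 + \<theta>) * cosh (Re s)" by (simp add: distrib_right)
  also have "\<dots> \<le> (1 + \<theta>) * exp \<bar>Re s\<bar>" using \<theta> by (intro mult_left_mono cosh_real_le_exp_abs) auto
  finally show ?thesis by simp
qed

text \<open>With t = |sinh (Re s)|, the imaginary part of \<open>P s\<close> is at least t/2 in
  modulus, its real part is at most 1 + gap + 2t, and m is at least 1 + 4 gap. The distance is
  therefore at least t/2 and at least 3 gap - 2t; the first bound suffices for t >= gap, the second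
  for t < gap.\<close>

lemma P_gap:
  assumes b: "\<bar>Im s\<bar> \<le> eps" and m: "l0 / \<kappa> \<le> m"
  shows "gap / 2 \<le> cmod (of_real m - P s)"
proof -
  define t where "t = \<bar>sinh (Re s)\<bar>"
  have t0: "0 \<le> t" by (simp add: t_def)
  have sm: "\<bar>sinh (\<sigma> * Re s)\<bar> \<le> t" unfolding t_def by (intro abs_sinh_mono \<sigma>_mult_le)
  have "(Im s)\<^sup>2 \<le> (1/20)\<^sup>2" using b eps by (intro abs_le_square_iff[THEN iffD1]) auto
  then have c: "cos (Im s) \<ge> 9 / 10"
    using cos_ge_quadratic[of "Im s"] by (simp add: power2_eq_square)
  have "\<bar>sinh (\<sigma> * Re s) * sin (\<sigma> * Im s)\<bar> \<le> t * (1/20)"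
    unfolding abs_mult using sm t0 abs_sin_x_le_abs_x[of "\<sigma> * Im s"] \<sigma>_mult_le[of "Im s"] b eps
    by (intro mult_mono) auto
  moreover have "1 * (t * (9/10)) \<le> \<theta> * (t * cos (Im s))"
    using c t0 \<theta> by (intro mult_mono) auto
  moreover have "\<bar>\<theta> * (sinh (Re s) * cos (Im s))\<bar> = \<theta> * (t * cos (Im s))"
    using c \<theta> by (simp add: abs_mult t_def)
  ultimately have "t / 2 \<le> \<bar>Im (P s)\<bar>" unfolding Im_P using t0 by linarith
  then have 1: "t / 2 \<le> cmod (of_real m - P s)"
    using abs_Im_le_cmod[of "of_real m - P s"] by simp
  have "cosh (\<sigma> * Re s) * cos (\<sigma> * Im s) \<le> cosh (\<sigma> * Re s) * 1"
    by (intro mult_left_mono) auto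
  also have "\<dots> \<le> 1 + t" using cosh_real_le_1_plus_sinh[of "\<sigma> * Re s"] sm by simp
  finally have "cosh (\<sigma> * Re s) * cos (\<sigma> * Im s) \<le> 1 + t" .
  moreover have "- (\<theta> * (cosh (Re s) * sin (Im s))) \<le> (1 + t) * (\<theta> * eps)"
  proof -
    have "- (\<theta> * (cosh (Re s) * sin (Im s))) = \<theta> * (cosh (Re s) * (- sin (Im s)))" by simp
    also have "\<dots> \<le> \<theta> * ((1 + t) * eps)"
      using \<theta> b abs_sin_x_le_abs_x[of "Im s"] cosh_real_le_1_plus_sinh[of "Re s"] t0 eps
      by (intro mult_left_mono order_trans[OF mult_left_mono mult_right_mono[of _ _ eps]]) (auto simp: t_def)
    finally show ?thesis by (simp add: algebra_simps)
  qed
  moreover have "(1 + t) * (\<theta> * eps) = \<theta> * eps + t * (\<theta> * eps)" by (simp add: distrib_right)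
  moreover have "t * (\<theta> * eps) \<le> t * 1" using t0 eps by (intro mult_left_mono) auto
  ultimately have "Re (P s) \<le> 1 + gap + 2 * t" unfolding Re_P using eps(3) by linarith
  moreover have "1 + 4 * gap \<le> m" using m by (simp add: gap_def diff_divide_distrib)
  ultimately have 2: "3 * gap - 2 * t \<le> cmod (of_real m - P s)"
    using complex_Re_le_cmod[of "of_real m - P s"] by simp
  show ?thesis using 1 2 gap_pos by linarith
qed

section \<open>The strip in the variable y: growth of the contour map, width and kernel
  bounds\<close>

lemma Re_arg: "Re (arg y) = pi / 2 * (sinh (Re y) * cos (Im y))"
  and Im_arg: "Im (arg y) = pi / 2 * (cosh (Re y) * sin (Im y))"
  by (simp_all add: arg_def Re_sinh Im_sinh)

lemma arg_bounds:
  assumes y: "\<bar>Im y\<bar> \<le> 1/20"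
  shows "\<bar>sinh (Re y)\<bar> \<le> 2 * \<bar>Re (arg y)\<bar>" "\<bar>Im (arg y)\<bar> \<le> 2 * (cosh (Re y) * \<bar>Im y\<bar>)"
proof -
  have "(Im y)\<^sup>2 \<le> (1/20)\<^sup>2" using y by (intro abs_le_square_iff[THEN iffD1]) auto
  then have c: "cos (Im y) \<ge> 1/2"
    using cos_ge_quadratic[of "Im y"] by (simp add: power2_eq_square)
  have "1 * (\<bar>sinh (Re y)\<bar> * (1/2)) \<le> pi / 2 * (\<bar>sinh (Re y)\<bar> * cos (Im y))"
    using c pi_ge_two by (intro mult_mono) auto
  also have "\<dots> = \<bar>Re (arg y)\<bar>" using c by (simp add: Re_arg abs_mult)
  finally show "\<bar>sinh (Re y)\<bar> \<le> 2 * \<bar>Re (arg y)\<bar>" by simp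
  have "\<bar>Im (arg y)\<bar> = pi / 2 * (cosh (Re y) * \<bar>sin (Im y)\<bar>)" by (simp add: Im_arg abs_mult)
  also have "\<dots> \<le> 2 * (cosh (Re y) * \<bar>Im y\<bar>)"
    using pi_less_4 by (intro mult_mono abs_sin_x_le_abs_x) auto
  finally show "\<bar>Im (arg y)\<bar> \<le> 2 * (cosh (Re y) * \<bar>Im y\<bar>)" .
qed

text \<open>Where |Re (arg y)| is at most 2, |sinh (Re y)| is at most 4 and cosh (Re y) at most 5,
  so height \<open>eps / 10\<close> gives |Im (arg y)| at most \<open>eps\<close>. Elsewhere
  \<open>P_growth\<close> asks nothing of the imaginary part.\<close>

lemma Psi_growth:
  assumes y: "\<bar>Im y\<bar> \<le> eps / 10"
  shows "\<kappa> / 100 * exp \<bar>Re (arg y)\<bar> \<le> cmod (Psi y)"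
proof -
  have y': "\<bar>Im y\<bar> \<le> 1/20" using y eps by linarith
  have "exp \<bar>Re (arg y)\<bar> / 100 \<le> cmod (P (arg y))"
  proof (rule P_growth)
    assume "\<bar>Re (arg y)\<bar> \<le> 2"
    then have "cosh (Re y) \<le> 5"
      using arg_bounds(1)[OF y'] cosh_real_le_1_plus_sinh[of "Re y"] by linarith
    then have "cosh (Re y) * \<bar>Im y\<bar> \<le> 5 * (eps / 10)"
      using y by (intro mult_mono) auto
    then show "\<bar>Im (arg y)\<bar> \<le> eps" using arg_bounds(2)[OF y'] by linarith
  qed
  then have "\<kappa> * (exp \<bar>Re (arg y)\<bar> / 100) \<le> \<kappa> * cmod (P (arg y))"
    using \<kappa> by (intro mult_left_mono) auto
  then show ?thesis using \<kappa> by (simp add: Psi_def norm_mult)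
qed

lemma Psi_nonzero: "\<bar>Im y\<bar> \<le> eps / 10 \<Longrightarrow> Psi y \<noteq> 0"
proof
  assume "\<bar>Im y\<bar> \<le> eps / 10" "Psi y = 0"
  with Psi_growth[of y] have "\<kappa> / 100 * exp \<bar>Re (arg y)\<bar> \<le> 0" by simp
  moreover have "0 < \<kappa> / 100 * exp \<bar>Re (arg y)\<bar>" using \<kappa> by simp
  ultimately show False by linarith
qed

text \<open>Chosen so that exp |Re (arg y)| >= C1 l forces |Psi y| >= 2 l.\<close>

definition C1 :: real where "C1 = 200 / \<kappa>"

text \<open>In the region where |Psi y| is not yet known to exceed 2 l, cosh (Re y) is at most 1 + 2
  ln (C1 l). This height keeps |Im (arg y)| below \<open>eps\<close> there.\<close>

definition width :: "real \<Rightarrow> real" where "width l = eps / (10 * (1 + ln (C1 * l)))"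

definition C2 :: real where "C2 = 200 / (\<kappa> * l0) + 2 * C1 / (\<kappa> * gap)"

lemma C1_ge: "l0 \<le> l \<Longrightarrow> 1 \<le> C1 * l"
  using \<kappa> \<kappa>_less by (simp add: C1_def field_simps)

lemma C2_pos: "0 < C2"
  using \<kappa> \<kappa>_less gap_pos by (simp add: C2_def C1_def add_pos_pos)

lemma width:
  assumes "l0 \<le> l"
  shows "0 < width l" "width l \<le> eps / 10"
proof -
  have "0 \<le> ln (C1 * l)" using C1_ge[OF assms] by simp
  then show "0 < width l" "width l \<le> eps / 10"
    using eps by (auto simp: width_def divide_simps)
qed

text \<open>If exp |Re (arg y)| >= C1 l, then |Psi y| is at least twice l and dominates it
  regardless of its direction. Otherwise the width keeps \<open>arg y\<close> in the thin strip of
  \<open>P_gap\<close>, and the exponential is below C1 l; this second case is where the factor l in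
  the error originates. The exponential in the numerator is kept to absorb the growth of Psi'.
  \<open>C2\<close> is the sum of the constants of the two cases.\<close>

lemma resolvent_bound:
  assumes l: "l0 \<le> l" and y: "\<bar>Im y\<bar> \<le> width l"
  shows "of_real l \<noteq> Psi y" "exp \<bar>Re (arg y)\<bar> / cmod (of_real l - Psi y) \<le> C2 * l"
proof -
  define a where "a = \<bar>Re (arg y)\<bar>"
  have lpos: "0 < l" using l \<kappa> \<kappa>_less by simp
  have y1: "\<bar>Im y\<bar> \<le> eps / 10" using y width[OF l] by simp
  then have y2: "\<bar>Im y\<bar> \<le> 1/20" using eps by simp
  have "0 < cmod (of_real l - Psi y) \<and> exp a / cmod (of_real l - Psi y) \<le> C2 * l"
  proof (cases "C1 * l \<le> exp a")
    case True
    have g: "\<kappa> / 100 * exp a \<le> cmod (Psi y)" using Psi_growth[OF y1] by (simp add: a_def)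
    have "2 * l = \<kappa> / 100 * (C1 * l)" using \<kappa> by (simp add: C1_def)
    also have "\<dots> \<le> \<kappa> / 100 * exp a" using True \<kappa> by (intro mult_left_mono) auto
    finally have "l \<le> \<kappa> / 200 * exp a" by simp
    then have low: "\<kappa> / 200 * exp a \<le> cmod (of_real l - Psi y)"
      using norm_triangle_ineq2[of "Psi y" "of_real l"] g lpos by (simp add: norm_minus_commute)
    have pos: "0 < \<kappa> / 200 * exp a" using \<kappa> by simp
    have "exp a / cmod (of_real l - Psi y) \<le> exp a / (\<kappa> / 200 * exp a)"
      using low pos by (intro frac_le) auto
    also have "\<dots> = 200 / (\<kappa> * l0) * l0" using \<kappa> \<kappa>_less by simp
    also have "\<dots> \<le> 200 / (\<kappa> * l0) * l" using \<kappa> \<kappa>_less l by (intro mult_left_mono) auto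
    also have "\<dots> \<le> C2 * l" unfolding C2_def using \<kappa> \<kappa>_less gap_pos lpos
      by (intro mult_right_mono) (auto simp: C1_def)
    finally show ?thesis using low pos by linarith
  next
    case False
    define L where "L = ln (C1 * l)"
    have L0: "0 \<le> L" using C1_ge[OF l] by (simp add: L_def)
    have "exp a < exp L" using False C1_ge[OF l] by (simp add: L_def)
    then have "a < L" by simp
    then have "cosh (Re y) \<le> 1 + 2 * L"
      using arg_bounds(1)[OF y2] cosh_real_le_1_plus_sinh[of "Re y"] by (simp add: a_def)
    then have "cosh (Re y) * \<bar>Im y\<bar> \<le> (1 + 2 * L) * (eps / (10 * (1 + L)))"
      using y L0 by (intro mult_mono) (auto simp: width_def L_def)
    also have "\<dots> \<le> (2 * (1 + L)) * (eps / (10 * (1 + L)))"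
      using L0 eps by (intro mult_right_mono) auto
    also have "\<dots> = eps / 5" using L0 by (simp add: field_simps)
    finally have "\<bar>Im (arg y)\<bar> \<le> eps" using arg_bounds(2)[OF y2] eps by linarith
    moreover have "l0 / \<kappa> \<le> l / \<kappa>" using l \<kappa> by (simp add: divide_right_mono)
    ultimately have "gap / 2 \<le> cmod (of_real (l / \<kappa>) - P (arg y))" by (rule P_gap)
    then have "\<kappa> * (gap / 2) \<le> \<kappa> * cmod (of_real (l / \<kappa>) - P (arg y))"
      using \<kappa> by (intro mult_left_mono) auto
    also have "\<dots> = cmod (of_real \<kappa> * (of_real (l / \<kappa>) - P (arg y)))"
      using \<kappa> by (simp add: norm_mult)
    also have "of_real \<kappa> * (of_real (l / \<kappa>) - P (arg y)) = of_real l - Psi y"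
      using \<kappa> by (simp add: Psi_def right_diff_distrib)
    finally have low: "\<kappa> * gap / 2 \<le> cmod (of_real l - Psi y)" by simp
    have pos: "0 < \<kappa> * gap / 2" using \<kappa> gap_pos by simp
    have "exp a / cmod (of_real l - Psi y) \<le> (C1 * l) / (\<kappa> * gap / 2)"
      using False low pos C1_ge[OF l] by (intro frac_le) auto
    also have "\<dots> = (2 * C1 / (\<kappa> * gap)) * l" by simp
    also have "\<dots> \<le> C2 * l" unfolding C2_def using \<kappa> \<kappa>_less gap_pos lpos
      by (intro mult_right_mono) auto
    finally show ?thesis using low pos by linarith
  qed
  then show "of_real l \<noteq> Psi y" "exp \<bar>Re (arg y)\<bar> / cmod (of_real l - Psi y) \<le> C2 * l"
    by (auto simp: a_def)
qed

definition C3 :: real where "C3 = 2 * \<kappa> * (1 + \<theta>) * C2"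

lemma C3_pos: "0 < C3"
  using C2_pos \<kappa> \<theta> by (simp add: C3_def)

lemma kernel_bound:
  assumes l: "l0 \<le> l" and y: "\<bar>Im y\<bar> \<le> width l"
  shows "cmod (Psi' y / (of_real l - Psi y)) \<le> C3 * l * cosh (Re y)"
proof -
  have lpos: "0 < l" using l \<kappa> \<kappa>_less by simp
  have "cmod (Psi' y) = \<kappa> * (cmod (P' (arg y)) * (pi / 2 * cmod (cosh y)))"
    using \<kappa> by (simp add: Psi'_def norm_mult)
  also have "\<dots> \<le> \<kappa> * (((1 + \<theta>) * exp \<bar>Re (arg y)\<bar>) * (2 * cosh (Re y)))"
    using \<kappa> \<theta> pi_less_4 by (intro mult_left_mono mult_mono P'_bound cmod_cosh_le) auto
  finally have "cmod (Psi' y) \<le> 2 * \<kappa> * (1 + \<theta>) * cosh (Re y) * exp \<bar>Re (arg y)\<bar>"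
    by (simp add: algebra_simps)
  then have "cmod (Psi' y / (of_real l - Psi y))
      \<le> (2 * \<kappa> * (1 + \<theta>) * cosh (Re y) * exp \<bar>Re (arg y)\<bar>) / cmod (of_real l - Psi y)"
    unfolding norm_divide by (intro divide_right_mono) auto
  also have "\<dots> = 2 * \<kappa> * (1 + \<theta>) * cosh (Re y) * (exp \<bar>Re (arg y)\<bar> / cmod (of_real l - Psi y))"
    by simp
  also have "\<dots> \<le> 2 * \<kappa> * (1 + \<theta>) * cosh (Re y) * (C2 * l)"
    using \<kappa> \<theta> by (intro mult_left_mono resolvent_bound[OF assms]) auto
  also have "\<dots> = C3 * l * cosh (Re y)" by (simp add: C3_def)
  finally show ?thesis .
qed

section \<open>The contour map on the real line and its derivative\<close>

lemma Psi_of_real: "Psi (of_real x) = psi \<sigma> \<theta> \<kappa> x"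
proof -
  have a: "arg (of_real x) = of_real (pi / 2 * sinh x)"
    by (simp add: arg_def sinh_of_real_complex)
  have b: "of_real \<sigma> * of_real (pi / 2 * sinh x) = complex_of_real (\<sigma> * pi / 2 * sinh x)"
    by simp
  show ?thesis
    unfolding Psi_def P_def a b psi_def sinh_of_real_complex cosh_of_real_complex by simp
qed

lemma Psi_deriv: "(Psi has_field_derivative Psi' y) (at y within S)"
proof -
  have "(arg has_field_derivative of_real (pi / 2) * cosh y) (at y within S)"
    unfolding arg_def[abs_def] by (auto intro!: derivative_eq_intros)
  note arg' = this
  have "(P has_field_derivative P' s) (at s)" for s
    unfolding P_def[abs_def] P'_def by (auto intro!: derivative_eq_intros simp: mult_ac)
  from DERIV_chain2[OF this arg'] show ?thesis
    unfolding Psi_def[abs_def] Psi'_def by (rule DERIV_cmult)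
qed

lemma psi_deriv: "(psi \<sigma> \<theta> \<kappa> has_vector_derivative Psi' (of_real x)) (at x)"
  using has_vector_derivative_real_field[OF Psi_deriv[of "of_real x" UNIV]] by (simp add: Psi_of_real)

lemma Re_psi: "Re (psi \<sigma> \<theta> \<kappa> x) = \<kappa> * cosh (\<sigma> * pi / 2 * sinh x)"
  and Im_psi: "Im (psi \<sigma> \<theta> \<kappa> x) = \<kappa> * (\<theta> * sinh (pi / 2 * sinh x))"
  by (simp_all add: psi_def)

end

section \<open>The scalar quadrature error\<close>

lemma sum_symmetric_Suc:
  fixes f :: "int \<Rightarrow> 'a :: ab_group_add"
  shows "(\<Sum>j = - int (Suc M)..int (Suc M). f j) = (\<Sum>j = - int M..int M. f j) + f (int (Suc M)) + f (- int (Suc M))"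
proof -
  have "{- int (Suc M)..int (Suc M)} = insert (- int (Suc M)) (insert (int (Suc M)) {- int M..int M})"
    by auto
  then show ?thesis by (simp add: algebra_simps)
qed

lemma exp_decay_bounds:
  fixes b s :: real
  assumes "0 < b" "0 \<le> s"
  shows "s\<^sup>2 * exp (- (b * s)) \<le> 2 / b\<^sup>2"
proof -
  have "1 + b * s + (b * s)\<^sup>2 / 2 \<le> exp (b * s)"
    using assms by (intro exp_lower_Taylor_quadratic) auto
  moreover have "0 \<le> b * s" using assms by simp
  ultimately have "(b * s)\<^sup>2 / 2 \<le> exp (b * s)" by linarith
  then show ?thesis using assms by (simp add: exp_minus field_simps power_mult_distrib)
qed

lemma cosh_decay:
  fixes b x :: real
  assumes "0 < b"
  shows "cosh x * exp (- (b * \<bar>sinh x\<bar>)) \<le> (1 + 2 / b\<^sup>2) / cosh x"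
proof -
  have "(cosh x)\<^sup>2 * exp (- (b * \<bar>sinh x\<bar>)) = exp (- (b * \<bar>sinh x\<bar>)) + \<bar>sinh x\<bar>\<^sup>2 * exp (- (b * \<bar>sinh x\<bar>))"
    by (simp add: cosh_square_eq distrib_right)
  also have "\<dots> \<le> 1 + 2 / b\<^sup>2"
    using assms by (intro add_mono exp_decay_bounds) auto
  finally show ?thesis by (simp add: power2_eq_square field_simps)
qed

text \<open>Half of the double exponential decay is spent to absorb exp (2x). What is left besides
  the rate b/4 is a factor exp (-x), which makes sums over nodes bounded independently of the step
  size.\<close>

lemma cosh_double_exp_decay:
  fixes b x :: real
  assumes "0 < b" "0 \<le> x"
  shows "cosh x * exp (- (b * \<bar>sinh x\<bar>)) \<le> exp (b / 2) * (32 / b\<^sup>2) * (exp (- x) * exp (- (b / 4 * exp x)))"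
proof -
  define t where "t = exp x"
  have t: "1 \<le> t" using assms by (simp add: t_def)
  define q where "q = exp (- x)"
  have q: "q \<le> 1" "q * t = 1" using assms by (auto simp: q_def t_def simp flip: exp_add)
  have "cosh x \<le> t" using cosh_real_le_exp_abs[of x] assms by (simp add: t_def)
  moreover have "t / 2 - 1 / 2 \<le> \<bar>sinh x\<bar>" using q assms by (simp add: sinh_field_def t_def q_def)
  then have "b * (t / 2 - 1 / 2) \<le> b * \<bar>sinh x\<bar>" using assms by (intro mult_left_mono) auto
  then have "exp (- (b * \<bar>sinh x\<bar>)) \<le> exp (b / 2 - b / 4 * t - b / 4 * t)" by (simp add: algebra_simps)
  ultimately have "cosh x * exp (- (b * \<bar>sinh x\<bar>)) \<le> t * exp (b / 2 - b / 4 * t - b / 4 * t)"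
    using t by (intro mult_mono) auto
  also have "\<dots> = exp (b / 2) * (t * exp (- (b / 4 * t))) * exp (- (b / 4 * t))"
    by (simp only: diff_conv_add_uminus exp_add mult_ac)
  also have "t * exp (- (b / 4 * t)) = q * (t\<^sup>2 * exp (- (b / 4 * t)))"
    using q(2) by (simp add: power2_eq_square mult.assoc[symmetric])
  also have "exp (b / 2) * (q * (t\<^sup>2 * exp (- (b / 4 * t)))) * exp (- (b / 4 * t))
      \<le> exp (b / 2) * (q * (2 / (b / 4)\<^sup>2)) * exp (- (b / 4 * t))"
    using exp_decay_bounds[of "b / 4" t] assms t by (intro mult_right_mono mult_left_mono) (auto simp: q_def)
  also have "\<dots> = exp (b / 2) * (32 / b\<^sup>2) * (q * exp (- (b / 4 * t)))"
    by (simp add: power2_eq_square)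
  finally show ?thesis by (simp add: t_def q_def)
qed

text \<open>1 + k <= exp k. This compares a Riemann sum of exp (-x) with a telescoping sum, so that
  no factor 1/k enters the truncation error.\<close>

lemma exp_sum_step:
  fixes k :: real
  shows "k * exp (- (real (Suc M) * k)) \<le> exp (- (real M * k)) - exp (- (real (Suc M) * k))"
proof -
  have "(1 + k) * exp (- (real (Suc M) * k)) \<le> exp k * exp (- (real (Suc M) * k))"
    by (intro mult_right_mono exp_ge_add_one_self) auto
  also have "\<dots> = exp (- (real M * k))" by (simp add: algebra_simps flip: exp_add)
  finally show ?thesis by (simp add: algebra_simps)
qed

section \<open>Logarithm of the contour map and the error on a single eigenvalue\<close>

context de_contour
begin

definition scalar_quad :: "real \<Rightarrow> real \<Rightarrow> real \<Rightarrow> nat \<Rightarrow> complex" where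
  "scalar_quad \<beta> l k N = of_real k / (2 * of_real pi * \<i>) *
     (\<Sum>j = - int N..int N. psi \<sigma> \<theta> \<kappa> (real_of_int j * k) powr (- of_real \<beta>) *
        Psi' (of_real (real_of_int j * k)) / (of_real l - psi \<sigma> \<theta> \<kappa> (real_of_int j * k)))"

definition strip :: "real \<Rightarrow> complex set" where
  "strip d = {y. \<bar>Im y\<bar> < d}"

lemma strip: "open (strip d)" "convex (strip d)"
proof -
  have "strip d = {y. Im y < d} \<inter> {y. Im y > - d}" by (auto simp: strip_def)
  then show "open (strip d)" "convex (strip d)"
    by (simp_all add: convex_Int convex_halfspace_Im_lt convex_halfspace_Im_gt open_Int open_halfspace_Im_lt open_halfspace_Im_gt)
qed

lemma Psi_holomorphic: "Psi holomorphic_on S" and Psi'_holomorphic: "Psi' holomorphic_on S"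
proof -
  show "Psi holomorphic_on S"
    using Psi_deriv by (auto simp: holomorphic_on_def field_differentiable_def)
  have "deriv Psi = Psi'"
    using Psi_deriv by (auto simp: fun_eq_iff intro!: DERIV_imp_deriv)
  moreover have "Psi holomorphic_on UNIV"
    using Psi_deriv by (auto simp: holomorphic_on_def field_differentiable_def)
  ultimately have "Psi' holomorphic_on UNIV"
    using holomorphic_deriv[of Psi UNIV] by simp
  then show "Psi' holomorphic_on S" by (rule holomorphic_on_subset) simp
qed

lemma psi_half_plane: "0 < Re (psi \<sigma> \<theta> \<kappa> x)" "psi \<sigma> \<theta> \<kappa> x \<notin> \<real>\<^sub>\<le>\<^sub>0"
  using \<kappa> by (auto simp: Re_psi complex_nonpos_Reals_iff not_le)

text \<open>Inside the strip \<open>Psi\<close> wraps around the origin, so its logarithm is not \<^term>\<open>Ln \<circ> Psi\<close>.\<close>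

lemma contour_log:
  obtains L where "\<And>y. y \<in> strip (eps / 10) \<Longrightarrow> (L has_field_derivative Psi' y / Psi y) (at y)"
    and "\<And>y. y \<in> strip (eps / 10) \<Longrightarrow> exp (L y) = Psi y"
    and "\<And>x. L (of_real x) = Ln (psi \<sigma> \<theta> \<kappa> x)"
proof -
  let ?S = "strip (eps / 10)"
  have nz: "Psi y \<noteq> 0" if "y \<in> ?S" for y using that by (intro Psi_nonzero) (auto simp: strip_def)
  have S0: "of_real x \<in> ?S" for x using eps by (simp add: strip_def)
  have "(\<lambda>y. Psi' y / Psi y) holomorphic_on ?S"
    using nz by (intro holomorphic_intros Psi_holomorphic Psi'_holomorphic) auto
  note hol = this
  obtain G where G0: "\<And>y. y \<in> ?S \<Longrightarrow> (G has_field_derivative Psi' y / Psi y) (at y within ?S)"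
  proof (rule holomorphic_convex_primitive'[OF strip(2,1) hol])
    fix g assume "\<And>y. y \<in> ?S \<Longrightarrow> (g has_field_derivative Psi' y / Psi y) (at y within ?S)"
    then show thesis by (rule that)
  qed
  have G: "(G has_field_derivative Psi' y / Psi y) (at y)" if "y \<in> ?S" for y
    using G0[OF that] by (simp only: at_within_open[OF that strip(1)])
  have "\<exists>c. \<forall>y\<in>?S. Psi y * exp (- G y) = c"
  proof (rule has_field_derivative_zero_constant[OF strip(2)])
    fix y assume y: "y \<in> ?S"
    have "((\<lambda>y. Psi y * exp (- G y)) has_field_derivative
        Psi' y * exp (- G y) + (exp (- G y) * - (Psi' y / Psi y)) * Psi y) (at y within ?S)"
      using DERIV_mult[OF Psi_deriv[of y ?S] DERIV_chain2[OF DERIV_exp DERIV_minus[OF G0[OF y]]]]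
      by (simp add: add.commute)
    then show "((\<lambda>y. Psi y * exp (- G y)) has_field_derivative 0) (at y within ?S)"
      using nz[OF y] by simp
  qed
  then obtain c where c: "\<And>y. y \<in> ?S \<Longrightarrow> Psi y * exp (- G y) = c" by blast
  \<comment> \<open>\<open>G\<close> is fixed only up to a constant; the shift gives
    \<open>L\<close> the principal value at 0, and exp L = Psi follows from the constancy of Psi exp
    (-G).\<close>
  define L where "L y = G y - G 0 + Ln (Psi 0)" for y
  have L': "(L has_field_derivative Psi' y / Psi y) (at y)" if "y \<in> ?S" for y
    unfolding L_def[abs_def] using G[OF that] by (auto intro!: derivative_eq_intros)
  have expL: "exp (L y) = Psi y" if "y \<in> ?S" for y
  proof -
    have 0: "(0 :: complex) \<in> ?S" using S0[of 0] by simp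
    have "Psi y * exp (- G y) = Psi 0 * exp (- G 0)" using c[OF that] c[OF 0] by simp
    then have "Psi y = exp (G y) * (Psi 0 * exp (- G 0))" by (simp add: exp_minus field_simps)
    also have "\<dots> = exp (L y)" using nz[OF 0] by (simp add: L_def exp_add exp_diff exp_minus field_simps)
    finally show ?thesis ..
  qed
  have "L (of_real x) = Ln (psi \<sigma> \<theta> \<kappa> x)" for x
  proof -
    \<comment> \<open>On the real line the contour stays in the right half-plane, where
      \<open>Ln\<close> is holomorphic; the two logarithms have the same derivative there and agree
      at 0.\<close>
    let ?D = "\<lambda>x. L (of_real x) - Ln (psi \<sigma> \<theta> \<kappa> x)"
    have "(?D has_vector_derivative 0) (at x)" for x
    proof -
      have 1: "((\<lambda>x. L (of_real x)) has_vector_derivative Psi' (of_real x) / Psi (of_real x)) (at x)"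
        by (rule has_vector_derivative_real_field[OF L'[OF S0]])
      have "(Ln has_field_derivative inverse (psi \<sigma> \<theta> \<kappa> x)) (at (psi \<sigma> \<theta> \<kappa> x))"
        by (rule has_field_derivative_Ln[OF psi_half_plane(2)])
      from field_vector_diff_chain_at[OF psi_deriv this]
      have 2: "((\<lambda>x. Ln (psi \<sigma> \<theta> \<kappa> x)) has_vector_derivative Psi' (of_real x) * inverse (psi \<sigma> \<theta> \<kappa> x)) (at x)"
        by (simp add: o_def)
      show ?thesis
        using has_vector_derivative_diff[OF 1 2] by (simp add: Psi_of_real divide_inverse)
    qed
    then obtain c where D: "\<And>x. ?D x = c"
      by (rule has_vector_derivative_zero_constant[of UNIV ?D, simplified]) metis
    have "?D x = ?D 0" by (simp only: D)
    also have "?D 0 = 0" using Psi_of_real[of 0] by (simp add: L_def)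
    finally show ?thesis by simp
  qed
  with L' expL show thesis by (rule that)
qed

lemma psi_uminus: "psi \<sigma> \<theta> \<kappa> (- x) = cnj (psi \<sigma> \<theta> \<kappa> x)"
  by (simp add: complex_eq_iff Re_psi Im_psi)

lemma psi_at_top: "filterlim (\<lambda>x. cmod (psi \<sigma> \<theta> \<kappa> x)) at_top at_top"
proof (rule filterlim_at_top_mono)
  have "filterlim (\<lambda>x. (\<kappa> / 100 / 2) * sinh x) at_top at_top"
    using \<kappa> by (intro filterlim_tendsto_pos_mult_at_top[OF tendsto_const _ sinh_real_at_top]) auto
  then show "filterlim (\<lambda>x. \<kappa> / 200 * sinh x) at_top at_top" by simp
  have "\<kappa> / 200 * sinh x \<le> cmod (psi \<sigma> \<theta> \<kappa> x)" for x
  proof -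
    let ?a = "\<bar>Re (arg (of_real x))\<bar>"
    have "sinh x \<le> 2 * ?a" using arg_bounds(1)[of "of_real x"] by simp
    also have "\<dots> \<le> 2 * exp ?a" using exp_ge_add_one_self[of ?a] by linarith
    finally have "\<kappa> / 200 * sinh x \<le> \<kappa> / 200 * (2 * exp ?a)" using \<kappa> by (intro mult_left_mono) auto
    also have "\<dots> \<le> cmod (psi \<sigma> \<theta> \<kappa> x)"
      using Psi_growth[of "of_real x"] eps by (simp add: Psi_of_real)
    finally show ?thesis .
  qed
  then show "\<forall>\<^sub>F x in at_top. \<kappa> / 200 * sinh x \<le> cmod (psi \<sigma> \<theta> \<kappa> x)" by simp
qed

text \<open>The constant is uniform in \<beta>, l, k and N. The decay uses only the lower bound
  \<open>bbar\<close>; the upper bound \<open>bmax\<close> enters through the powers of \<kappa>/100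
  and of l0, which may be raised to -\<beta> below 1.\<close>

lemma scalar_error:
  assumes bbar: "0 < bbar"
  obtains C where "C > 0" and "\<And>\<beta> l k N. bbar < \<beta> \<Longrightarrow> \<beta> \<le> bmax \<Longrightarrow> l0 \<le> l \<Longrightarrow> 0 < k \<Longrightarrow> k < 1 / 2 \<Longrightarrow>
    cmod (of_real l powr (- of_real \<beta>) - scalar_quad \<beta> l k N)
      \<le> C * l * (exp (- (pi * width l / k)) + exp (- (bbar / 8 * exp (k * real N))))"
proof -
  obtain L where L': "\<And>y. y \<in> strip (eps / 10) \<Longrightarrow> (L has_field_derivative Psi' y / Psi y) (at y)"
    and expL: "\<And>y. y \<in> strip (eps / 10) \<Longrightarrow> exp (L y) = Psi y"
    and Lreal: "\<And>x. L (of_real x) = Ln (psi \<sigma> \<theta> \<kappa> x)"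
    using contour_log by blast
  have l0: "0 < l0" using \<kappa> \<kappa>_less by simp
  \<comment> \<open>|Re (arg y)| is at least |sinh (Re y)| / 2, so |Psi y|^(-\<beta>) decays at
    least at rate \<open>bbar / 2\<close> in |sinh (Re y)|.\<close>
  define b where "b = bbar / 2"
  have b: "0 < b" using bbar by (simp add: b_def)
  define K where "K = exp (\<bar>bmax\<bar> * \<bar>ln (\<kappa> / 100)\<bar>)"
  define K3 where "K3 = K * C3"
  define K4 where "K4 = K3 * (1 + 2 / b\<^sup>2)"
  define K5 where "K5 = K3 * (exp (b / 2) * (32 / b\<^sup>2))"
  define K6 where "K6 = exp (\<bar>bmax\<bar> * \<bar>ln l0\<bar>) / l0"
  have Kpos: "0 < K" "0 < K3" "0 < K4" "0 < K5" "0 < K6"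
    using C3_pos b l0 by (auto simp: K_def K3_def K4_def K5_def K6_def add_pos_pos)
  \<comment> \<open>The first two summands serve the case exp t >= 2 below; the last serves the
    opposite case and is doubled because there 1 <= 2 exp (-t).\<close>
  define C where "C = 8 * pi * K4 + 2 * (2 * K5) + 2 * (2 * pi * K6 + K4 + 2 * K5)"
  have Cpos: "0 < C" using Kpos by (simp add: C_def add_pos_pos)
  show thesis
  proof (rule that[OF Cpos])
    fix \<beta> l k :: real and N :: nat
    assume \<beta>: "bbar < \<beta>" "\<beta> \<le> bmax" and l: "l0 \<le> l" and k: "0 < k" "k < 1 / 2"
    have lpos: "0 < l" using l l0 by simp
    have \<beta>0: "0 < \<beta>" using \<beta> bbar by simp
    note w = width[OF l]
    \<comment> \<open>exp (-\<beta> L) replaces the principal power, which would jump wherever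
      \<open>Psi\<close> crosses the negative axis.\<close>
    define h where "h y = exp (- of_real \<beta> * L y) * Psi' y / (of_real l - Psi y)" for y
    have sub: "y \<in> strip (eps / 10)" if "\<bar>Im y\<bar> < width l" for y
      using that w by (simp add: strip_def)
    have real_in: "of_real x \<in> strip (eps / 10)" for x using eps by (simp add: strip_def)
    have bound: "cmod (h y) \<le> K3 * l * (cosh (Re y) * exp (- (b * \<bar>sinh (Re y)\<bar>)))" if y: "\<bar>Im y\<bar> < width l" for y
    proof -
      let ?a = "\<bar>Re (arg y)\<bar>"
      have y1: "\<bar>Im y\<bar> \<le> eps / 10" and y2: "\<bar>Im y\<bar> \<le> 1 / 20" using y w eps by auto
      have "exp (ln (\<kappa> / 100) + ?a) = \<kappa> / 100 * exp ?a" using \<kappa> by (simp add: exp_add)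
      also have "\<dots> \<le> cmod (Psi y)" by (rule Psi_growth[OF y1])
      also have "\<dots> = exp (Re (L y))" using expL[OF sub[OF y]] by (metis norm_exp_eq_Re)
      finally have "ln (\<kappa> / 100) + ?a \<le> Re (L y)" by simp
      then have "\<beta> * (ln (\<kappa> / 100) + ?a) \<le> \<beta> * Re (L y)" using \<beta>0 by (intro mult_left_mono) auto
      moreover have "- (\<beta> * ln (\<kappa> / 100)) \<le> \<bar>bmax\<bar> * \<bar>ln (\<kappa> / 100)\<bar>"
      proof -
        have "- (\<beta> * ln (\<kappa> / 100)) \<le> \<bar>\<beta>\<bar> * \<bar>ln (\<kappa> / 100)\<bar>" by (metis abs_ge_minus_self abs_mult)
        also have "\<dots> \<le> \<bar>bmax\<bar> * \<bar>ln (\<kappa> / 100)\<bar>" using \<beta> \<beta>0 by (intro mult_right_mono) auto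
        finally show ?thesis .
      qed
      moreover have "bbar * (\<bar>sinh (Re y)\<bar> / 2) \<le> \<beta> * ?a"
        using \<beta> \<beta>0 bbar arg_bounds(1)[OF y2] by (intro mult_mono) auto
      then have "b * \<bar>sinh (Re y)\<bar> \<le> \<beta> * ?a" by (simp add: b_def)
      ultimately have "- (\<beta> * Re (L y)) \<le> \<bar>bmax\<bar> * \<bar>ln (\<kappa> / 100)\<bar> + - (b * \<bar>sinh (Re y)\<bar>)"
        by (simp add: distrib_left)
      then have "exp (- (\<beta> * Re (L y))) \<le> exp (\<bar>bmax\<bar> * \<bar>ln (\<kappa> / 100)\<bar> + - (b * \<bar>sinh (Re y)\<bar>))"
        by (simp only: exp_le_cancel_iff)
      also have "\<dots> = K * exp (- (b * \<bar>sinh (Re y)\<bar>))"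
        by (simp only: K_def exp_add)
      finally have 1: "cmod (exp (- of_real \<beta> * L y)) \<le> K * exp (- (b * \<bar>sinh (Re y)\<bar>))"
        by (simp add: norm_exp_eq_Re)
      have "cmod (h y) = cmod (exp (- of_real \<beta> * L y)) * cmod (Psi' y / (of_real l - Psi y))"
        by (simp only: h_def times_divide_eq_right[symmetric] norm_mult)
      also have "\<dots> \<le> (K * exp (- (b * \<bar>sinh (Re y)\<bar>))) * (C3 * l * cosh (Re y))"
        using 1 kernel_bound[OF l, of y] y Kpos by (intro mult_mono) auto
      also have "\<dots> = K3 * l * (cosh (Re y) * exp (- (b * \<bar>sinh (Re y)\<bar>)))" by (simp add: K3_def)
      finally show ?thesis .
    qed
    have bound_sech: "cmod (h y) \<le> K4 * l / cosh (Re y)" if "\<bar>Im y\<bar> < width l" for y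
    proof -
      have "cmod (h y) \<le> K3 * l * ((1 + 2 / b\<^sup>2) / cosh (Re y))"
        using order_trans[OF bound[OF that] mult_left_mono[OF cosh_decay[OF b]]] Kpos lpos by simp
      then show ?thesis by (simp add: K4_def mult_ac)
    qed
    have bound_real: "cmod (h (of_real x)) \<le> K5 * l * (exp (- \<bar>x\<bar>) * exp (- (b / 4 * exp \<bar>x\<bar>)))" for x
    proof -
      have "cmod (h (of_real x)) \<le> K3 * l * (cosh \<bar>x\<bar> * exp (- (b * \<bar>sinh \<bar>x\<bar>\<bar>)))"
        using bound[of "of_real x"] w by simp
      also have "\<dots> \<le> K3 * l * (exp (b / 2) * (32 / b\<^sup>2) * (exp (- \<bar>x\<bar>) * exp (- (b / 4 * exp \<bar>x\<bar>))))"
        using cosh_double_exp_decay[OF b, of "\<bar>x\<bar>"] Kpos lpos by (intro mult_left_mono) auto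
      also have "\<dots> = K5 * l * (exp (- \<bar>x\<bar>) * exp (- (b / 4 * exp \<bar>x\<bar>)))" by (simp add: K5_def)
      finally show ?thesis .
    qed
    have holL: "L holomorphic_on {y. \<bar>Im y\<bar> < width l}"
      using L' sub by (auto simp: holomorphic_on_def field_differentiable_def intro: has_field_derivative_at_within)
    have holh: "h holomorphic_on {y. \<bar>Im y\<bar> < width l}"
      unfolding h_def[abs_def] using resolvent_bound(1)[OF l]
      by (intro holomorphic_intros holL Psi_holomorphic Psi'_holomorphic) (auto simp: less_imp_le)
    obtain H where H0: "\<And>y. y \<in> strip (width l) \<Longrightarrow> (H has_field_derivative h y) (at y within strip (width l))"
    proof (rule holomorphic_convex_primitive'[OF strip(2,1) holh[folded strip_def]])
      fix g assume "\<And>y. y \<in> strip (width l) \<Longrightarrow> (g has_field_derivative h y) (at y within strip (width l))"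
      then show thesis by (rule that)
    qed
    have H: "(H has_field_derivative h y) (at y)" if "\<bar>Im y\<bar> < width l" for y
    proof -
      have y: "y \<in> strip (width l)" using that by (simp add: strip_def)
      show ?thesis using H0[OF y] by (simp only: at_within_open[OF y strip(1)])
    qed
    have hreal: "h (of_real x) = psi \<sigma> \<theta> \<kappa> x powr (- of_real \<beta>) * Psi' (of_real x) / (of_real l - psi \<sigma> \<theta> \<kappa> x)" for x
      using psi_half_plane(1)[of x] by (auto simp: h_def Lreal Psi_of_real powr_def)
    let ?T = "\<lambda>M. of_real k * (\<Sum>j = - int M..int M. h (of_real (of_int j * k)))"
    let ?J = "2 * of_real pi * \<i> * of_real l powr (- of_real \<beta>)"
    \<comment> \<open>Induction over symmetric pairs of outer nodes. The double exponential is
      frozen at its value for n, and the remaining factor exp (-x) telescopes.\<close>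
    have tail: "cmod (?T M - ?T n) \<le> 2 * K5 * l * exp (- (b / 4 * exp (k * real n))) * (exp (- (real n * k)) - exp (- (real M * k)))"
      if "n \<le> M" for n M
      using that
    proof (induction M rule: dec_induct)
      case base
      then show ?case by simp
    next
      case (step M)
      let ?E = "exp (- (b / 4 * exp (k * real n)))"
      let ?x = "real (Suc M) * k"
      have step_bound: "k * cmod (h (of_real x)) \<le> K5 * l * ?E * (exp (- (real M * k)) - exp (- ?x))" if "\<bar>x\<bar> = ?x" for x
      proof -
        have "k * real n \<le> ?x" using step(1) k by simp
        then have "exp (- (b / 4 * exp ?x)) \<le> ?E" using b by simp
        then have "cmod (h (of_real x)) \<le> K5 * l * (exp (- ?x) * ?E)"
          using bound_real[of x] Kpos lpos unfolding that by (elim order_trans) (intro mult_left_mono, auto)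
        then have "k * cmod (h (of_real x)) \<le> k * (K5 * l * (exp (- ?x) * ?E))"
          using k by (intro mult_left_mono) auto
        also have "\<dots> = K5 * l * ?E * (k * exp (- ?x))" by simp
        also have "\<dots> \<le> K5 * l * ?E * (exp (- (real M * k)) - exp (- ?x))"
          using exp_sum_step[of k M] Kpos lpos by (intro mult_left_mono) auto
        finally show ?thesis .
      qed
      have "?T (Suc M) - ?T n = (?T M - ?T n) + of_real k * h (of_real ?x) + of_real k * h (of_real (- ?x))"
        unfolding sum_symmetric_Suc by (simp add: algebra_simps)
      also have "cmod \<dots> \<le> cmod (?T M - ?T n) + k * cmod (h (of_real ?x)) + k * cmod (h (of_real (- ?x)))"
        using k by (intro norm_triangle_le add_mono) (auto simp: norm_mult)
      also have "\<dots> \<le> 2 * K5 * l * ?E * (exp (- (real n * k)) - exp (- (real M * k)))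
          + K5 * l * ?E * (exp (- (real M * k)) - exp (- ?x)) + K5 * l * ?E * (exp (- (real M * k)) - exp (- ?x))"
        using k by (intro add_mono step.IH step_bound) auto
      also have "\<dots> = 2 * K5 * l * ?E * (exp (- (real n * k)) - exp (- ?x))"
        by (simp only: right_diff_distrib)
      finally show ?case .
    qed
    have tail': "cmod (?T M - ?T n) \<le> 2 * K5 * l * exp (- (b / 4 * exp (k * real n)))" if "n \<le> M" for n M
    proof -
      have "exp (- (real n * k)) \<le> 1" "0 < exp (- (real M * k))" using k by auto
      then have "exp (- (real n * k)) - exp (- (real M * k)) \<le> 1" by linarith
      then have "2 * K5 * l * exp (- (b / 4 * exp (k * real n))) * (exp (- (real n * k)) - exp (- (real M * k)))
          \<le> 2 * K5 * l * exp (- (b / 4 * exp (k * real n))) * 1"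
        using Kpos lpos by (intro mult_left_mono) auto
      with tail[OF that] show ?thesis by simp
    qed
    \<comment> \<open>For steps that are large compared with the width, 1/(exp t - 1) is unbounded,
      and this trivial bound takes over.\<close>
    have crude: "cmod (?J - ?T N) \<le> (2 * pi * K6 + K4 + 2 * K5) * l"
    proof -
      have "cmod (of_real l powr (- of_real \<beta>)) = exp (- (\<beta> * ln l))"
        using lpos by (simp add: powr_def norm_exp_eq_Re Ln_of_real)
      also have "\<dots> \<le> exp (\<bar>bmax\<bar> * \<bar>ln l0\<bar>)"
      proof -
        have "- (\<beta> * ln l) \<le> - (\<beta> * ln l0)" using l l0 \<beta>0 by simp
        also have "\<dots> \<le> \<bar>\<beta>\<bar> * \<bar>ln l0\<bar>" by (metis abs_ge_minus_self abs_mult)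
        also have "\<dots> \<le> \<bar>bmax\<bar> * \<bar>ln l0\<bar>" using \<beta> \<beta>0 by (intro mult_right_mono) auto
        finally show ?thesis by simp
      qed
      also have "\<dots> = K6 * l0" using l0 by (simp add: K6_def)
      also have "\<dots> \<le> K6 * l" using l Kpos by (intro mult_left_mono) auto
      finally have 1: "cmod ?J \<le> 2 * pi * (K6 * l)" by (simp add: norm_mult)
      have "cmod (h (of_real 0)) \<le> K4 * l" using bound_sech[of 0] w by simp
      then have "k * cmod (h (of_real 0)) \<le> 1 * (K4 * l)"
        using k by (intro mult_mono) auto
      then have 2: "cmod (?T 0) \<le> K4 * l" using k by (simp add: norm_mult)
      have "2 * K5 * l * exp (- (b / 4 * exp (k * real 0))) \<le> 2 * K5 * l * 1"
        using Kpos lpos b by (intro mult_left_mono) auto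
      with tail'[of 0 N] have 3: "cmod (?T N - ?T 0) \<le> 2 * K5 * l" by simp
      have "?J - ?T N = ?J - ?T 0 - (?T N - ?T 0)" by simp
      also have "cmod \<dots> \<le> cmod ?J + cmod (?T 0) + cmod (?T N - ?T 0)"
        by (intro norm_triangle_le_diff add_mono order_refl)
      also have "\<dots> \<le> 2 * pi * (K6 * l) + K4 * l + 2 * K5 * l" using 1 2 3 by linarith
      finally show ?thesis by (simp add: algebra_simps)
    qed
    \<comment> \<open>Strictly inside the domain of holomorphy, as the rectangle argument requires;
      hence the rate pi times the width over k instead of twice that.\<close>
    define d where "d = width l / 2"
    define t where "t = pi * width l / k"
    have t_eq: "2 * pi * d / k = t" by (simp add: d_def t_def)
    have tpos: "0 < t" using w k by (simp add: t_def)
    have dpos: "0 < d" "d < width l" using w by (auto simp: d_def)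
    \<comment> \<open>\<open>N\<close> stays fixed while the rectangle with \<open>M >= N\<close>
      grows: its side terms vanish, the increments of \<open>H\<close> tend to the contour integral,
      and only the tail between \<open>N\<close> and \<open>M\<close> sees the truncation.\<close>
    have fine: "cmod (?J - ?T N) \<le> 2 * K5 * l * exp (- (b / 4 * exp (k * real N))) + 2 * pi * (K4 * l) / (exp t - 1)"
    proof -
      let ?X = "\<lambda>M. (real M + 1 / 2) * k"
      let ?D = "\<lambda>M. H (of_real (?X M)) - H (of_real (- ?X M))"
      have Xlim: "filterlim ?X at_top sequentially"
      proof -
        have "filterlim (\<lambda>M. 1 / 2 + real M) at_top sequentially"
          by (intro filterlim_tendsto_add_at_top[OF tendsto_const] filterlim_real_sequentially)
        from filterlim_at_top_mult_tendsto_pos[OF tendsto_const k(1) this]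
        show ?thesis by (simp add: add.commute mult.commute)
      qed
      have "((\<lambda>X. H (of_real X) - H (of_real (- X))) \<longlongrightarrow> ?J) at_top"
      proof (rule cauchy_kernel_limit[OF \<beta>0 lpos psi_deriv psi_half_plane(1) _ psi_uminus _ psi_at_top])
        show "of_real l - psi \<sigma> \<theta> \<kappa> x \<notin> \<real>\<^sub>\<le>\<^sub>0" for x
          using \<kappa> \<kappa>_less l \<theta> by (cases "x = 0") (auto simp: complex_nonpos_Reals_iff Re_psi Im_psi)
        show "0 < Im (psi \<sigma> \<theta> \<kappa> x)" if "0 < x" for x
          using that \<kappa> \<theta> by (simp add: Im_psi)
        show "((\<lambda>x. H (of_real x)) has_vector_derivative psi \<sigma> \<theta> \<kappa> x powr (- of_real \<beta>) *
            Psi' (of_real x) / (of_real l - psi \<sigma> \<theta> \<kappa> x)) (at x)" for x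
          using has_vector_derivative_real_field[OF H[of "of_real x"]] w by (simp add: hreal)
      qed
      then have Dlim: "?D \<longlonglongrightarrow> ?J" by (rule filterlim_compose[OF _ Xlim])
      have "filterlim (\<lambda>M. cosh (?X M)) at_top sequentially"
        by (rule filterlim_compose[OF cosh_real_at_top Xlim])
      then have small: "(\<lambda>M. 6 * d * (K4 * l) / cosh (?X M)) \<longlonglongrightarrow> 0"
        by (rule tendsto_divide_0[OF tendsto_const filterlim_at_top_imp_at_infinity])
      have est: "cmod (?D M - ?T N) \<le> 2 * K5 * l * exp (- (b / 4 * exp (k * real N)))
          + 2 * pi * (K4 * l) / (exp t - 1) + 6 * d * (K4 * l) / cosh (?X M)" if "N \<le> M" for M
      proof -
        have "cmod (?T M - ?D M) \<le> 2 * pi * (K4 * l) / (exp (2 * pi * d / k) - 1) + 6 * d * (K4 * l) / cosh (?X M)"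
          by (rule trapezoid_strip[OF dpos k(1) holh H]) (use bound_sech dpos in auto)
        moreover have "?D M - ?T N = (?T M - ?T N) - (?T M - ?D M)" by simp
        then have "cmod (?D M - ?T N) \<le> cmod (?T M - ?T N) + cmod (?T M - ?D M)"
          by (simp only: norm_triangle_ineq4)
        ultimately show ?thesis using tail'[OF that] unfolding t_eq by linarith
      qed
      have "cmod (?J - ?T N) \<le> 2 * K5 * l * exp (- (b / 4 * exp (k * real N))) + 2 * pi * (K4 * l) / (exp t - 1) + 0"
        by (rule tendsto_le[OF sequentially_bot tendsto_add[OF tendsto_const small] tendsto_norm[OF tendsto_diff[OF Dlim tendsto_const]]])
          (use est in \<open>auto intro: eventually_sequentiallyI\<close>)
      then show ?thesis by simp
    qed
    let ?E1 = "exp (- t)" and ?E2 = "exp (- (b / 4 * exp (k * real N)))"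
    have "cmod (?J - ?T N) \<le> C * l * (?E1 + ?E2)"
    proof (cases "2 \<le> exp t")
      case True
      have "?E1 * exp t = 1" by (simp flip: exp_add)
      have "2 * pi * (K4 * l) / (exp t - 1) \<le> 2 * pi * (K4 * l) / (exp t / 2)"
        using True Kpos lpos tpos by (intro divide_left_mono mult_pos_pos) auto
      also have "\<dots> = 4 * pi * K4 * l * ?E1" by (simp add: exp_minus field_simps)
      finally have "cmod (?J - ?T N) \<le> 2 * K5 * l * ?E2 + 4 * pi * K4 * l * ?E1" using fine by linarith
      also have "\<dots> \<le> C * l * ?E2 + C * l * ?E1"
        using Kpos lpos by (intro add_mono mult_right_mono) (auto simp: C_def)
      finally show ?thesis by (simp add: distrib_left)
    next
      case False
      have "?E1 * exp t = 1" by (simp flip: exp_add)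
      moreover have "?E1 * exp t \<le> ?E1 * 2" using False by (intro mult_left_mono) auto
      ultimately have half: "1 \<le> 2 * ?E1" by simp
      have "cmod (?J - ?T N) \<le> (2 * pi * K6 + K4 + 2 * K5) * l * 1" using crude by simp
      also have "\<dots> \<le> (2 * pi * K6 + K4 + 2 * K5) * l * (2 * ?E1)"
        using half Kpos lpos by (intro mult_left_mono) auto
      also have "\<dots> = (2 * (2 * pi * K6 + K4 + 2 * K5)) * l * ?E1" by simp
      also have "\<dots> \<le> C * l * ?E1"
        using Kpos lpos by (intro mult_right_mono) (auto simp: C_def)
      also have "\<dots> \<le> C * l * (?E1 + ?E2)" using Cpos lpos by (intro mult_left_mono) auto
      finally show ?thesis .
    qed
    moreover have "scalar_quad \<beta> l k N = of_real k / (2 * of_real pi * \<i>) *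
        (\<Sum>j = - int N..int N. h (of_real (real_of_int j * k)))"
      by (simp only: scalar_quad_def hreal)
    then have "?J - ?T N = 2 * of_real pi * \<i> * (of_real l powr (- of_real \<beta>) - scalar_quad \<beta> l k N)"
      by (simp add: right_diff_distrib)
    ultimately have "2 * pi * cmod (of_real l powr (- of_real \<beta>) - scalar_quad \<beta> l k N) \<le> C * l * (?E1 + ?E2)"
      by (simp add: norm_mult)
    moreover have "1 * cmod (of_real l powr (- of_real \<beta>) - scalar_quad \<beta> l k N)
        \<le> 2 * pi * cmod (of_real l powr (- of_real \<beta>) - scalar_quad \<beta> l k N)"
      using pi_ge_two by (intro mult_right_mono) auto
    ultimately show "cmod (of_real l powr (- of_real \<beta>) - scalar_quad \<beta> l k N)
      \<le> C * l * (exp (- (pi * width l / k)) + exp (- (bbar / 8 * exp (k * real N))))"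
      by (simp add: t_def b_def)
  qed
qed

end

section \<open>Summation over the spectrum\<close>

lemma fact_add_le: "fact (q + n) \<le> (2 ^ (q + n) * fact q * fact n :: real)"
proof -
  have "(fact (q + n) :: real) = real ((q + n) choose q) * fact q * fact n"
    using binomial_fact[of q "q + n", where 'a = real] by (simp add: field_simps)
  also have "\<dots> \<le> 2 ^ (q + n) * fact q * fact n"
  proof (intro mult_right_mono)
    have "real ((q + n) choose q) \<le> real (2 ^ (q + n))"
      using binomial_le_pow2[of "q + n" q] by (rule of_nat_mono)
    then show "real ((q + n) choose q) \<le> 2 ^ (q + n)" by simp
  qed auto
  finally show ?thesis .
qed

text \<open>The power on the right is the \<open>n\<close>-th power of the threshold at which the spectrum is split: dividing by
  it turns the factorial growth of the moments into the factor \<open>exp (- 2 n)\<close>.\<close>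

lemma gevrey_moment:
  fixes R \<omega> :: real and n q :: nat
  assumes "0 < R" "0 \<le> \<omega>" "1 \<le> n"
  shows "R ^ (2 * (q + n)) * fact (q + n) powr (2 * \<omega>)
    \<le> R ^ (2 * q) * (2 ^ q * fact q) powr (2 * \<omega>) * exp (- 2 * real n) *
      (exp 2 * R\<^sup>2 * 4 powr \<omega> * real n powr (2 * \<omega>)) ^ n"
proof -
  have "fact (q + n) \<le> (2 ^ q * fact q) * (2 ^ n * real n ^ n)"
  proof -
    have "fact n \<le> real n ^ n" using fact_le_power[of n, where 'a = real] by simp
    then have "2 ^ (q + n) * fact q * fact n \<le> 2 ^ (q + n) * fact q * real n ^ n"
      by (intro mult_left_mono) auto
    with fact_add_le[of q n] have "fact (q + n) \<le> 2 ^ (q + n) * fact q * real n ^ n"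
      by (rule order_trans)
    then show ?thesis by (simp add: power_add mult_ac)
  qed
  then have "fact (q + n) powr (2 * \<omega>) \<le> ((2 ^ q * fact q) * (2 ^ n * real n ^ n)) powr (2 * \<omega>)"
    using assms by (intro powr_mono2) auto
  also have "\<dots> = (2 ^ q * fact q) powr (2 * \<omega>) * (2 ^ n * real n ^ n) powr (2 * \<omega>)"
    by (simp add: powr_mult)
  also have "(2 ^ n * real n ^ n) powr (2 * \<omega>) = (4 powr \<omega> * real n powr (2 * \<omega>)) ^ n"
  proof -
    have "(2 ^ n * real n ^ n) powr (2 * \<omega>) = ((2 * real n) powr (2 * \<omega>)) ^ n"
    proof -
      have pos: "0 < 2 * real n" using assms by simp
      have "2 ^ n * real n ^ n = (2 * real n) powr real n"
        using pos by (simp only: powr_realpow power_mult_distrib)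
      also have "\<dots> powr (2 * \<omega>) = ((2 * real n) powr (2 * \<omega>)) powr real n"
        by (simp only: powr_powr mult.commute)
      also have "\<dots> = ((2 * real n) powr (2 * \<omega>)) ^ n"
        using pos by (subst powr_realpow) auto
      finally show ?thesis .
    qed
    also have "(2 * real n) powr (2 * \<omega>) = 4 powr \<omega> * real n powr (2 * \<omega>)"
      using assms powr_powr[of 2 2 \<omega>] by (simp add: powr_mult)
    finally show ?thesis .
  qed
  finally have "R ^ (2 * (q + n)) * fact (q + n) powr (2 * \<omega>)
      \<le> R ^ (2 * (q + n)) * ((2 ^ q * fact q) powr (2 * \<omega>) * (4 powr \<omega> * real n powr (2 * \<omega>)) ^ n)"
    using assms by (intro mult_left_mono) auto
  also have "\<dots> = R ^ (2 * q) * (2 ^ q * fact q) powr (2 * \<omega>) * (exp (- 2 * real n) * exp 2 ^ n) *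
      ((R\<^sup>2) ^ n * (4 powr \<omega> * real n powr (2 * \<omega>)) ^ n)"
    by (simp add: power_add power_mult[symmetric] distrib_left exp_of_nat_mult[symmetric] flip: exp_add)
  also have "\<dots> = R ^ (2 * q) * (2 ^ q * fact q) powr (2 * \<omega>) * exp (- 2 * real n) *
      (exp 2 * R\<^sup>2 * 4 powr \<omega> * real n powr (2 * \<omega>)) ^ n"
    by (simp add: power_mult_distrib mult_ac)
  finally show ?thesis .
qed

text \<open>Here \<open>a\<close> stands for squared coefficients of the data, \<open>e\<close> for
  scalar errors, \<open>D\<close> for their strip part and \<open>T\<close> for the truncation part.
  Each power of \<open>lam\<close> lost is paid for by a higher moment: \<open>q = p + 2\<close>
  consists of the weight of the norm and the square of the factor \<open>lam\<close> in the error.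
  The eigenvalues above \<Lambda> are treated by a Markov type inequality with n further
  moments.\<close>

lemma weighted_error_sum:
  fixes lam a e D :: "nat \<Rightarrow> real" and q n :: nat
  assumes l0: "0 < l0" "\<And>j. l0 \<le> lam j" and a: "\<And>j. 0 \<le> a j" and R: "0 < R" and \<omega>: "0 \<le> \<omega>" and Cf: "0 < Cf"
    and moments: "\<And>m. summable (\<lambda>j. lam j ^ m * a j)"
      "\<And>m. (\<Sum>j. lam j ^ m * a j) \<le> Cf\<^sup>2 * (R ^ (2 * m) * fact m powr (2 * \<omega>))"
    and n: "1 \<le> n" and \<Lambda>: "\<Lambda> = exp 2 * R\<^sup>2 * 4 powr \<omega> * real n powr (2 * \<omega>)"
    and e: "\<And>j. 0 \<le> e j" "\<And>j. e j \<le> C * lam j * (D j + T)" and C: "0 < C" and T: "0 \<le> T"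
    and D: "\<And>j. 0 \<le> D j" "\<And>j. D j \<le> 1" "\<And>j. lam j < \<Lambda> \<Longrightarrow> D j \<le> D0" and D0: "0 \<le> D0"
    and \<beta>: "0 \<le> \<beta>" "\<beta> \<le> real p" and q: "q = p + 2"
  shows "summable (\<lambda>j. lam j powr \<beta> * ((e j)\<^sup>2 * a j))"
    and "sqrt (\<Sum>j. lam j powr \<beta> * ((e j)\<^sup>2 * a j))
      \<le> C * sqrt (2 * exp (real p * \<bar>ln l0\<bar>) * (R ^ (2 * q) * (2 ^ q * fact q) powr (2 * \<omega>))) * (Cf * (T + D0 + exp (- real n)))"
proof -
  define K where "K = exp (real p * \<bar>ln l0\<bar>)"
  define Q where "Q = R ^ (2 * q) * (2 ^ q * fact q) powr (2 * \<omega>)"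
  have Kpos: "0 < K" and Qpos: "0 \<le> Q" using R by (auto simp: K_def Q_def)
  have lpos: "0 < lam j" for j using l0(1) l0(2)[of j] by simp
  have \<Lambda>pos: "0 < \<Lambda>" using R n by (simp add: \<Lambda>)
  \<comment> \<open>\<beta> is rounded up to the integer \<open>p\<close>. Eigenvalues may lie below
    1, where the rounding costs a constant.\<close>
  have weight: "lam j powr \<beta> \<le> K * lam j ^ p" for j
  proof -
    have "lam j powr \<beta> = lam j powr (\<beta> - real p) * lam j powr real p"
      using lpos[of j] by (simp flip: powr_add)
    also have "lam j powr (\<beta> - real p) \<le> K"
    proof -
      have "(\<beta> - real p) * ln (lam j) \<le> (\<beta> - real p) * ln l0"
        using \<beta> l0(1) l0(2)[of j] lpos[of j] by (intro mult_left_mono_neg) auto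
      also have "\<dots> \<le> \<bar>\<beta> - real p\<bar> * \<bar>ln l0\<bar>" by (metis abs_ge_self abs_mult)
      also have "\<dots> \<le> real p * \<bar>ln l0\<bar>" using \<beta> by (intro mult_right_mono) auto
      finally show ?thesis using lpos[of j] by (simp add: powr_def K_def)
    qed
    finally show ?thesis using lpos[of j] by (simp add: powr_realpow)
  qed
  let ?F = "\<lambda>j. (T\<^sup>2 + D0\<^sup>2) * (lam j ^ q * a j) + (1 / \<Lambda> ^ n) * (lam j ^ (q + n) * a j)"
  have point: "lam j powr \<beta> * ((e j)\<^sup>2 * a j) \<le> 2 * K * C\<^sup>2 * ?F j" for j
  proof -
    have "(e j)\<^sup>2 \<le> (C * lam j * (D j + T))\<^sup>2" using e by (intro power_mono) auto
    also have "\<dots> = C\<^sup>2 * (lam j)\<^sup>2 * (D j + T)\<^sup>2" by (simp add: power_mult_distrib)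
    also have "\<dots> \<le> C\<^sup>2 * (lam j)\<^sup>2 * (2 * (D j)\<^sup>2 + 2 * T\<^sup>2)"
      using sum_squares_bound[of "D j" T] by (intro mult_left_mono) (auto simp: power2_sum)
    finally have "(e j)\<^sup>2 \<le> C\<^sup>2 * (lam j)\<^sup>2 * (2 * (D j)\<^sup>2 + 2 * T\<^sup>2)" .
    then have "lam j powr \<beta> * ((e j)\<^sup>2 * a j) \<le> (K * lam j ^ p) * ((C\<^sup>2 * (lam j)\<^sup>2 * (2 * (D j)\<^sup>2 + 2 * T\<^sup>2)) * a j)"
      using weight[of j] a[of j] Kpos lpos[of j] by (intro mult_mono) auto
    also have "\<dots> = 2 * K * C\<^sup>2 * (T\<^sup>2 * (lam j ^ q * a j) + (D j)\<^sup>2 * (lam j ^ q * a j))"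
      by (simp add: q power_add power2_eq_square algebra_simps)
    also have "\<dots> \<le> 2 * K * C\<^sup>2 * ?F j"
    proof (intro mult_left_mono)
      have la: "0 \<le> lam j ^ m * a j" for m using lpos[of j] a[of j] by simp
      have "(D j)\<^sup>2 * (lam j ^ q * a j) \<le> D0\<^sup>2 * (lam j ^ q * a j) + (1 / \<Lambda> ^ n) * (lam j ^ (q + n) * a j)"
      proof (cases "lam j < \<Lambda>")
        case True
        have "(D j)\<^sup>2 * (lam j ^ q * a j) \<le> D0\<^sup>2 * (lam j ^ q * a j)"
          using D(1,3) True la by (intro mult_right_mono power_mono) auto
        moreover have "0 \<le> (1 / \<Lambda> ^ n) * (lam j ^ (q + n) * a j)" using \<Lambda>pos la[of "q + n"] by simp
        ultimately show ?thesis by linarith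
      next
        case False
        have "(D j)\<^sup>2 \<le> 1" using D(1,2) by (simp add: power_le_one)
        then have "(D j)\<^sup>2 * (lam j ^ q * a j) \<le> 1 * (lam j ^ q * a j)" using la by (intro mult_right_mono) auto
        \<comment> \<open>Above the threshold \<open>D\<close> may be as large as 1, and the missing
          smallness is bought with the factor (\<open>lam j\<close> / \<Lambda>)^n >= 1.\<close>
        moreover have "1 \<le> lam j ^ n / \<Lambda> ^ n"
          using False \<Lambda>pos power_mono[of \<Lambda> "lam j" n] by (simp add: field_simps)
        then have "1 * (lam j ^ q * a j) \<le> (lam j ^ n / \<Lambda> ^ n) * (lam j ^ q * a j)"
          using la by (intro mult_right_mono) auto
        moreover have "(lam j ^ n / \<Lambda> ^ n) * (lam j ^ q * a j) = (1 / \<Lambda> ^ n) * (lam j ^ (q + n) * a j)"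
          by (simp add: power_add)
        moreover have "0 \<le> D0\<^sup>2 * (lam j ^ q * a j)" using la by simp
        ultimately show ?thesis by linarith
      qed
      then show "T\<^sup>2 * (lam j ^ q * a j) + (D j)\<^sup>2 * (lam j ^ q * a j) \<le> ?F j"
        by (simp add: distrib_right)
    qed (use Kpos in auto)
    finally show ?thesis .
  qed
  have sF: "summable ?F" by (intro summable_add summable_mult moments)
  then have sF': "summable (\<lambda>j. 2 * K * C\<^sup>2 * ?F j)" by (rule summable_mult)
  have nonneg: "0 \<le> lam j powr \<beta> * ((e j)\<^sup>2 * a j)" for j using a[of j] by simp
  show S: "summable (\<lambda>j. lam j powr \<beta> * ((e j)\<^sup>2 * a j))"
    by (rule summable_comparison_test'[OF sF', of 0]) (use point nonneg in auto)
  have "(\<Sum>j. lam j powr \<beta> * ((e j)\<^sup>2 * a j)) \<le> (\<Sum>j. 2 * K * C\<^sup>2 * ?F j)"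
    by (rule suminf_le[OF point S sF'])
  also have "\<dots> = 2 * K * C\<^sup>2 * ((T\<^sup>2 + D0\<^sup>2) * (\<Sum>j. lam j ^ q * a j) + (1 / \<Lambda> ^ n) * (\<Sum>j. lam j ^ (q + n) * a j))"
    by (subst suminf_mult[OF sF], subst suminf_add[symmetric])
      (auto intro!: summable_mult moments simp: suminf_mult moments simp del: times_divide_eq_left mult_1)
  also have "\<dots> \<le> 2 * K * C\<^sup>2 * ((T\<^sup>2 + D0\<^sup>2) * (Cf\<^sup>2 * Q) + Cf\<^sup>2 * Q * exp (- 2 * real n))"
  proof (intro mult_left_mono add_mono)
    have "fact q powr (2 * \<omega>) \<le> (2 ^ q * fact q) powr (2 * \<omega>)"
      using \<omega> mult_right_mono[of 1 "2 ^ q" "fact q :: real"] by (intro powr_mono2) auto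
    then have "R ^ (2 * q) * fact q powr (2 * \<omega>) \<le> Q"
      unfolding Q_def using R by (intro mult_left_mono) auto
    then have "Cf\<^sup>2 * (R ^ (2 * q) * fact q powr (2 * \<omega>)) \<le> Cf\<^sup>2 * Q" by (intro mult_left_mono) auto
    then show "(\<Sum>j. lam j ^ q * a j) \<le> Cf\<^sup>2 * Q" using moments(2)[of q] by linarith
    have "(\<Sum>j. lam j ^ (q + n) * a j) \<le> Cf\<^sup>2 * (Q * exp (- 2 * real n) * \<Lambda> ^ n)"
      using order_trans[OF moments(2)[of "q + n"] mult_left_mono[OF gevrey_moment[OF R \<omega> n, of q]]]
      unfolding Q_def \<Lambda> by simp
    then have "(1 / \<Lambda> ^ n) * (\<Sum>j. lam j ^ (q + n) * a j) \<le> (1 / \<Lambda> ^ n) * (Cf\<^sup>2 * (Q * exp (- 2 * real n) * \<Lambda> ^ n))"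
      using \<Lambda>pos by (intro mult_left_mono) auto
    also have "\<dots> = Cf\<^sup>2 * Q * exp (- 2 * real n)" using \<Lambda>pos by simp
    finally show "(1 / \<Lambda> ^ n) * (\<Sum>j. lam j ^ (q + n) * a j) \<le> Cf\<^sup>2 * Q * exp (- 2 * real n)" .
  qed (use Kpos in auto)
  also have "\<dots> = C\<^sup>2 * (2 * K * Q) * Cf\<^sup>2 * (T\<^sup>2 + D0\<^sup>2 + (exp (- real n))\<^sup>2)"
    by (simp add: algebra_simps exp_double[symmetric])
  also have "\<dots> \<le> C\<^sup>2 * (2 * K * Q) * Cf\<^sup>2 * (T + D0 + exp (- real n))\<^sup>2"
    using Kpos Qpos T D0 by (intro mult_left_mono) (auto simp: power2_sum algebra_simps)
  also have "\<dots> = (C * sqrt (2 * K * Q) * (Cf * (T + D0 + exp (- real n))))\<^sup>2"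
    using Kpos Qpos by (simp add: power_mult_distrib)
  finally have "sqrt (\<Sum>j. lam j powr \<beta> * ((e j)\<^sup>2 * a j)) \<le> C * sqrt (2 * K * Q) * (Cf * (T + D0 + exp (- real n)))"
    using C Cf T D0 Kpos Qpos by (intro real_le_lsqrt) (auto simp: add_nonneg_nonneg)
  then show "sqrt (\<Sum>j. lam j powr \<beta> * ((e j)\<^sup>2 * a j))
      \<le> C * sqrt (2 * exp (real p * \<bar>ln l0\<bar>) * (R ^ (2 * q) * (2 ^ q * fact q) powr (2 * \<omega>))) * (Cf * (T + D0 + exp (- real n)))"
    by (simp add: K_def Q_def)
qed

section \<open>The quadrature operator in terms of coefficients\<close>

context de_contour
begin

text \<open>At real y the imaginary part of \<open>arg y\<close> is 0, so \<open>P_gap\<close>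
  applies for every l. The nodes thus keep one common distance from the whole spectrum, as existence
  of the resolvents requires.\<close>

lemma psi_gap:
  assumes "l0 \<le> l"
  shows "\<kappa> * gap / 2 \<le> cmod (of_real l - psi \<sigma> \<theta> \<kappa> x)"
proof -
  have "gap / 2 \<le> cmod (of_real (l / \<kappa>) - P (arg (of_real x)))"
    using assms eps \<kappa> by (intro P_gap) (auto simp: Im_arg divide_right_mono)
  then have "\<kappa> * (gap / 2) \<le> \<kappa> * cmod (of_real (l / \<kappa>) - P (arg (of_real x)))"
    using \<kappa> by (intro mult_left_mono) auto
  also have "\<dots> = cmod (of_real \<kappa> * (of_real (l / \<kappa>) - P (arg (of_real x))))"
    using \<kappa> by (simp add: norm_mult)
  also have "of_real \<kappa> * (of_real (l / \<kappa>) - P (arg (of_real x))) = of_real l - psi \<sigma> \<theta> \<kappa> x"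
    using \<kappa> by (simp add: Psi_def right_diff_distrib flip: Psi_of_real)
  finally show ?thesis by simp
qed

lemma quad_op_coefficient:
  fixes k \<beta> :: real and N :: nat
  assumes "dirichlet_eigensystem \<Omega> A c lam v" "lam 0 = l0" and f: "f \<in> L2 \<Omega>"
  defines "q \<equiv> quad_op \<Omega> A c \<sigma> \<theta> \<kappa> k (\<lambda>z. z powr (- of_real \<beta>)) N f"
  shows "q \<in> L2 \<Omega>" and "L2_inner \<Omega> q (v i) = scalar_quad \<beta> (lam i) k N * L2_inner \<Omega> f (v i)"
proof -
  interpret D: dirichlet_eigensystem \<Omega> A c lam v by fact
  let ?p = "\<lambda>j::int. psi \<sigma> \<theta> \<kappa> (real_of_int j * k)"
  let ?r = "\<lambda>j::int. resolvent \<Omega> A c (?p j) f"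
  let ?g = "\<lambda>j::int. ?p j powr (- of_real \<beta>) * Psi' (of_real (real_of_int j * k))"
  let ?C = "of_real k / (2 * of_real pi * \<i>)"
  have pos: "0 < \<kappa> * gap / 2" using \<kappa> gap_pos by simp
  have ll: "l0 \<le> lam j" for j using D.lam0_le[of j] assms(2) by simp
  have r: "?r j \<in> L2 \<Omega>" "L2_inner \<Omega> (?r j) (v i) = L2_inner \<Omega> f (v i) / (of_real (lam i) - ?p j)" for j i
    using D.resolvent[OF f pos psi_gap[OF ll]] by blast+
  have q: "q = (\<lambda>x. ?C * (\<Sum>j = - int N..int N. ?g j * ?r j x))"
    unfolding q_def by (simp add: fun_eq_iff quad_op_def vector_derivative_at[OF psi_deriv])
  show "q \<in> L2 \<Omega>"
    unfolding q by (intro L2_scale L2_sum r)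
  have "L2_inner \<Omega> q (v i) = ?C * (\<Sum>j = - int N..int N. ?g j * L2_inner \<Omega> (?r j) (v i))"
    unfolding q L2_inner_scale_left
    by (subst L2_inner_sum_left) (auto intro: L2_scale r D.v_L2 simp: L2_inner_scale_left)
  also have "\<dots> = scalar_quad \<beta> (lam i) k N * L2_inner \<Omega> f (v i)"
    unfolding scalar_quad_def r(2) by (simp add: sum_distrib_left sum_distrib_right mult_ac)
  finally show "L2_inner \<Omega> q (v i) = scalar_quad \<beta> (lam i) k N * L2_inner \<Omega> f (v i)" .
qed

end

section \<open>The fractional equation, the moments of its data and the strip width below the
  threshold\<close>

lemma of_real_powr_cancel:
  "0 < x \<Longrightarrow> complex_of_real x powr (- of_real b) * of_real x powr of_real b = 1"
  by (simp flip: powr_add)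

context dirichlet_eigensystem
begin

text \<open>The equation holds almost everywhere, so it is compared coefficient by coefficient;
  positive eigenvalues make the principal powers mutually inverse. Square summability of the
  coefficients of u is exactly membership of f in the domain of the inverse power.\<close>

lemma fractional_solution:
  assumes u: "u \<in> fun_op_dom \<Omega> lam v (\<lambda>z. z powr of_real \<beta>)"
    and eq: "AE x in lebesgue_on \<Omega>. fun_op \<Omega> lam v (\<lambda>z. z powr of_real \<beta>) u x = f x"
    and f: "f \<in> L2 \<Omega>"
  defines "g \<equiv> \<lambda>z. z powr (- of_real \<beta>)"
  shows "u \<in> L2 \<Omega>" "L2_inner \<Omega> u (v j) = g (of_real (lam j)) * L2_inner \<Omega> f (v j)"
    and "f \<in> fun_op_dom \<Omega> lam v g"
proof -
  show uL: "u \<in> L2 \<Omega>" using u by (simp add: fun_op_dom_def)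
  have coeff: "L2_inner \<Omega> u (v j) = g (of_real (lam j)) * L2_inner \<Omega> f (v j)" for j
  proof -
    have "L2_inner \<Omega> f (v j) = of_real (lam j) powr of_real \<beta> * L2_inner \<Omega> u (v j)"
      using L2_inner_cong_AE[OF eq fun_op(1)[OF u] f v_L2] fun_op(2)[OF u] by simp
    then show ?thesis
      using of_real_powr_cancel[OF lam_pos[of j], of \<beta>] by (simp add: g_def mult.assoc[symmetric])
  qed
  then show "L2_inner \<Omega> u (v j) = g (of_real (lam j)) * L2_inner \<Omega> f (v j)" .
  show "f \<in> fun_op_dom \<Omega> lam v g"
    using f coefficients_summable[OF uL] by (simp add: fun_op_dom_def coeff)
qed

end

text \<open>At an integer order m the Gamma factor is m!, and squaring the norm bound doubles the
  exponents of R and of the factorial.\<close>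

lemma Hdot_moments:
  assumes H: "f \<in> Hdot \<Omega> lam v (real m)" "Hdot_norm \<Omega> lam v (real m) f \<le> Cf * R powr real m * Gamma (real m + 1) powr \<omega>"
    and pos: "\<And>j. 0 < lam j" "0 < Cf" "0 < R"
  shows "summable (\<lambda>j. lam j ^ m * (cmod (L2_inner \<Omega> f (v j)))\<^sup>2)"
    and "(\<Sum>j. lam j ^ m * (cmod (L2_inner \<Omega> f (v j)))\<^sup>2) \<le> Cf\<^sup>2 * (R ^ (2 * m) * fact m powr (2 * \<omega>))"
proof -
  have eq: "lam j powr real m = lam j ^ m" for j using pos by (simp add: powr_realpow)
  show s: "summable (\<lambda>j. lam j ^ m * (cmod (L2_inner \<Omega> f (v j)))\<^sup>2)"
    using H(1) by (simp add: Hdot_def eq)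
  let ?S = "\<Sum>j. lam j ^ m * (cmod (L2_inner \<Omega> f (v j)))\<^sup>2"
  have S0: "0 \<le> ?S" using s pos by (intro suminf_nonneg) (auto simp: less_imp_le)
  have "Gamma (real m + 1) = fact m" using Gamma_fact[of m, where 'a = real] by (simp add: add.commute)
  then have "sqrt ?S \<le> Cf * R ^ m * fact m powr \<omega>"
    using H(2) pos by (simp add: Hdot_norm_def eq powr_realpow)
  then have "(sqrt ?S)\<^sup>2 \<le> (Cf * R ^ m * fact m powr \<omega>)\<^sup>2"
    using S0 by (intro power_mono) auto
  also have "\<dots> = Cf\<^sup>2 * (R ^ (2 * m) * fact m powr (2 * \<omega>))"
    using powr_add[of "fact m :: real" \<omega> \<omega>]
    by (simp add: power_mult_distrib power_mult[symmetric] power2_eq_square[of "fact m powr \<omega>"] mult.commute)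
  finally show "?S \<le> Cf\<^sup>2 * (R ^ (2 * m) * fact m powr (2 * \<omega>))" using S0 by simp
qed

text \<open>The logarithm of the threshold is ln m + 2 \<omega> ln n, and n <= 1/k; \<omega> is
  therefore exactly the factor in front of |ln k|.\<close>

lemma (in de_contour) threshold_width:
  assumes l: "l0 \<le> l" "l < m * real n powr (2 * \<omega>)" and m: "0 < m" and n: "1 \<le> n" "real n \<le> 1 / k"
    and \<omega>: "0 \<le> \<omega>" and k: "0 < k" "k < 1"
  shows "pi * eps / (10 * (1 + \<bar>ln (C1 * m)\<bar> + 2 * \<omega> * \<bar>ln k\<bar>)) \<le> pi * width l"
proof -
  have C1: "0 < C1" using \<kappa> by (simp add: C1_def)
  have lpos: "0 < l" using l \<kappa> \<kappa>_less by simp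
  have "ln (C1 * l) \<le> ln (C1 * m * real n powr (2 * \<omega>))"
    using l lpos C1 by (intro ln_mono) (auto simp: mult.assoc less_imp_le)
  also have "\<dots> = ln (C1 * m) + 2 * \<omega> * ln (real n)"
    using C1 m n by (simp add: ln_mult ln_powr)
  also have "\<dots> \<le> \<bar>ln (C1 * m)\<bar> + 2 * \<omega> * \<bar>ln k\<bar>"
  proof (intro add_mono mult_left_mono)
    have "ln (real n) \<le> ln (1 / k)" using n k by (intro ln_mono) auto
    also have "\<dots> = - ln k" using k by (simp add: ln_div)
    finally show "ln (real n) \<le> \<bar>ln k\<bar>" by simp
  qed (use \<omega> in auto)
  finally have le: "ln (C1 * l) \<le> \<bar>ln (C1 * m)\<bar> + 2 * \<omega> * \<bar>ln k\<bar>" .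
  have "0 \<le> ln (C1 * l)" using C1_ge[OF l(1)] by simp
  with le have "pi * eps / (10 * (1 + \<bar>ln (C1 * m)\<bar> + 2 * \<omega> * \<bar>ln k\<bar>)) \<le> pi * eps / (10 * (1 + ln (C1 * l)))"
    using eps by (intro divide_left_mono) auto
  then show ?thesis by (simp add: width_def)
qed

text \<open>The order of quantifiers carries the independence claims: \<gamma> is fixed before any
  upper bound on \<beta>, C after \<open>\<beta>max\<close>, and both before the domain, the
  coefficients, the data, k and N.\<close>

theorem corollary3p9:
  fixes \<sigma> \<theta> \<kappa> lam0 \<omega> R\<^sub>f \<beta>bar :: real
  assumes "\<sigma> \<in> {1/2, 1}" and "1 \<le> \<theta>" and "0 < \<kappa>" and "\<kappa> < lam0"
    and "0 \<le> \<omega>" and "0 < R\<^sub>f" and "0 < \<beta>bar"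
  shows "\<exists>\<gamma>>0. \<forall>\<beta>max. \<exists>C>0.
    \<forall>(\<Omega> :: (real ^ 'n) set) A c lam v \<beta> f u C\<^sub>f k N.
      admissible_problem \<Omega> A c \<longrightarrow>
      eigensystem \<Omega> A c lam v \<longrightarrow>
      lam 0 = lam0 \<longrightarrow>
      \<beta>bar < \<beta> \<longrightarrow> \<beta> \<le> \<beta>max \<longrightarrow>
      u \<in> fun_op_dom \<Omega> lam v (\<lambda>z. z powr complex_of_real \<beta>) \<longrightarrow>
      (AE x in lebesgue_on \<Omega>. fun_op \<Omega> lam v (\<lambda>z. z powr complex_of_real \<beta>) u x = f x) \<longrightarrow>
      0 < C\<^sub>f \<longrightarrow>
      (\<forall>\<rho>\<ge>0. f \<in> Hdot \<Omega> lam v \<rho> \<and>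
              Hdot_norm \<Omega> lam v \<rho> f \<le> C\<^sub>f * R\<^sub>f powr \<rho> * Gamma (\<rho> + 1) powr \<omega>) \<longrightarrow>
      0 < k \<longrightarrow> k < 1/2 \<longrightarrow>
      (let g = (\<lambda>z. z powr (- complex_of_real \<beta>));
           err = (\<lambda>x. u x - quad_op \<Omega> A c \<sigma> \<theta> \<kappa> k g N f x);
           E = quad_error \<Omega> A c lam v \<sigma> \<theta> \<kappa> k g N f
       in err \<in> Hdot \<Omega> lam v \<beta> \<and> E \<in> Hdot \<Omega> lam v \<beta> \<and>
          Hdot_norm \<Omega> lam v \<beta> err = Hdot_norm \<Omega> lam v \<beta> E \<and>
          Hdot_norm \<Omega> lam v \<beta> E
            \<le> C * (C\<^sub>f * exp (- \<gamma> / (k * \<bar>ln k\<bar>)) + C\<^sub>f * exp (- \<gamma> * exp (k * real N))) \<and>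
          (\<omega> = 0 \<longrightarrow> Hdot_norm \<Omega> lam v \<beta> E
            \<le> C * (C\<^sub>f * exp (- \<gamma> / k) + C\<^sub>f * exp (- \<gamma> * exp (k * real N)))))"
proof -
  interpret de_contour \<sigma> \<theta> \<kappa> lam0 using assms by unfold_locales
  define m where "m = exp 2 * R\<^sub>f\<^sup>2 * 4 powr \<omega>"
  have m: "0 < m" using assms by (simp add: m_def)
  define a where "a = 1 + \<bar>ln (C1 * m)\<bar>"
  have a: "1 \<le> a" by (simp add: a_def)
  \<comment> \<open>The entries serve, in order: the part of the spectrum above the threshold, using
    |ln k| >= ln 2; the strip term for \<omega> = 0; the strip term in general; the
    truncation.\<close>
  define \<gamma> where "\<gamma> = Min {ln 2, pi * eps / (10 * a), pi * eps / (10 * (a / ln 2 + 2 * \<omega>)), \<beta>bar / 8}"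
  have l2: "0 < ln (2 :: real)" by simp
  have a2: "0 < a / ln 2 + 2 * \<omega>" using a l2 \<open>0 \<le> \<omega>\<close> by (intro add_pos_nonneg) auto
  then have "0 < \<gamma>"
    using a eps \<open>0 < \<beta>bar\<close> by (simp add: \<gamma>_def)
  moreover have "\<gamma> \<le> ln 2" "\<gamma> \<le> pi * eps / (10 * a)" "\<gamma> \<le> pi * eps / (10 * (a / ln 2 + 2 * \<omega>))" "\<gamma> \<le> \<beta>bar / 8"
    unfolding \<gamma>_def by (rule Min_le; simp)+
  ultimately have \<gamma>: "0 < \<gamma>" "\<gamma> \<le> ln 2" "\<gamma> \<le> pi * eps / (10 * a)" "\<gamma> \<le> pi * eps / (10 * (a / ln 2 + 2 * \<omega>))" "\<gamma> \<le> \<beta>bar / 8"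
    by this+
  have ln2: "ln 2 \<le> (1 :: real)" using ln_le_minus_one[of 2] by simp
  show ?thesis
  proof (rule exI[of _ \<gamma>], rule conjI[OF \<gamma>(1)], rule allI, goal_cases)
    case (1 \<beta>max)
    obtain C0 where C0: "C0 > 0" "\<And>\<beta> l k N. \<beta>bar < \<beta> \<Longrightarrow> \<beta> \<le> \<beta>max \<Longrightarrow> lam0 \<le> l \<Longrightarrow> 0 < k \<Longrightarrow> k < 1 / 2 \<Longrightarrow>
      cmod (complex_of_real l powr (- complex_of_real \<beta>) - scalar_quad \<beta> l k N)
        \<le> C0 * l * (exp (- (pi * width l / k)) + exp (- (\<beta>bar / 8 * exp (k * real N))))"
      using scalar_error[OF \<open>0 < \<beta>bar\<close>, of \<beta>max] by blast
    define p where "p = nat \<lceil>\<beta>max\<rceil>"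
    define q where "q = p + 2"
    define C' where "C' = C0 * sqrt (2 * exp (real p * \<bar>ln lam0\<bar>) * (R\<^sub>f ^ (2 * q) * (2 ^ q * fact q) powr (2 * \<omega>)))"
    have C': "0 < C'" using C0(1) \<open>0 < R\<^sub>f\<close> by (simp add: C'_def)
    \<comment> \<open>4 = 1 + 3: the strip term once, and the part above the threshold with the
      factor 3 lost in rounding.\<close>
    define C where "C = 4 * C'"
    have Cpos: "0 < C" using C' by (simp add: C_def)
    have estimate: "err \<in> Hdot \<Omega> lam v \<beta> \<and> E \<in> Hdot \<Omega> lam v \<beta> \<and>
          Hdot_norm \<Omega> lam v \<beta> err = Hdot_norm \<Omega> lam v \<beta> E \<and>
          Hdot_norm \<Omega> lam v \<beta> E
            \<le> C * (C\<^sub>f * exp (- \<gamma> / (k * \<bar>ln k\<bar>)) + C\<^sub>f * exp (- \<gamma> * exp (k * real N))) \<and>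
          (\<omega> = 0 \<longrightarrow> Hdot_norm \<Omega> lam v \<beta> E
            \<le> C * (C\<^sub>f * exp (- \<gamma> / k) + C\<^sub>f * exp (- \<gamma> * exp (k * real N))))"
      if adm: "admissible_problem \<Omega> A c" and eig: "eigensystem \<Omega> A c lam v" and lam0: "lam 0 = lam0"
        and \<beta>: "\<beta>bar < \<beta>" "\<beta> \<le> \<beta>max"
        and u: "u \<in> fun_op_dom \<Omega> lam v (\<lambda>z. z powr complex_of_real \<beta>)"
        and eq: "AE x in lebesgue_on \<Omega>. fun_op \<Omega> lam v (\<lambda>z. z powr complex_of_real \<beta>) u x = f x"
        and Cf: "0 < C\<^sub>f"
        and H: "\<forall>\<rho>\<ge>0. f \<in> Hdot \<Omega> lam v \<rho> \<and> Hdot_norm \<Omega> lam v \<rho> f \<le> C\<^sub>f * R\<^sub>f powr \<rho> * Gamma (\<rho> + 1) powr \<omega>"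
        and k: "0 < k" "k < 1/2"
        and g_def: "g = (\<lambda>z. z powr (- complex_of_real \<beta>))"
        and err_def: "err = (\<lambda>x. u x - quad_op \<Omega> A c \<sigma> \<theta> \<kappa> k g N f x)"
        and E_def: "E = quad_error \<Omega> A c lam v \<sigma> \<theta> \<kappa> k g N f"
      for \<Omega> :: "(real ^ 'n) set" and A c lam v \<beta> f u C\<^sub>f k N g err E
    proof -
      interpret D: dirichlet_eigensystem \<Omega> A c lam v
        using adm eig lam0 assms by unfold_locales auto
      have f: "f \<in> L2 \<Omega>" using H by (auto simp: Hdot_def)
      note sol = D.fractional_solution[OF u eq f, folded g_def]
      note quad = quad_op_coefficient[OF D.dirichlet_eigensystem_axioms lam0 f, of k \<beta> N, folded g_def]
      let ?s = "\<lambda>j. complex_of_real (lam j) powr (- complex_of_real \<beta>) - scalar_quad \<beta> (lam j) k N"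
      have errL: "err \<in> L2 \<Omega>" unfolding err_def by (intro L2_diff sol quad)
      have EL: "E \<in> L2 \<Omega>"
        unfolding E_def quad_error_def[abs_def] by (intro L2_diff D.fun_op(1) sol quad)
      have ec: "L2_inner \<Omega> err (v j) = ?s j * L2_inner \<Omega> f (v j)" for j
        unfolding err_def L2_inner_diff_left[OF sol(1) quad(1) D.v_L2] sol(2) quad(2) by (simp add: g_def left_diff_distrib)
      have Ec: "L2_inner \<Omega> E (v j) = ?s j * L2_inner \<Omega> f (v j)" for j
        unfolding E_def quad_error_def[abs_def] L2_inner_diff_left[OF D.fun_op(1)[OF sol(3)] quad(1) D.v_L2] D.fun_op(2)[OF sol(3)] quad(2)
        by (simp add: g_def left_diff_distrib)
      \<comment> \<open>The extra moment order is matched to the target rate: the part above the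
        threshold then contributes exp (-n), about exp (-1/k).\<close>
      define n where "n = nat \<lfloor>1 / k\<rfloor>"
      have n: "1 \<le> n" "real n \<le> 1 / k" "1 / k \<le> real n + 1"
      proof -
        have "2 < 1 / k" using k by (simp add: field_simps)
        then show "1 \<le> n" "real n \<le> 1 / k" "1 / k \<le> real n + 1" unfolding n_def by linarith+
      qed
      define W where "W = pi * eps / (10 * (a + 2 * \<omega> * \<bar>ln k\<bar>))"
      define T where "T = exp (- (\<beta>bar / 8 * exp (k * real N)))"
      have ll: "lam0 \<le> lam j" for j using D.lam0_le[of j] lam0 by simp
      have lpos: "0 < lam0" using assms by simp
      note mom = Hdot_moments[OF conjunct1[OF H[rule_format]] conjunct2[OF H[rule_format]] D.lam_pos Cf \<open>0 < R\<^sub>f\<close>]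
      let ?D = "\<lambda>j. exp (- (pi * width (lam j) / k))"
      have D_low: "?D j \<le> exp (- (W / k))" if "lam j < m * real n powr (2 * \<omega>)" for j
      proof -
        have "W \<le> pi * width (lam j)"
          using threshold_width[OF ll that m n(1,2) \<open>0 \<le> \<omega>\<close> k(1)] k(2) unfolding W_def a_def by simp
        then have "W / k \<le> pi * width (lam j) / k" using k by (intro divide_right_mono) auto
        then show ?thesis by simp
      qed
      have D1: "?D j \<le> 1" for j using width(1)[OF ll[of j]] k by simp
      have s_bound: "cmod (?s j) \<le> C0 * lam j * (?D j + T)" for j
        unfolding T_def by (intro C0 \<beta> ll k)
      have \<beta>p: "0 \<le> \<beta>" "\<beta> \<le> real p" using \<beta> assms unfolding p_def by linarith+
      have sq0: "0 \<le> (cmod (L2_inner \<Omega> f (v j)))\<^sup>2" "0 \<le> cmod (?s j)" "0 \<le> ?D j" for j by auto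
      have T0: "0 \<le> T" "0 \<le> exp (- (W / k))" by (auto simp: T_def)
      have \<Lambda>: "m * real n powr (2 * \<omega>) = exp 2 * R\<^sub>f\<^sup>2 * 4 powr \<omega> * real n powr (2 * \<omega>)" by (simp add: m_def)
      note sums = weighted_error_sum[where D = ?D and lam = lam and ?l0.0 = lam0, OF lpos ll sq0(1) \<open>0 < R\<^sub>f\<close> \<open>0 \<le> \<omega>\<close> Cf mom n(1) \<Lambda>
          sq0(2) s_bound C0(1) T0(1) sq0(3) D1 D_low T0(2) \<beta>p q_def]
      have S: "summable (\<lambda>j. lam j powr \<beta> * (cmod (?s j * L2_inner \<Omega> f (v j)))\<^sup>2)"
        using sums(1) by (simp add: norm_mult power_mult_distrib)
      have norm: "Hdot_norm \<Omega> lam v \<beta> E \<le> C' * (C\<^sub>f * (T + exp (- (W / k)) + exp (- real n)))"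
        using sums(2) by (simp only: Hdot_norm_def Ec norm_mult power_mult_distrib C'_def)
      \<comment> \<open>Rounding 1/k down costs at most a factor e.\<close>
      have en: "exp (- real n) \<le> 3 * exp (- (1 / k))"
      proof -
        have "exp (- real n) \<le> exp (1 + - (1 / k))" using n by simp
        also have "\<dots> = exp 1 * exp (- (1 / k))" by (simp only: exp_add)
        also have "\<dots> \<le> 3 * exp (- (1 / k))" using exp_le by (intro mult_right_mono) auto
        finally show ?thesis .
      qed
      have T: "T \<le> exp (- \<gamma> * exp (k * real N))"
        unfolding T_def using \<gamma>(5) by simp
      have lnk: "ln 2 \<le> \<bar>ln k\<bar>"
      proof -
        have "ln k \<le> ln (1 / 2)" using k by (intro ln_mono) auto
        then show ?thesis by (simp add: ln_div)
      qed
      then have lnk0: "0 < \<bar>ln k\<bar>" using l2 by linarith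
      have combine: "Hdot_norm \<Omega> lam v \<beta> E \<le> C * (C\<^sub>f * exp (- G) + C\<^sub>f * exp (- \<gamma> * exp (k * real N)))"
        if "G \<le> W / k" "G \<le> 1 / k" for G
      proof -
        have "T + exp (- (W / k)) + exp (- real n) \<le> exp (- \<gamma> * exp (k * real N)) + exp (- G) + 3 * exp (- G)"
          using T en that by (intro add_mono) (auto intro: order_trans[OF en])
        also have "\<dots> \<le> 4 * (exp (- G) + exp (- \<gamma> * exp (k * real N)))" by simp
        finally have "C' * (C\<^sub>f * (T + exp (- (W / k)) + exp (- real n)))
            \<le> C' * (C\<^sub>f * (4 * (exp (- G) + exp (- \<gamma> * exp (k * real N)))))"
          using C' Cf by (intro mult_left_mono) auto
        also have "\<dots> = C * (C\<^sub>f * exp (- G) + C\<^sub>f * exp (- \<gamma> * exp (k * real N)))"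
          by (simp add: C_def algebra_simps)
        finally show ?thesis using norm by linarith
      qed
      have "\<gamma> / (k * \<bar>ln k\<bar>) \<le> W / k"
      proof -
        \<comment> \<open>|ln k| >= ln 2 lets the constant part of the denominator of
          \<open>W\<close> be absorbed into the multiple of |ln k|.\<close>
        have "a \<le> a / ln 2 * \<bar>ln k\<bar>" using mult_left_mono[OF lnk, of "a / ln 2"] a l2 by simp
        then have "a + 2 * \<omega> * \<bar>ln k\<bar> \<le> (a / ln 2 + 2 * \<omega>) * \<bar>ln k\<bar>" by (simp add: distrib_right)
        moreover have "0 < a + 2 * \<omega> * \<bar>ln k\<bar>" using a \<open>0 \<le> \<omega>\<close> by (intro add_pos_nonneg) auto
        ultimately have "pi * eps / (10 * ((a / ln 2 + 2 * \<omega>) * \<bar>ln k\<bar>)) \<le> W"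
          unfolding W_def using eps a2 lnk0 by (intro divide_left_mono mult_pos_pos) auto
        moreover have "\<gamma> / \<bar>ln k\<bar> \<le> pi * eps / (10 * (a / ln 2 + 2 * \<omega>)) / \<bar>ln k\<bar>"
          using \<gamma>(4) by (intro divide_right_mono) auto
        moreover have "pi * eps / (10 * (a / ln 2 + 2 * \<omega>)) / \<bar>ln k\<bar> = pi * eps / (10 * ((a / ln 2 + 2 * \<omega>) * \<bar>ln k\<bar>))"
          by (simp only: divide_divide_eq_left mult.assoc)
        ultimately have "\<gamma> / \<bar>ln k\<bar> \<le> W" by linarith
        then have "\<gamma> / \<bar>ln k\<bar> / k \<le> W / k" using k by (intro divide_right_mono) auto
        then show ?thesis by (simp add: mult.commute)
      qed
      moreover have "\<gamma> / (k * \<bar>ln k\<bar>) \<le> 1 / k"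
      proof -
        have "\<gamma> / \<bar>ln k\<bar> \<le> 1" using \<gamma>(2) lnk lnk0 by simp
        then have "\<gamma> / \<bar>ln k\<bar> / k \<le> 1 / k" using k by (intro divide_right_mono) auto
        then show ?thesis by (simp add: mult.commute)
      qed
      ultimately have gen: "Hdot_norm \<Omega> lam v \<beta> E \<le> C * (C\<^sub>f * exp (- \<gamma> / (k * \<bar>ln k\<bar>)) + C\<^sub>f * exp (- \<gamma> * exp (k * real N)))"
        using combine[of "\<gamma> / (k * \<bar>ln k\<bar>)"] by simp
      \<comment> \<open>With \<omega> = 0, \<open>W\<close> is independent of k.\<close>
      have band: "Hdot_norm \<Omega> lam v \<beta> E \<le> C * (C\<^sub>f * exp (- \<gamma> / k) + C\<^sub>f * exp (- \<gamma> * exp (k * real N)))" if "\<omega> = 0"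
      proof -
        have "\<gamma> / k \<le> W / k" using \<gamma>(3) that k by (intro divide_right_mono) (auto simp: W_def)
        moreover have "\<gamma> / k \<le> 1 / k" using \<gamma>(2) ln2 k by (intro divide_right_mono) auto
        ultimately show ?thesis using combine[of "\<gamma> / k"] by simp
      qed
      show ?thesis
        using errL EL S gen band by (auto simp: Hdot_def Hdot_norm_def ec Ec)
    qed
    show ?case
      unfolding Let_def
      by (rule exI[of _ C], rule conjI[OF Cpos], (rule allI)+, (rule impI)+, rule estimate; (assumption | rule refl))
  qed
qed

end
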